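(* Let $\Bbbk$ be an algebraically closed field of characteristic $p>0$, $q=p^r$ with $r\ge 1$, $n\ge 2$, $G=SL_n(\mathbb{F}_q)$ acting tautologically on $\mathfrak{h}=\Bbbk^n$, and let $c$ be a conjugation-invariant function from the set of reflections of $G$ to $\Bbbk$. The characters and Hilbert series of the irreducible modules $L_{0,c}(\mathrm{triv})$ for the rational Cherednik algebra $H_{0,c}(SL_n(\mathbb{F}_q),\mathfrak{h})$ are as follows. (1) If $(q,n)\neq(2,2)$, then for every $c$: $\chi_{L_{0,c}(\mathrm{triv})}(z)=[\mathrm{triv}]$ and $\mathrm{Hilb}_{L_{0,c}(\mathrm{triv})}(z)=1$. (2) If $(q,n)=(2,2)$ and $c=0$: $\chi_{L_{0,c}(\mathrm{triv})}(z)=[\mathrm{triv}]$ and $\mathrm{Hilb}_{L_{0,c}(\mathrm{triv})}(z)=1$. (3) If $(q,n)=(2,2)$ and $c\neq0$: $$\chi_{L_{0,c}(\mathrm{triv})}(z)=[\mathrm{triv}]+[\mathfrak{h}^*]z+([S^2\mathfrak{h}^*]-[\mathrm{triv}])z^2+([S^3\mathfrak{h}^*]-[\mathfrak{h}^*]-[\mathrm{triv}])z^3$$ and $\mathrm{Hilb}_{L_{0,c}(\mathrm{triv})}(z)=1+2z+2z^2+z^3$.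
   Context: Let $\Bbbk$ be an algebraically closed field of characteristic $p>0$, $G$ a finite group, $\mathfrak{h}$ a faithful $n$-dimensional representation of $G$ over $\Bbbk$ (so $G\subseteq GL(\mathfrak{h})$), $\mathfrak{h}^*$ the dual representation, $(g.y,x)=(y,g^{-1}.x)$, and $(\cdot,\cdot)$ the canonical pairing. A reflection is an element $s\in GL(\mathfrak{h})$ such that $1-s$ has rank $1$ on $\mathfrak{h}$; $S$ is the set of reflections in $G$. For $s\in S$ choose $\alpha_s\in\mathfrak{h}^*$, $\alpha_s^\vee\in\mathfrak{h}$ with $s.x=x-(\alpha_s^\vee,x)\alpha_s$ for all $x\in\mathfrak{h}^*$. Let $t\in\Bbbk$ and let $c:S\to\Bbbk$, $s\mapsto c_s$, be conjugation invariant. The rational Cherednik algebra $H_{t,c}(G,\mathfrak{h})$ is the quotient of $\Bbbk G\ltimes T(\mathfrak{h}\oplus\mathfrak{h}^* )$ by the relations $[x,x']=0$, $[y,y']=0$, $[y,x]=(y,x)t-\sum_{s\in S}c_s((1-s).x,y)s$ for $x,x'\in\mathfrak{h}^*$, $y,y'\in\mathfrak{h}$. It is $\mathbb{Z}$-graded by $\deg x=1$, $\deg y=-1$, $\deg g=0$. For an irreducible finite-dimensional $G$-representation $\tau$ over $\Bbbk$, the Verma module is $M_{t,c}(\tau)=M_{t,c}(G,\mathfrak{h},\tau)=H_{t,c}(G,\mathfrak{h})\otimes_{\Bbbk G\ltimes S\mathfrak{h}}\tau$, where $\mathfrak{h}$ acts on $\tau$ by zero. As a graded space it is $S\mathfrak{h}^*\otimes\tau$,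 with $x\in\mathfrak{h}^*$ acting by multiplication, $g\in G$ diagonally, and $y\in\mathfrak{h}$ by the Dunkl operator $D_y=t\partial_y\otimes1-\sum_{s\in S}c_s\frac{(y,\alpha_s)}{\alpha_s}(1-s)\otimes s$. Contravariant form: let $\bar c(s)=c(s^{-1})$. The restricted dual $M^\dagger$ of a graded module $M$ with finite-dimensional pieces has $i$-th graded piece $(M_i)^*$. The isomorphism $H_{t,c}(G,\mathfrak{h})^{opp}\cong H_{t,\bar c}(G,\mathfrak{h}^* )$, identity on $\mathfrak{h},\mathfrak{h}^*$ and $g\mapsto g^{-1}$, makes $M_{t,\bar c}(G,\mathfrak{h}^*,\tau^* )^\dagger$ an $H_{t,c}(G,\mathfrak{h})$-module. Let $\phi:M_{t,c}(G,\mathfrak{h},\tau)\to M_{t,\bar c}(G,\mathfrak{h}^*,\tau^* )^\dagger$ be the unique homomorphism that is the identity on the lowest graded piece $\tau$; equivalently, it is a bilinear form $B:M_{t,c}(G,\mathfrak{h},\tau)\times M_{t,\bar c}(G,\mathfrak{h}^*,\tau^* )\to\Bbbk$. Put $\ker B=\ker\phi$ and $L_{t,c}(\tau)=M_{t,c}(\tau)/\ker B$, a graded module. $\mathrm{triv}$ is the trivial one-dimensional representation of $G$. $K_0(G)$ is the Grothendieck group of finite-dimensional $G$-representations over $\Bbbk$; for a graded module $M=\oplus_iM_i$, $\chi_M(z)=\sum_i[M_i]z^i$ and $\mathrm{Hilb}_M(z)=\sum_i\dim(M_i)z^i$. For $(q,n)=(2,2)$ there is only one conjugacy class of reflections in $G$,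 so $c$ is identified with a single element of $\Bbbk$. *)

theory Defs
  imports
    "HOL-Analysis.Determinants"
    "HOL-Library.Poly_Mapping"
    "HOL-Algebra.QuotRing"
    "HOL-Algebra.Subrings"
    "HOL-Algebra.Free_Abelian_Groups"
    "HOL-Algebra.Algebraic_Closure_Type"
    "Jordan_Normal_Form.Missing_VectorSpace"
begin

text \<open>
  The ground field is a type \<open>'k\<close>.  A finite group \<open>G\<close> is a HOL-Algebra group; a representation on
  \<open>k\<^sup>n\<close> is a function from group elements to matrices.  The dual of \<open>k\<^sup>n\<close> is identified with
  \<open>k\<^sup>n\<close> through the dual basis, so that the canonical pairing is the standard bilinear form.
\<close>

abbreviation base_field :: "'k::field ring" where
  "base_field \<equiv> ring_of_type_algebra"

definition pairing :: "'k::field^'n \<Rightarrow> 'k^'n \<Rightarrow> 'k" where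
  "pairing y x = (\<Sum>i\<in>UNIV. y $ i * x $ i)"

text \<open>\<open>(g.y, x) = (y, g\<^sup>-\<^sup>1.x)\<close>\<close>

definition dual_rep :: "('g, 'm) monoid_scheme \<Rightarrow> ('g \<Rightarrow> 'k::field^'n^'n) \<Rightarrow> 'g \<Rightarrow> 'k^'n^'n" where
  "dual_rep G \<rho> g = transpose (\<rho> (inv\<^bsub>G\<^esub> g))"

definition reflections :: "('g, 'm) monoid_scheme \<Rightarrow> ('g \<Rightarrow> 'k::field^'n^'n) \<Rightarrow> 'g set" where
  "reflections G \<rho> = {s \<in> carrier G. rank (mat 1 - \<rho> s) = 1}"

definition conj_invariant ::
  "('g, 'm) monoid_scheme \<Rightarrow> ('g \<Rightarrow> 'k::field^'n^'n) \<Rightarrow> ('g \<Rightarrow> 'k) \<Rightarrow> bool" where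
  "conj_invariant G \<rho> c \<longleftrightarrow>
     (\<forall>s \<in> reflections G \<rho>. \<forall>g \<in> carrier G. c (g \<otimes>\<^bsub>G\<^esub> s \<otimes>\<^bsub>G\<^esub> inv\<^bsub>G\<^esub> g) = c s)"


section \<open>The rational Cherednik algebra\<close>

text \<open>
  The free associative algebra on a set of letters is the monoid algebra of the free monoid;
  multiplication of \<^type>\<open>poly_mapping\<close> is convolution with respect to \<open>+\<close>, so the free monoid is
  written additively (and is of course not commutative).
\<close>

datatype 'a free_monoid = Word (letters: "'a list")

instantiation free_monoid :: (type) monoid_add
begin

definition zero_free_monoid :: "'a free_monoid" where
  "zero_free_monoid = Word []"

definition plus_free_monoid :: "'a free_monoid \<Rightarrow> 'a free_monoid \<Rightarrow> 'a free_monoid" where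
  "plus_free_monoid v w = Word (letters v @ letters w)"

instance
  by standard (simp_all add: zero_free_monoid_def plus_free_monoid_def)

end

text \<open>Letters: group elements, the basis of \<open>h\<close>, and the dual basis of \<open>h\<^sup>*\<close>.\<close>

datatype ('g, 'n) gen = GenG 'g | GenY 'n | GenX 'n

type_synonym ('g, 'n, 'k) free_alg = "('g, 'n) gen free_monoid \<Rightarrow>\<^sub>0 'k"

definition scalar :: "'k::field \<Rightarrow> ('g, 'n, 'k) free_alg" where
  "scalar a = Poly_Mapping.single 0 a"

definition grp :: "'g \<Rightarrow> ('g, 'n, 'k::field) free_alg" where
  "grp g = Poly_Mapping.single (Word [GenG g]) 1"

definition yvec :: "'k::field^'n \<Rightarrow> ('g, 'n, 'k) free_alg" where
  "yvec v = (\<Sum>i\<in>UNIV. Poly_Mapping.single (Word [GenY i]) (v $ i))"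

definition xvec :: "'k::field^'n \<Rightarrow> ('g, 'n, 'k) free_alg" where
  "xvec v = (\<Sum>i\<in>UNIV. Poly_Mapping.single (Word [GenX i]) (v $ i))"

text \<open>
  Relations presenting \<open>kG \<ltimes> T(h \<oplus> h\<^sup>*)\<close>: those of \<open>G\<close>, and \<open>g v = (g.v) g\<close>.  Elements of the type
  \<open>'g\<close> outside \<open>carrier G\<close> are letters too; the first set removes them.
\<close>

definition smash_rels ::
  "('g, 'm) monoid_scheme \<Rightarrow> ('g \<Rightarrow> 'k::field^'n^'n) \<Rightarrow> ('g, 'n, 'k) free_alg set" where
  "smash_rels G \<rho> =
     {grp g | g. g \<notin> carrier G}
   \<union> {grp \<one>\<^bsub>G\<^esub> - 1}
   \<union> {grp (g \<otimes>\<^bsub>G\<^esub> h) - grp g * grp h | g h. g \<in> carrier G \<and> h \<in> carrier G}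
   \<union> {grp g * yvec y - yvec (\<rho> g *v y) * grp g | g y. g \<in> carrier G}
   \<union> {grp g * xvec x - xvec (dual_rep G \<rho> g *v x) * grp g | g x. g \<in> carrier G}"

definition commutator_rels ::
  "('g, 'm) monoid_scheme \<Rightarrow> ('g \<Rightarrow> 'k::field^'n^'n) \<Rightarrow> 'k \<Rightarrow> ('g \<Rightarrow> 'k)
     \<Rightarrow> ('g, 'n, 'k) free_alg set" where
  "commutator_rels G \<rho> t c =
     {xvec x * xvec x' - xvec x' * xvec x | x x'. True}
   \<union> {yvec y * yvec y' - yvec y' * yvec y | y y'. True}
   \<union> {(yvec y * xvec x - xvec x * yvec y)
       - (scalar (pairing y x * t)
          - (\<Sum>s\<in>reflections G \<rho>. scalar (c s * pairing y (x - dual_rep G \<rho> s *v x)) * grp s))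
      | x y. True}"

definition rca_ideal ::
  "('g, 'm) monoid_scheme \<Rightarrow> ('g \<Rightarrow> 'k::field^'n^'n) \<Rightarrow> 'k \<Rightarrow> ('g \<Rightarrow> 'k)
     \<Rightarrow> ('g, 'n, 'k) free_alg set" where
  "rca_ideal G \<rho> t c =
     Idl\<^bsub>ring_of_type_algebra\<^esub> (smash_rels G \<rho> \<union> commutator_rels G \<rho> t c)"

definition rca ::
  "('g, 'm) monoid_scheme \<Rightarrow> ('g \<Rightarrow> 'k::field^'n^'n) \<Rightarrow> 'k \<Rightarrow> ('g \<Rightarrow> 'k)
     \<Rightarrow> ('g, 'n, 'k) free_alg set ring" where
  "rca G \<rho> t c = ring_of_type_algebra Quot rca_ideal G \<rho> t c"

definition rca_class ::
  "('g, 'm) monoid_scheme \<Rightarrow> ('g \<Rightarrow> 'k::field^'n^'n) \<Rightarrow> 'k \<Rightarrow> ('g \<Rightarrow> 'k)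
     \<Rightarrow> ('g, 'n, 'k) free_alg \<Rightarrow> ('g, 'n, 'k) free_alg set" where
  "rca_class G \<rho> t c a = rca_ideal G \<rho> t c +>\<^bsub>ring_of_type_algebra\<^esub> a"

fun gen_degree :: "('g, 'n) gen \<Rightarrow> int" where
  "gen_degree (GenG g) = 0"
| "gen_degree (GenY i) = -1"
| "gen_degree (GenX i) = 1"

definition word_degree :: "('g, 'n) gen free_monoid \<Rightarrow> int" where
  "word_degree w = sum_list (map gen_degree (letters w))"

definition rca_piece ::
  "('g, 'm) monoid_scheme \<Rightarrow> ('g \<Rightarrow> 'k::field^'n^'n) \<Rightarrow> 'k \<Rightarrow> ('g \<Rightarrow> 'k) \<Rightarrow> int
     \<Rightarrow> ('g, 'n, 'k) free_alg set set" where
  "rca_piece G \<rho> t c i =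
     rca_class G \<rho> t c ` {a. \<forall>w \<in> Poly_Mapping.keys a. word_degree w = i}"


section \<open>Verma modules\<close>

text \<open>
  Left modules over a (non-commutative) ring are instances of the record \<^typ>\<open>('a, 'b) module\<close>, whose
  fields \<open>mult\<close> and \<open>one\<close> are inherited from rings and have no meaning for modules.
\<close>

definition quot_module :: "('a, 'b) module \<Rightarrow> 'b set \<Rightarrow> ('a, 'b set) module" where
  "quot_module M N =
     \<lparr>carrier = a_rcosets\<^bsub>M\<^esub> N, mult = (\<lambda>_ _. N), one = N, zero = N,
      add = (\<lambda>A B. A <+>\<^bsub>M\<^esub> B),
      module.smult = (\<lambda>a A. \<Union>m\<in>A. N +>\<^bsub>M\<^esub> (a \<odot>\<^bsub>M\<^esub> m))\<rparr>"

text \<open>\<open>H \<otimes>\<^sub>k k\<^sup>d\<close>, realised as \<open>H\<^sup>d\<close>, and its elements \<open>h \<otimes> v\<close>.\<close>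

definition tensor_module ::
  "('g, 'm) monoid_scheme \<Rightarrow> ('g \<Rightarrow> 'k::field^'n^'n) \<Rightarrow> 'k \<Rightarrow> ('g \<Rightarrow> 'k)
     \<Rightarrow> (('g, 'n, 'k) free_alg set, 'd \<Rightarrow> ('g, 'n, 'k) free_alg set) module" where
  "tensor_module G \<rho> t c =
     \<lparr>carrier = {f. \<forall>j. f j \<in> carrier (rca G \<rho> t c)},
      mult = (\<lambda>_ _ _. \<zero>\<^bsub>rca G \<rho> t c\<^esub>), one = (\<lambda>_. \<zero>\<^bsub>rca G \<rho> t c\<^esub>),
      zero = (\<lambda>_. \<zero>\<^bsub>rca G \<rho> t c\<^esub>),
      add = (\<lambda>f f' j. f j \<oplus>\<^bsub>rca G \<rho> t c\<^esub> f' j),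
      module.smult = (\<lambda>a f j. a \<otimes>\<^bsub>rca G \<rho> t c\<^esub> f j)\<rparr>"

definition pure_tensor ::
  "('g, 'm) monoid_scheme \<Rightarrow> ('g \<Rightarrow> 'k::field^'n^'n) \<Rightarrow> 'k \<Rightarrow> ('g \<Rightarrow> 'k)
     \<Rightarrow> ('g, 'n, 'k) free_alg set \<Rightarrow> 'k^'d \<Rightarrow> 'd \<Rightarrow> ('g, 'n, 'k) free_alg set" where
  "pure_tensor G \<rho> t c h v = (\<lambda>j. rca_class G \<rho> t c (scalar (v $ j)) \<otimes>\<^bsub>rca G \<rho> t c\<^esub> h)"

text \<open>
  The relations \<open>h a \<otimes> v = h \<otimes> a v\<close> of the tensor product over \<open>kG \<ltimes> Sh\<close>, for \<open>a\<close> in the generating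
  set \<open>G \<union> h\<close> of that algebra; \<open>h\<close> acts on \<open>\<tau>\<close> by zero.
\<close>

definition verma_rels ::
  "('g, 'm) monoid_scheme \<Rightarrow> ('g \<Rightarrow> 'k::field^'n^'n) \<Rightarrow> 'k \<Rightarrow> ('g \<Rightarrow> 'k) \<Rightarrow> ('g \<Rightarrow> 'k^'d^'d)
     \<Rightarrow> ('d \<Rightarrow> ('g, 'n, 'k) free_alg set) set" where
  "verma_rels G \<rho> t c \<tau> =
     {pure_tensor G \<rho> t c (h \<otimes>\<^bsub>rca G \<rho> t c\<^esub> rca_class G \<rho> t c (grp g)) v
        \<ominus>\<^bsub>tensor_module G \<rho> t c\<^esub> pure_tensor G \<rho> t c h (\<tau> g *v v)
      | h g v. h \<in> carrier (rca G \<rho> t c) \<and> g \<in> carrier G}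
   \<union> {pure_tensor G \<rho> t c (h \<otimes>\<^bsub>rca G \<rho> t c\<^esub> rca_class G \<rho> t c (yvec y)) v
      | h y v. h \<in> carrier (rca G \<rho> t c)}"

definition verma_null ::
  "('g, 'm) monoid_scheme \<Rightarrow> ('g \<Rightarrow> 'k::field^'n^'n) \<Rightarrow> 'k \<Rightarrow> ('g \<Rightarrow> 'k) \<Rightarrow> ('g \<Rightarrow> 'k^'d^'d)
     \<Rightarrow> ('d \<Rightarrow> ('g, 'n, 'k) free_alg set) set" where
  "verma_null G \<rho> t c \<tau> = generate (add_monoid (tensor_module G \<rho> t c)) (verma_rels G \<rho> t c \<tau>)"

definition verma ::
  "('g, 'm) monoid_scheme \<Rightarrow> ('g \<Rightarrow> 'k::field^'n^'n) \<Rightarrow> 'k \<Rightarrow> ('g \<Rightarrow> 'k) \<Rightarrow> ('g \<Rightarrow> 'k^'d^'d)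
     \<Rightarrow> (('g, 'n, 'k) free_alg set, ('d \<Rightarrow> ('g, 'n, 'k) free_alg set) set) module" where
  "verma G \<rho> t c \<tau> = quot_module (tensor_module G \<rho> t c) (verma_null G \<rho> t c \<tau>)"

definition verma_piece ::
  "('g, 'm) monoid_scheme \<Rightarrow> ('g \<Rightarrow> 'k::field^'n^'n) \<Rightarrow> 'k \<Rightarrow> ('g \<Rightarrow> 'k) \<Rightarrow> ('g \<Rightarrow> 'k^'d^'d) \<Rightarrow> int
     \<Rightarrow> ('d \<Rightarrow> ('g, 'n, 'k) free_alg set) set set" where
  "verma_piece G \<rho> t c \<tau> i =
     (\<lambda>f. verma_null G \<rho> t c \<tau> +>\<^bsub>tensor_module G \<rho> t c\<^esub> f)
       ` {f. \<forall>j. f j \<in> rca_piece G \<rho> t c i}"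

text \<open>The element \<open>1 \<otimes> v\<close> of the Verma module.\<close>

definition verma_low ::
  "('g, 'm) monoid_scheme \<Rightarrow> ('g \<Rightarrow> 'k::field^'n^'n) \<Rightarrow> 'k \<Rightarrow> ('g \<Rightarrow> 'k) \<Rightarrow> ('g \<Rightarrow> 'k^'d^'d)
     \<Rightarrow> 'k^'d \<Rightarrow> ('d \<Rightarrow> ('g, 'n, 'k) free_alg set) set" where
  "verma_low G \<rho> t c \<tau> v =
     verma_null G \<rho> t c \<tau> +>\<^bsub>tensor_module G \<rho> t c\<^esub> pure_tensor G \<rho> t c \<one>\<^bsub>rca G \<rho> t c\<^esub> v"


section \<open>The contravariant form and the module \<open>L\<close>\<close>

text \<open>
  The anti-isomorphism from \<open>H\<^sub>t\<^sub>,\<^sub>c(G, h)\<close> to \<open>H\<^sub>t\<^sub>,\<^sub>c'(G, h\<^sup>*)\<close>, where \<open>c' s = c (s\<^sup>-\<^sup>1)\<close>, on the level of free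
  algebras.  In the second algebra \<open>h\<^sup>*\<close> plays the role of \<open>h\<close>, so being the identity on \<open>h\<close> and
  \<open>h\<^sup>*\<close> means exchanging the letters \<open>GenX\<close> and \<open>GenY\<close>.  Letters outside the group are
  fixed, since they have to be sent to zero in the quotient.
\<close>

fun opp_gen :: "('g, 'm) monoid_scheme \<Rightarrow> ('g, 'n) gen \<Rightarrow> ('g, 'n) gen" where
  "opp_gen G (GenG g) = GenG (if g \<in> carrier G then inv\<^bsub>G\<^esub> g else g)"
| "opp_gen G (GenY i) = GenX i"
| "opp_gen G (GenX i) = GenY i"

definition opp_free ::
  "('g, 'm) monoid_scheme \<Rightarrow> ('g, 'n, 'k::field) free_alg \<Rightarrow> ('g, 'n, 'k) free_alg" where
  "opp_free G a = (\<Sum>w\<in>Poly_Mapping.keys a.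
     Poly_Mapping.single (Word (rev (map (opp_gen G) (letters w)))) (Poly_Mapping.lookup a w))"

definition conj_param :: "('g, 'm) monoid_scheme \<Rightarrow> ('g \<Rightarrow> 'k) \<Rightarrow> 'g \<Rightarrow> 'k" where
  "conj_param G c s = c (inv\<^bsub>G\<^esub> s)"

definition opp_map ::
  "('g, 'm) monoid_scheme \<Rightarrow> ('g \<Rightarrow> 'k::field^'n^'n) \<Rightarrow> 'k \<Rightarrow> ('g \<Rightarrow> 'k)
     \<Rightarrow> ('g, 'n, 'k) free_alg set \<Rightarrow> ('g, 'n, 'k) free_alg set" where
  "opp_map G \<rho> t c A =
     (\<Union>a\<in>A. rca_class G (dual_rep G \<rho>) t (conj_param G c) (opp_free G a))"

definition dual_verma ::
  "('g, 'm) monoid_scheme \<Rightarrow> ('g \<Rightarrow> 'k::field^'n^'n) \<Rightarrow> 'k \<Rightarrow> ('g \<Rightarrow> 'k) \<Rightarrow> ('g \<Rightarrow> 'k^'d^'d)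
     \<Rightarrow> (('g, 'n, 'k) free_alg set, ('d \<Rightarrow> ('g, 'n, 'k) free_alg set) set) module" where
  "dual_verma G \<rho> t c \<tau> = verma G (dual_rep G \<rho>) t (conj_param G c) (dual_rep G \<tau>)"

definition dual_verma_piece ::
  "('g, 'm) monoid_scheme \<Rightarrow> ('g \<Rightarrow> 'k::field^'n^'n) \<Rightarrow> 'k \<Rightarrow> ('g \<Rightarrow> 'k) \<Rightarrow> ('g \<Rightarrow> 'k^'d^'d) \<Rightarrow> int
     \<Rightarrow> ('d \<Rightarrow> ('g, 'n, 'k) free_alg set) set set" where
  "dual_verma_piece G \<rho> t c \<tau> i =
     verma_piece G (dual_rep G \<rho>) t (conj_param G c) (dual_rep G \<tau>) i"

text \<open>
  The restricted dual of \<open>M\<^sub>t\<^sub>,\<^sub>c'(G, h\<^sup>*, \<tau>\<^sup>*)\<close> as a module over \<open>H\<^sub>t\<^sub>,\<^sub>c(G, h)\<close>: linear functionals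
  vanishing on all but finitely many graded pieces.
\<close>

definition restricted_dual ::
  "('g, 'm) monoid_scheme \<Rightarrow> ('g \<Rightarrow> 'k::field^'n^'n) \<Rightarrow> 'k \<Rightarrow> ('g \<Rightarrow> 'k) \<Rightarrow> ('g \<Rightarrow> 'k^'d^'d)
     \<Rightarrow> (('g, 'n, 'k) free_alg set,
         ('d \<Rightarrow> ('g, 'n, 'k) free_alg set) set \<Rightarrow> 'k) module" where
  "restricted_dual G \<rho> t c \<tau> =
     (let M' = dual_verma G \<rho> t c \<tau>;
          z = (\<lambda>m\<in>carrier M'. 0)
      in \<lparr>carrier = {f \<in> carrier M' \<rightarrow>\<^sub>E UNIV.
             (\<forall>m\<in>carrier M'. \<forall>m'\<in>carrier M'. f (m \<oplus>\<^bsub>M'\<^esub> m') = f m + f m')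
           \<and> (\<forall>a. \<forall>m\<in>carrier M'.
                f (rca_class G (dual_rep G \<rho>) t (conj_param G c) (scalar a) \<odot>\<^bsub>M'\<^esub> m) = a * f m)
           \<and> finite {i. \<exists>m\<in>dual_verma_piece G \<rho> t c \<tau> i. f m \<noteq> 0}},
          mult = (\<lambda>_ _. z), one = z, zero = z,
          add = (\<lambda>f f'. \<lambda>m\<in>carrier M'. f m + f' m),
          module.smult = (\<lambda>a f. \<lambda>m\<in>carrier M'. f (opp_map G \<rho> t c a \<odot>\<^bsub>M'\<^esub> m))\<rparr>)"

text \<open>
  Being the identity on the lowest piece \<open>\<tau> = \<tau>\<^sup>*\<^sup>*\<close> means that \<open>1 \<otimes> v\<close> is sent to evaluation at
  \<open>v\<close> on the degree 0 piece \<open>\<tau>\<^sup>*\<close>, extended by zero to the other pieces.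
\<close>

definition is_contravariant_hom ::
  "('g, 'm) monoid_scheme \<Rightarrow> ('g \<Rightarrow> 'k::field^'n^'n) \<Rightarrow> 'k \<Rightarrow> ('g \<Rightarrow> 'k) \<Rightarrow> ('g \<Rightarrow> 'k^'d^'d)
     \<Rightarrow> (('d \<Rightarrow> ('g, 'n, 'k) free_alg set) set
          \<Rightarrow> ('d \<Rightarrow> ('g, 'n, 'k) free_alg set) set \<Rightarrow> 'k) \<Rightarrow> bool" where
  "is_contravariant_hom G \<rho> t c \<tau> \<phi> \<longleftrightarrow>
     \<phi> \<in> module_hom (rca G \<rho> t c) (verma G \<rho> t c \<tau>) (restricted_dual G \<rho> t c \<tau>)
   \<and> (\<forall>v \<xi>. \<phi> (verma_low G \<rho> t c \<tau> v)
               (verma_low G (dual_rep G \<rho>) t (conj_param G c) (dual_rep G \<tau>) \<xi>) = pairing v \<xi>)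
   \<and> (\<forall>v i. i \<noteq> 0 \<longrightarrow>
        (\<forall>m\<in>dual_verma_piece G \<rho> t c \<tau> i. \<phi> (verma_low G \<rho> t c \<tau> v) m = 0))"

text \<open>The homomorphism is unique on the carrier of the Verma module, so the choice is immaterial.\<close>

definition contravariant_hom ::
  "('g, 'm) monoid_scheme \<Rightarrow> ('g \<Rightarrow> 'k::field^'n^'n) \<Rightarrow> 'k \<Rightarrow> ('g \<Rightarrow> 'k) \<Rightarrow> ('g \<Rightarrow> 'k^'d^'d)
     \<Rightarrow> ('d \<Rightarrow> ('g, 'n, 'k) free_alg set) set
     \<Rightarrow> ('d \<Rightarrow> ('g, 'n, 'k) free_alg set) set \<Rightarrow> 'k" where
  "contravariant_hom G \<rho> t c \<tau> = (SOME \<phi>. is_contravariant_hom G \<rho> t c \<tau> \<phi>)"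

definition ker_B ::
  "('g, 'm) monoid_scheme \<Rightarrow> ('g \<Rightarrow> 'k::field^'n^'n) \<Rightarrow> 'k \<Rightarrow> ('g \<Rightarrow> 'k) \<Rightarrow> ('g \<Rightarrow> 'k^'d^'d)
     \<Rightarrow> ('d \<Rightarrow> ('g, 'n, 'k) free_alg set) set set" where
  "ker_B G \<rho> t c \<tau> = {m \<in> carrier (verma G \<rho> t c \<tau>).
     contravariant_hom G \<rho> t c \<tau> m = \<zero>\<^bsub>restricted_dual G \<rho> t c \<tau>\<^esub>}"

definition irr_mod ::
  "('g, 'm) monoid_scheme \<Rightarrow> ('g \<Rightarrow> 'k::field^'n^'n) \<Rightarrow> 'k \<Rightarrow> ('g \<Rightarrow> 'k) \<Rightarrow> ('g \<Rightarrow> 'k^'d^'d)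
     \<Rightarrow> (('g, 'n, 'k) free_alg set, ('d \<Rightarrow> ('g, 'n, 'k) free_alg set) set set) module" where
  "irr_mod G \<rho> t c \<tau> = quot_module (verma G \<rho> t c \<tau>) (ker_B G \<rho> t c \<tau>)"


section \<open>Group representations and the Grothendieck group\<close>

record ('k, 'v, 'g) grep = "('k, 'v) module" +
  act :: "'g \<Rightarrow> 'v \<Rightarrow> 'v"

definition is_grep :: "('g, 'm) monoid_scheme \<Rightarrow> ('k::field, 'v, 'g) grep \<Rightarrow> bool" where
  "is_grep G V \<longleftrightarrow> vectorspace base_field V
   \<and> (\<forall>g\<in>carrier G. act V g \<in> module_hom base_field V V)
   \<and> (\<forall>v\<in>carrier V. act V \<one>\<^bsub>G\<^esub> v = v)
   \<and> (\<forall>g\<in>carrier G. \<forall>h\<in>carrier G. \<forall>v\<in>carrier V. act V (g \<otimes>\<^bsub>G\<^esub> h) v = act V g (act V h v))"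

definition is_fd_grep :: "('g, 'm) monoid_scheme \<Rightarrow> ('k::field, 'v, 'g) grep \<Rightarrow> bool" where
  "is_fd_grep G V \<longleftrightarrow> is_grep G V \<and> vectorspace.fin_dim base_field V"

definition grep_hom ::
  "('g, 'm) monoid_scheme \<Rightarrow> ('k::field, 'v, 'g) grep \<Rightarrow> ('k, 'w, 'g) grep \<Rightarrow> ('v \<Rightarrow> 'w) set" where
  "grep_hom G V W = {f \<in> module_hom base_field V W.
     \<forall>g\<in>carrier G. \<forall>v\<in>carrier V. f (act V g v) = act W g (f v)}"

definition grep_iso ::
  "('g, 'm) monoid_scheme \<Rightarrow> ('k::field, 'v, 'g) grep \<Rightarrow> ('k, 'w, 'g) grep \<Rightarrow> bool" where
  "grep_iso G V W \<longleftrightarrow> (\<exists>f\<in>grep_hom G V W. bij_betw f (carrier V) (carrier W))"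

definition short_exact ::
  "('g, 'm) monoid_scheme \<Rightarrow> ('k::field, 'u, 'g) grep \<Rightarrow> ('k, 'v, 'g) grep \<Rightarrow> ('k, 'w, 'g) grep
     \<Rightarrow> bool" where
  "short_exact G U V W \<longleftrightarrow> (\<exists>f\<in>grep_hom G U V. \<exists>h\<in>grep_hom G V W.
     inj_on f (carrier U) \<and> f ` carrier U = {v \<in> carrier V. h v = \<zero>\<^bsub>W\<^esub>} \<and> h ` carrier V = carrier W)"

text \<open>
  The Grothendieck group is generated by the finite-dimensional representations whose underlying
  set is contained in the type \<open>nat \<Rightarrow> 'k\<close>, which is large enough to contain a copy of every
  finite-dimensional representation over \<open>'k\<close>.  Isomorphic representations are identified by the
  relations (take \<open>U = 0\<close>).  The group operation is written multiplicatively, as for all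
  HOL-Algebra groups.
\<close>

type_synonym ('k, 'g) std_grep = "('k, nat \<Rightarrow> 'k, 'g) grep"

definition fd_greps :: "('g, 'm) monoid_scheme \<Rightarrow> ('k::field, 'g) std_grep set" where
  "fd_greps G = {V. is_fd_grep G V}"

definition K0_rels :: "('g, 'm) monoid_scheme \<Rightarrow> (('k::field, 'g) std_grep \<Rightarrow>\<^sub>0 int) set" where
  "K0_rels G = generate (free_Abelian_group (fd_greps G))
     {frag_of V - frag_of U - frag_of W | U V W.
        U \<in> fd_greps G \<and> V \<in> fd_greps G \<and> W \<in> fd_greps G \<and> short_exact G U V W}"

definition K0 :: "('g, 'm) monoid_scheme \<Rightarrow> (('k::field, 'g) std_grep \<Rightarrow>\<^sub>0 int) set monoid" where
  "K0 G = free_Abelian_group (fd_greps G) Mod K0_rels G"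

definition K0_class ::
  "('g, 'm) monoid_scheme \<Rightarrow> ('k::field, 'v, 'g) grep \<Rightarrow> (('k, 'g) std_grep \<Rightarrow>\<^sub>0 int) set" where
  "K0_class G V = K0_rels G #>\<^bsub>free_Abelian_group (fd_greps G)\<^esub>
     frag_of (SOME V'. V' \<in> fd_greps G \<and> grep_iso G V' V)"

definition K0_diff ::
  "('g, 'm) monoid_scheme \<Rightarrow> (('k::field, 'g) std_grep \<Rightarrow>\<^sub>0 int) set
     \<Rightarrow> (('k, 'g) std_grep \<Rightarrow>\<^sub>0 int) set \<Rightarrow> (('k, 'g) std_grep \<Rightarrow>\<^sub>0 int) set" where
  "K0_diff G a b = a \<otimes>\<^bsub>K0 G\<^esub> inv\<^bsub>K0 G\<^esub> b"

definition matrix_grep :: "('g \<Rightarrow> 'k::field^'n^'n) \<Rightarrow> ('k, 'k^'n, 'g) grep" where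
  "matrix_grep \<rho> = \<lparr>carrier = UNIV, mult = (\<lambda>_ _. 0), one = 0, zero = 0, add = (+),
     module.smult = (*s), act = (\<lambda>g v. \<rho> g *v v)\<rparr>"

definition triv :: "'g \<Rightarrow> 'k::field^1^1" where
  "triv g = mat 1"

text \<open>
  The symmetric algebra of \<open>k\<^sup>n\<close> is the polynomial algebra in the basis vectors; \<open>g\<close> acts by the
  algebra automorphism extending its action on linear forms.
\<close>

type_synonym ('n, 'k) sym_alg = "('n \<Rightarrow>\<^sub>0 nat) \<Rightarrow>\<^sub>0 'k"

definition linear_form :: "'k::field^'n \<Rightarrow> ('n, 'k) sym_alg" where
  "linear_form v = (\<Sum>i\<in>UNIV. Poly_Mapping.single (Poly_Mapping.single i 1) (v $ i))"

definition sym_act :: "('g \<Rightarrow> 'k::field^'n^'n) \<Rightarrow> 'g \<Rightarrow> ('n, 'k) sym_alg \<Rightarrow> ('n, 'k) sym_alg" where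
  "sym_act \<rho> g P = (\<Sum>m\<in>Poly_Mapping.keys P. Poly_Mapping.single 0 (Poly_Mapping.lookup P m)
     * (\<Prod>i\<in>UNIV. linear_form (\<rho> g *v axis i 1) ^ Poly_Mapping.lookup m i))"

definition sym_power :: "('g \<Rightarrow> 'k::field^'n^'n) \<Rightarrow> nat \<Rightarrow> ('k, ('n, 'k) sym_alg, 'g) grep" where
  "sym_power \<rho> d =
     \<lparr>carrier = {P. \<forall>m\<in>Poly_Mapping.keys P. (\<Sum>i\<in>UNIV. Poly_Mapping.lookup m i) = d},
      mult = (\<lambda>_ _. 0), one = 0, zero = 0, add = (+),
      module.smult = (\<lambda>a P. Poly_Mapping.single 0 a * P), act = sym_act \<rho>\<rparr>"


section \<open>Characters and Hilbert series\<close>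

text \<open>The graded pieces of \<open>L\<close>, with the actions of \<open>k\<close> and \<open>G\<close> obtained from that of the algebra.\<close>

definition irr_piece ::
  "('g, 'm) monoid_scheme \<Rightarrow> ('g \<Rightarrow> 'k::field^'n^'n) \<Rightarrow> 'k \<Rightarrow> ('g \<Rightarrow> 'k) \<Rightarrow> ('g \<Rightarrow> 'k^'d^'d) \<Rightarrow> int
     \<Rightarrow> ('k, ('d \<Rightarrow> ('g, 'n, 'k) free_alg set) set set, 'g) grep" where
  "irr_piece G \<rho> t c \<tau> i =
     (let L = irr_mod G \<rho> t c \<tau>
      in \<lparr>carrier = (\<lambda>m. ker_B G \<rho> t c \<tau> +>\<^bsub>verma G \<rho> t c \<tau>\<^esub> m) ` verma_piece G \<rho> t c \<tau> i,
          mult = mult L, one = one L, zero = zero L, add = add L,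
          module.smult = (\<lambda>a m. rca_class G \<rho> t c (scalar a) \<odot>\<^bsub>L\<^esub> m),
          act = (\<lambda>g m. rca_class G \<rho> t c (grp g) \<odot>\<^bsub>L\<^esub> m)\<rparr>)"

text \<open>A formal series indexed by the integers is the function giving its coefficients.\<close>

definition irr_char ::
  "('g, 'm) monoid_scheme \<Rightarrow> ('g \<Rightarrow> 'k::field^'n^'n) \<Rightarrow> 'k \<Rightarrow> ('g \<Rightarrow> 'k) \<Rightarrow> ('g \<Rightarrow> 'k^'d^'d)
     \<Rightarrow> int \<Rightarrow> (('k, 'g) std_grep \<Rightarrow>\<^sub>0 int) set" where
  "irr_char G \<rho> t c \<tau> i = K0_class G (irr_piece G \<rho> t c \<tau> i)"

definition irr_hilb ::
  "('g, 'm) monoid_scheme \<Rightarrow> ('g \<Rightarrow> 'k::field^'n^'n) \<Rightarrow> 'k \<Rightarrow> ('g \<Rightarrow> 'k) \<Rightarrow> ('g \<Rightarrow> 'k^'d^'d)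
     \<Rightarrow> int \<Rightarrow> nat" where
  "irr_hilb G \<rho> t c \<tau> i = vectorspace.dim base_field (irr_piece G \<rho> t c \<tau> i)"

text \<open>The series with coefficients \<open>xs ! 0, xs ! 1, \<dots>\<close> in degrees \<open>0, 1, \<dots>\<close> and \<open>z\<close> in all others.\<close>

definition series_of :: "'a \<Rightarrow> 'a list \<Rightarrow> int \<Rightarrow> 'a" where
  "series_of z xs i = (if 0 \<le> i \<and> i < int (length xs) then xs ! nat i else z)"


section \<open>The special linear group\<close>

definition SL :: "'k::field set \<Rightarrow> ('k^'n^'n) monoid" where
  "SL F = \<lparr>carrier = {A. (\<forall>i j. A $ i $ j \<in> F) \<and> det A = 1}, mult = (**), one = mat 1\<rparr>"

end

theory Submission
  imports Defs
begin

text \<open>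
  The module \<open>L\<close> is found by guessing it.  Suppose that the Cherednik algebra acts on a graded space
  \<open>V\<close> with a vector \<open>\<Omega>\<close> of degree 0 that is killed by \<open>h\<close> and fixed by \<open>G\<close>, and that a \<open>G\<close>-invariant
  functional \<open>\<epsilon>\<close> on \<open>V\<close> kills \<open>h\<^sup>* V\<close> and has \<open>\<epsilon> \<Omega> = 1\<close>.  Then \<open>(a, b) \<mapsto> \<epsilon> (b\<^sup>o\<^sup>p a \<Omega>)\<close> descends to a
  pairing of the two Verma modules, and it has the properties that define the contravariant form.
  No other pairing has them, because the degree 0 part of a Verma module is spanned by its lowest
  weight vector; this is the easy half of the triangular decomposition (\<open>degree_0_scalar\<close>).
  If moreover \<open>\<Omega>\<close> generates \<open>V\<close>, and every
  nonzero vector is moved by some product of elements of \<open>h\<close> to a vector on which \<open>\<epsilon>\<close> does not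
  vanish, then the kernel of the form consists of the \<open>a\<close> with \<open>a \<Omega> = 0\<close>, so that \<open>L = V\<close>
  (\<open>irr_piece_model\<close>).  It remains to exhibit \<open>V\<close>.
  
  When \<open>\<Sum>\<^sub>s c\<^sub>s (1 - s) = 0\<close>, the commutators \<open>[y, x]\<close> act by zero on the trivial representation, which
  is then such a \<open>V\<close> (\<open>trivial_quotient\<close>).  The sum vanishes for all \<open>c\<close> unless \<open>(q, n) = (2, 2)\<close>
  (\<open>refl_sum_zero\<close>).  Reflections in \<open>SL\<^sub>n\<close> are transvections, and the part of the sum that belongs to the
  transvections fixing a given hyperplane \<open>H\<close> commutes with the stabiliser of \<open>H\<close>.  For \<open>n \<ge> 3\<close> the
  transvections along \<open>H\<close> in that stabiliser already force it to be zero.  For \<open>n = 2\<close> an element of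
  the stabiliser with eigenvalues \<open>t, t\<^sup>-\<^sup>1\<close> multiplies it by \<open>t\<^sup>2\<close>, which suffices if some \<open>t\<close> in the
  field has \<open>t\<^sup>2 \<noteq> 0, 1\<close>; in odd characteristic, and so for \<open>q = 3\<close>, one can use instead that the
  whole sum is a scalar matrix of trace zero.
  
  For \<open>SL\<^sub>2(F\<^sub>2)\<close>, the symmetric group on three letters, all reflections are conjugate.  If \<open>c \<noteq> 0\<close>, then
  \<open>V\<close> is the coinvariant algebra, the quotient of \<open>k[x, y]\<close> by the Dickson invariants
  \<open>x\<^sup>2 + x y + y\<^sup>2\<close> and \<open>x\<^sup>2 y + x y\<^sup>2\<close>, with the Dunkl operators (\<open>coinvariant_quotient\<close>).  Its graded
  pieces are \<open>triv\<close>, \<open>h\<^sup>*\<close>, \<open>h\<^sup>*\<close> and \<open>triv\<close>: squaring identifies the piece of degree 2 with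
  the Frobenius twist of \<open>h\<^sup>*\<close>, which is \<open>h\<^sup>*\<close> itself over \<open>F\<^sub>2\<close>.  Exact sequences (\<open>K0_sym_2\<close>, \<open>K0_sym_3\<close>,
  \<open>K0_mid\<close>) identify these classes with the differences of symmetric powers in the theorem.
\<close>

no_notation fps_nth (infixl "$" 75)

section \<open>The free algebra and the Cherednik algebra\<close>

lemma poly_mapping_single_induct [case_names zero add single]:
  assumes "P 0" "\<And>a b. P a \<Longrightarrow> P b \<Longrightarrow> P (a + b)" "\<And>w k. P (Poly_Mapping.single w k)"
  shows "P (a :: 'a \<Rightarrow>\<^sub>0 'b::ab_group_add)"
proof (induction a rule: update_induct)
  case const
  then show ?case using assms(1) .
next
  case (update f a b)
  have "Poly_Mapping.update a b f = f + Poly_Mapping.single a b"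
    using update by (intro poly_mapping_eqI) (auto simp: lookup_update lookup_add lookup_single when_def in_keys_iff)
  then show ?case using assms(2)[OF update(3) assms(3)] by simp
qed

lemma ring_of_type_algebra_simps [simp]:
  "carrier ring_of_type_algebra = UNIV"
  "a \<otimes>\<^bsub>ring_of_type_algebra\<^esub> b = a * b"
  "a \<oplus>\<^bsub>ring_of_type_algebra\<^esub> b = a + b"
  "\<zero>\<^bsub>ring_of_type_algebra\<^esub> = 0" "\<one>\<^bsub>ring_of_type_algebra\<^esub> = 1"
  by (simp_all add: ring_of_type_algebra_def)

lemma ring_ring_of_type_algebra: "ring (ring_of_type_algebra :: 'a::ring_1 ring)"
proof -
  have "\<exists>y. x + y = 0" for x :: 'a
    using add.right_inverse by blast
  thus ?thesis
    unfolding ring_of_type_algebra_def using add.right_inverse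
    by unfold_locales (auto simp:algebra_simps Units_def)
qed

interpretation rta: ring "ring_of_type_algebra :: 'a::ring_1 ring"
  by (rule ring_ring_of_type_algebra)

lemma a_inv_ring_of_type_algebra [simp]: "\<ominus>\<^bsub>ring_of_type_algebra\<^esub> a = - (a :: 'a::ring_1)"
  by (rule rta.minus_equality) auto

lemma word_mult_single [simp]:
  "Poly_Mapping.single (Word v) a * Poly_Mapping.single (Word w) b
     = Poly_Mapping.single (Word (v @ w)) (a * b :: 'k::field)"
  by (simp add: mult_single plus_free_monoid_def)

lemma Word_Nil: "Word [] = 0" by (simp add: zero_free_monoid_def)

lemma scalar_mult_single: "scalar r * Poly_Mapping.single w k = Poly_Mapping.single w (r * k)"
  by (simp add: scalar_def mult_single)

lemma scalar_add: "scalar (a + b) = scalar a + scalar b"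
  and scalar_mult: "scalar (a * b) = scalar a * scalar b"
  and scalar_0 [simp]: "scalar 0 = 0" and scalar_1 [simp]: "scalar 1 = 1"
  and scalar_uminus: "scalar (- a) = - scalar a"
  by (simp_all add: scalar_def single_add mult_single single_uminus)

lemma scalar_commute: "scalar r * a = a * scalar r"
proof (induction a rule: poly_mapping_single_induct)
  case (single w k) then show ?case by (simp add: scalar_def mult_single mult.commute)
qed (simp_all add: distrib_left distrib_right)

lemma scalar_left_commute: "a * (scalar r * b) = scalar r * (a * b)"
  by (metis mult.assoc scalar_commute)

abbreviation xgen :: "'n \<Rightarrow> ('g, 'n, 'k::field) free_alg" where
  "xgen i \<equiv> Poly_Mapping.single (Word [GenX i]) 1"

abbreviation ygen :: "'n \<Rightarrow> ('g, 'n, 'k::field) free_alg" where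
  "ygen i \<equiv> Poly_Mapping.single (Word [GenY i]) 1"

lemma xvec_expand: "xvec v = (\<Sum>i\<in>UNIV. scalar (v $ i) * xgen i)"
  and yvec_expand: "yvec v = (\<Sum>i\<in>UNIV. scalar (v $ i) * ygen i)"
  by (simp_all add: xvec_def yvec_def scalar_mult_single)

lemma axis_expand:
  fixes f :: "'n::finite \<Rightarrow> 'b::ab_group_add"
  assumes "\<And>i. s 0 (f i) = 0" "\<And>i. s 1 (f i) = f i"
  shows "(\<Sum>i\<in>UNIV. s ((axis j 1 :: 'k::field^'n) $ i) (f i)) = f j"
proof -
  have "(\<Sum>i\<in>UNIV. s ((axis j 1 :: 'k^'n) $ i) (f i)) = (\<Sum>i\<in>UNIV. if i = j then f i else 0)"
    using assms by (intro sum.cong) (auto simp: axis_def)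
  then show ?thesis by simp
qed

lemma xvec_axis: "xvec (axis i 1) = xgen i" and yvec_axis: "yvec (axis i 1) = ygen i"
  unfolding xvec_expand yvec_expand
  by (rule axis_expand[of "\<lambda>a b. scalar a * b"]; simp)+

subsection \<open>The anti-isomorphism\<close>

lemma opp_free_add: "opp_free G (a + b) = opp_free G a + opp_free G b"
  unfolding opp_free_def
  by (rule setsum_keys_plus_distrib) (simp_all add: single_add)

lemma opp_free_single:
  "opp_free G (Poly_Mapping.single w k) = Poly_Mapping.single (Word (rev (map (opp_gen G) (letters w)))) k"
  by (cases "k = 0") (simp_all add: opp_free_def)

lemma opp_free_0 [simp]: "opp_free G 0 = 0" by (simp add: opp_free_def)

lemma opp_free_uminus: "opp_free G (- a) = - opp_free G a"
  by (metis add.right_inverse add_eq_0_iff opp_free_0 opp_free_add)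

lemma opp_free_diff: "opp_free G (a - b) = opp_free G a - opp_free G b"
  by (metis diff_conv_add_uminus opp_free_add opp_free_uminus)

lemma opp_free_sum: "opp_free G (\<Sum>i\<in>A. f i) = (\<Sum>i\<in>A. opp_free G (f i))"
  by (induction A rule: infinite_finite_induct) (simp_all add: opp_free_add)

lemma opp_free_mult: "opp_free G (a * b) = opp_free G b * opp_free G a"
proof (induction a rule: poly_mapping_single_induct)
  case (single v k)
  show ?case
  proof (induction b rule: poly_mapping_single_induct)
    case (single w l)
    show ?case
      by (cases v; cases w) (simp add: opp_free_single mult.commute)
  qed (simp_all add: distrib_left distrib_right opp_free_add)
qed (simp_all add: distrib_left distrib_right opp_free_add)

lemma opp_free_scalar [simp]: "opp_free G (scalar k) = scalar k"
  by (simp add: scalar_def opp_free_single zero_free_monoid_def)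

lemma opp_free_1 [simp]: "opp_free G 1 = 1"
  by (metis opp_free_scalar scalar_1)

lemma opp_free_grp: "opp_free G (grp g) = grp (if g \<in> carrier G then inv\<^bsub>G\<^esub> g else g)"
  by (simp add: grp_def opp_free_single)

lemma opp_free_yvec: "opp_free G (yvec v) = xvec v" and opp_free_xvec: "opp_free G (xvec v) = yvec v"
  by (simp_all add: xvec_def yvec_def opp_free_sum opp_free_single)

lemma opp_gen_opp_gen: "group G \<Longrightarrow> opp_gen G (opp_gen G x) = x"
  by (cases x) (auto simp: group.inv_closed group.inv_inv)

lemma opp_free_opp_free: "group G \<Longrightarrow> opp_free G (opp_free G a) = a"
proof (induction a rule: poly_mapping_single_induct)
  case (single w k)
  then show ?case by (cases w) (simp add: opp_free_single rev_map o_def opp_gen_opp_gen)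
qed (simp_all add: opp_free_add)

subsection \<open>The defining ideal\<close>

lemma ideal_rca_ideal: "ideal (rca_ideal G \<rho> t c) ring_of_type_algebra"
  unfolding rca_ideal_def by (rule rta.genideal_ideal) simp

lemma rca_ideal_props:
  shows rca_ideal_rels: "a \<in> smash_rels G \<rho> \<union> commutator_rels G \<rho> t c \<Longrightarrow> a \<in> rca_ideal G \<rho> t c"
    and rca_ideal_0 [simp]: "0 \<in> rca_ideal G \<rho> t c"
    and rca_ideal_add: "a \<in> rca_ideal G \<rho> t c \<Longrightarrow> b \<in> rca_ideal G \<rho> t c \<Longrightarrow> a + b \<in> rca_ideal G \<rho> t c"
    and rca_ideal_uminus: "a \<in> rca_ideal G \<rho> t c \<Longrightarrow> - a \<in> rca_ideal G \<rho> t c"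
    and rca_ideal_mult_left: "a \<in> rca_ideal G \<rho> t c \<Longrightarrow> b * a \<in> rca_ideal G \<rho> t c"
    and rca_ideal_mult_right: "a \<in> rca_ideal G \<rho> t c \<Longrightarrow> a * b \<in> rca_ideal G \<rho> t c"
proof -
  interpret ideal "rca_ideal G \<rho> t c" ring_of_type_algebra by (rule ideal_rca_ideal)
  show "a \<in> smash_rels G \<rho> \<union> commutator_rels G \<rho> t c \<Longrightarrow> a \<in> rca_ideal G \<rho> t c"
    unfolding rca_ideal_def using rta.genideal_self[of "smash_rels G \<rho> \<union> commutator_rels G \<rho> t c"] by auto
  show "0 \<in> rca_ideal G \<rho> t c" using zero_closed by simp
  show "a \<in> rca_ideal G \<rho> t c \<Longrightarrow> b \<in> rca_ideal G \<rho> t c \<Longrightarrow> a + b \<in> rca_ideal G \<rho> t c"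
    using a_closed by simp
  show "a \<in> rca_ideal G \<rho> t c \<Longrightarrow> - a \<in> rca_ideal G \<rho> t c"
    using a_inv_closed by force
  show "a \<in> rca_ideal G \<rho> t c \<Longrightarrow> b * a \<in> rca_ideal G \<rho> t c"
    using I_l_closed by simp
  show "a \<in> rca_ideal G \<rho> t c \<Longrightarrow> a * b \<in> rca_ideal G \<rho> t c"
    using I_r_closed by simp
qed

lemma rca_ideal_subset:
  assumes rels: "smash_rels G \<rho> \<union> commutator_rels G \<rho> t c \<subseteq> I"
    and "0 \<in> I" "\<And>a b. a \<in> I \<Longrightarrow> b \<in> I \<Longrightarrow> a + b \<in> I" "\<And>a. a \<in> I \<Longrightarrow> - a \<in> I"
    and "\<And>a b. a \<in> I \<Longrightarrow> b * a \<in> I" "\<And>a b. a \<in> I \<Longrightarrow> a * b \<in> I"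
  shows "rca_ideal G \<rho> t c \<subseteq> I"
proof -
  have "subgroup I (add_monoid ring_of_type_algebra)"
  proof (rule group.subgroupI[OF rta.a_group])
    fix a assume "a \<in> I"
    then show "inv\<^bsub>add_monoid ring_of_type_algebra\<^esub> a \<in> I"
      by (simp only: a_inv_def[symmetric] a_inv_ring_of_type_algebra assms(4))
  qed (use assms in auto)
  then have "ideal I ring_of_type_algebra"
    by (intro idealI) (use assms ring_ring_of_type_algebra in auto)
  then show ?thesis
    unfolding rca_ideal_def by (rule rta.genideal_minimal) (use rels in auto)
qed

lemma rca_class_mem: "b \<in> rca_class G \<rho> t c a \<longleftrightarrow> b - a \<in> rca_ideal G \<rho> t c"
proof
  assume "b \<in> rca_class G \<rho> t c a"
  then show "b - a \<in> rca_ideal G \<rho> t c" by (auto simp: rca_class_def a_r_coset_def')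
next
  assume "b - a \<in> rca_ideal G \<rho> t c"
  then show "b \<in> rca_class G \<rho> t c a"
    unfolding rca_class_def a_r_coset_def' by (intro UN_I[of "b - a"]) auto
qed

lemma rca_class_eq: "rca_class G \<rho> t c a = rca_class G \<rho> t c b \<longleftrightarrow> a - b \<in> rca_ideal G \<rho> t c"
proof
  assume "rca_class G \<rho> t c a = rca_class G \<rho> t c b"
  then have "a \<in> rca_class G \<rho> t c b" using rca_class_mem[of a G \<rho> t c a] by simp
  then show "a - b \<in> rca_ideal G \<rho> t c" by (simp add: rca_class_mem)
next
  assume h: "a - b \<in> rca_ideal G \<rho> t c"
  show "rca_class G \<rho> t c a = rca_class G \<rho> t c b"
  proof (rule Set.set_eqI)
    fix x
    have "x - a \<in> rca_ideal G \<rho> t c \<Longrightarrow> x - b \<in> rca_ideal G \<rho> t c"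
      using rca_ideal_add[OF _ h, of "x - a"] by simp
    moreover have "x - b \<in> rca_ideal G \<rho> t c \<Longrightarrow> x - a \<in> rca_ideal G \<rho> t c"
      using rca_ideal_add[OF _ rca_ideal_uminus[OF h], of "x - b"] by simp
    ultimately show "x \<in> rca_class G \<rho> t c a \<longleftrightarrow> x \<in> rca_class G \<rho> t c b"
      by (auto simp: rca_class_mem)
  qed
qed

lemma rca_simps:
  shows rca_carrier: "carrier (rca G \<rho> t c) = range (rca_class G \<rho> t c)"
    and rca_add: "rca_class G \<rho> t c a \<oplus>\<^bsub>rca G \<rho> t c\<^esub> rca_class G \<rho> t c b = rca_class G \<rho> t c (a + b)"
    and rca_mult: "rca_class G \<rho> t c a \<otimes>\<^bsub>rca G \<rho> t c\<^esub> rca_class G \<rho> t c b = rca_class G \<rho> t c (a * b)"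
    and rca_zero: "\<zero>\<^bsub>rca G \<rho> t c\<^esub> = rca_class G \<rho> t c 0"
    and rca_one: "\<one>\<^bsub>rca G \<rho> t c\<^esub> = rca_class G \<rho> t c 1"
proof -
  interpret ideal "rca_ideal G \<rho> t c" ring_of_type_algebra by (rule ideal_rca_ideal)
  show "carrier (rca G \<rho> t c) = range (rca_class G \<rho> t c)"
    by (auto simp: rca_def FactRing_def A_RCOSETS_def' rca_class_def)
  show "rca_class G \<rho> t c a \<oplus>\<^bsub>rca G \<rho> t c\<^esub> rca_class G \<rho> t c b = rca_class G \<rho> t c (a + b)"
    using a_rcos_sum[of a b] by (simp add: rca_def FactRing_def rca_class_def)
  show "rca_class G \<rho> t c a \<otimes>\<^bsub>rca G \<rho> t c\<^esub> rca_class G \<rho> t c b = rca_class G \<rho> t c (a * b)"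
    using rcoset_mult_add[of a b] by (simp add: rca_def FactRing_def rca_class_def)
  show "\<zero>\<^bsub>rca G \<rho> t c\<^esub> = rca_class G \<rho> t c 0"
    using rca_class_mem[of _ G \<rho> t c 0] by (auto simp: rca_def FactRing_def)
  show "\<one>\<^bsub>rca G \<rho> t c\<^esub> = rca_class G \<rho> t c 1"
    by (simp add: rca_def FactRing_def rca_class_def)
qed

subsection \<open>Quotients of presented modules\<close>

text \<open>
  Elements of the Verma module are sets of functions into sets of elements of the free algebra, and
  elements of \<open>L\<close> are sets of such sets.  A surjection \<open>cl\<close> from an abelian group \<open>'a\<close> onto \<open>M\<close> whose
  kernel lies in \<open>K\<close> induces a surjection from \<open>'a\<close> onto \<open>M / cl(K)\<close> with kernel \<open>K\<close>.  Used twice, this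
  turns all computations in \<open>L\<close> into computations with representatives in the free algebra.
\<close>

locale presented_quotient =
  fixes M :: "('r, 'b) module" and cl :: "'a::ab_group_add \<Rightarrow> 'b" and K :: "'a set" and N :: "'b set"
  assumes carrier_M: "carrier M = range cl"
    and add_cl: "cl a \<oplus>\<^bsub>M\<^esub> cl b = cl (a + b)"
    and N_eq: "N = cl ` K"
    and K_0: "0 \<in> K" and K_add: "a \<in> K \<Longrightarrow> b \<in> K \<Longrightarrow> a + b \<in> K" and K_uminus: "a \<in> K \<Longrightarrow> - a \<in> K"
    and cl_eqD: "cl a = cl b \<Longrightarrow> a - b \<in> K"
begin

definition qcl :: "'a \<Rightarrow> 'b set" where "qcl a = N +>\<^bsub>M\<^esub> cl a"

lemma mem_qcl: "m \<in> qcl a \<longleftrightarrow> (\<exists>b. m = cl b \<and> b - a \<in> K)"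
proof
  assume "m \<in> qcl a"
  then have "m \<in> N +>\<^bsub>M\<^esub> cl a" by (simp only: qcl_def)
  then obtain k where "k \<in> K" "m = cl (k + a)"
    by (auto simp: a_r_coset_def' N_eq add_cl)
  then show "\<exists>b. m = cl b \<and> b - a \<in> K" by (intro exI[of _ "k + a"]) simp
next
  assume "\<exists>b. m = cl b \<and> b - a \<in> K"
  then obtain b where b: "m = cl b" "b - a \<in> K" by blast
  then have "m = cl (b - a) \<oplus>\<^bsub>M\<^esub> cl a" by (simp add: add_cl)
  moreover have "cl (b - a) \<in> N" using b(2) by (simp add: N_eq)
  ultimately show "m \<in> qcl a" by (auto simp: qcl_def a_r_coset_def')
qed

lemma cl_mem_qcl: "cl b \<in> qcl a \<longleftrightarrow> b - a \<in> K"
proof -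
  have "b - a \<in> K" if "cl b = cl b'" "b' - a \<in> K" for b'
    using K_add[OF cl_eqD[OF that(1)] that(2)] by simp
  then show ?thesis unfolding mem_qcl by blast
qed

lemma qcl_eq: "qcl a = qcl b \<longleftrightarrow> a - b \<in> K"
proof
  assume "qcl a = qcl b"
  then have "cl a \<in> qcl b" using cl_mem_qcl[of a a] K_0 by simp
  then show "a - b \<in> K" by (simp add: cl_mem_qcl)
next
  assume h: "a - b \<in> K"
  have "x - a \<in> K \<longleftrightarrow> x - b \<in> K" for x
    using K_add[OF _ h, of "x - a"] K_add[OF _ K_uminus[OF h], of "x - b"] by auto
  then show "qcl a = qcl b" by (auto simp: mem_qcl)
qed

lemma carrier_quot: "carrier (quot_module M N) = range qcl"
  by (auto simp: quot_module_def A_RCOSETS_def' carrier_M qcl_def)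

lemma add_quot: "qcl a \<oplus>\<^bsub>quot_module M N\<^esub> qcl b = qcl (a + b)"
proof -
  have "x \<in> qcl a <+>\<^bsub>M\<^esub> qcl b \<longleftrightarrow> x \<in> qcl (a + b)" for x
  proof
    assume "x \<in> qcl a <+>\<^bsub>M\<^esub> qcl b"
    then obtain a' b' where "x = cl (a' + b')" "a' - a \<in> K" "b' - b \<in> K"
      by (auto simp: set_add_def' mem_qcl add_cl)
    then show "x \<in> qcl (a + b)"
      using K_add[of "a' - a" "b' - b"] by (auto simp: mem_qcl algebra_simps)
  next
    assume "x \<in> qcl (a + b)"
    then obtain d where d: "x = cl d" "d - (a + b) \<in> K" by (auto simp: mem_qcl)
    have "cl (d - b) \<in> qcl a" "cl b \<in> qcl b" "x = cl (d - b) \<oplus>\<^bsub>M\<^esub> cl b"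
      using d K_0 by (auto simp: cl_mem_qcl add_cl algebra_simps)
    then show "x \<in> qcl a <+>\<^bsub>M\<^esub> qcl b" by (auto simp: set_add_def')
  qed
  then show ?thesis by (auto simp: quot_module_def)
qed

lemma zero_quot: "\<zero>\<^bsub>quot_module M N\<^esub> = qcl 0"
proof -
  have "m \<in> N \<longleftrightarrow> m \<in> qcl 0" for m
    unfolding mem_qcl by (auto simp: N_eq)
  then show ?thesis by (auto simp: quot_module_def)
qed

lemma smult_quot:
  assumes f: "\<And>a. r \<odot>\<^bsub>M\<^esub> cl a = cl (f a)" and "\<And>a b. f (a - b) = f a - f b"
    and "\<And>a. a \<in> K \<Longrightarrow> f a \<in> K"
  shows "r \<odot>\<^bsub>quot_module M N\<^esub> qcl a = qcl (f a)"
proof -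
  have "(\<Union>m\<in>qcl a. N +>\<^bsub>M\<^esub> (r \<odot>\<^bsub>M\<^esub> m)) = (\<Union>m\<in>qcl a. qcl (f a))"
  proof (rule SUP_cong)
    fix m assume "m \<in> qcl a"
    then obtain b where "m = cl b" "b - a \<in> K" by (auto simp: mem_qcl)
    then have "N +>\<^bsub>M\<^esub> (r \<odot>\<^bsub>M\<^esub> m) = qcl (f b)" "f b - f a \<in> K"
      using assms(2)[of b a] assms(3)[of "b - a"] by (auto simp: f qcl_def)
    then show "N +>\<^bsub>M\<^esub> (r \<odot>\<^bsub>M\<^esub> m) = qcl (f a)" using qcl_eq by auto
  qed simp
  moreover have "cl a \<in> qcl a" using K_0 by (simp add: cl_mem_qcl)
  ultimately show ?thesis by (auto simp: quot_module_def)
qed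

end

section \<open>Verma modules of the trivial representation\<close>

text \<open>
  The left ideal of the free algebra whose quotient is the Verma module of the trivial representation.
\<close>

inductive_set verma_ideal :: "('g, 'm) monoid_scheme \<Rightarrow> ('g \<Rightarrow> 'k::field^'n^'n) \<Rightarrow> 'k \<Rightarrow> ('g \<Rightarrow> 'k)
    \<Rightarrow> ('g, 'n, 'k) free_alg set"
  for G \<rho> t c where
  ideal: "a \<in> rca_ideal G \<rho> t c \<Longrightarrow> a \<in> verma_ideal G \<rho> t c"
| grp: "g \<in> carrier G \<Longrightarrow> a * (grp g - 1) \<in> verma_ideal G \<rho> t c"
| yvec: "a * yvec y \<in> verma_ideal G \<rho> t c"
| add: "a \<in> verma_ideal G \<rho> t c \<Longrightarrow> b \<in> verma_ideal G \<rho> t c \<Longrightarrow> a + b \<in> verma_ideal G \<rho> t c"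
| uminus: "a \<in> verma_ideal G \<rho> t c \<Longrightarrow> - a \<in> verma_ideal G \<rho> t c"

lemma verma_ideal_0 [simp]: "0 \<in> verma_ideal G \<rho> t c"
  by (simp add: verma_ideal.ideal)

lemma verma_ideal_mult: "a \<in> verma_ideal G \<rho> t c \<Longrightarrow> b * a \<in> verma_ideal G \<rho> t c"
proof (induction rule: verma_ideal.induct)
  case (ideal a) then show ?case by (simp add: rca_ideal_mult_left verma_ideal.ideal)
next
  case (grp g a) then show ?case using verma_ideal.grp[of g G "b * a"] by (simp add: mult.assoc)
next
  case (yvec a y) then show ?case using verma_ideal.yvec[of "b * a" y] by (simp add: mult.assoc)
next
  case (add a b) then show ?case by (simp add: distrib_left verma_ideal.add)
next
  case (uminus a) then show ?case by (simp add: verma_ideal.uminus)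
qed

definition tensor_class :: "('g, 'm) monoid_scheme \<Rightarrow> ('g \<Rightarrow> 'k::field^'n^'n) \<Rightarrow> 'k \<Rightarrow> ('g \<Rightarrow> 'k)
    \<Rightarrow> ('g, 'n, 'k) free_alg \<Rightarrow> 1 \<Rightarrow> ('g, 'n, 'k) free_alg set" where
  "tensor_class G \<rho> t c a = (\<lambda>_. rca_class G \<rho> t c a)"

lemma fun_num1_eqI: "f 1 = g 1 \<Longrightarrow> f = g" for f g :: "1 \<Rightarrow> 'a"
  by (metis ext num1_eq1)

lemma tensor_simps:
  shows tensor_carrier: "carrier (tensor_module G \<rho> t c) = range (tensor_class G \<rho> t c)"
    and tensor_add: "tensor_class G \<rho> t c a \<oplus>\<^bsub>tensor_module G \<rho> t c\<^esub> tensor_class G \<rho> t c b = tensor_class G \<rho> t c (a + b)"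
    and tensor_zero: "\<zero>\<^bsub>tensor_module G \<rho> t c\<^esub> = tensor_class G \<rho> t c 0"
    and tensor_smult: "rca_class G \<rho> t c a \<odot>\<^bsub>tensor_module G \<rho> t c\<^esub> tensor_class G \<rho> t c b = tensor_class G \<rho> t c (a * b)"
proof -
  show "carrier (tensor_module G \<rho> t c) = range (tensor_class G \<rho> t c)"
  proof (intro equalityI subsetI)
    fix f :: "1 \<Rightarrow> _" assume "f \<in> carrier (tensor_module G \<rho> t c)"
    then have "f 1 \<in> range (rca_class G \<rho> t c)" by (simp add: tensor_module_def rca_carrier)
    then obtain a where "f 1 = rca_class G \<rho> t c a" by blast
    then have "f = tensor_class G \<rho> t c a" by (intro fun_num1_eqI) (simp add: tensor_class_def)
    then show "f \<in> range (tensor_class G \<rho> t c)" by blast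
  qed (auto simp: tensor_module_def rca_carrier tensor_class_def)
qed (simp_all add: tensor_module_def tensor_class_def rca_simps)

lemma tensor_class_eq: "tensor_class G \<rho> t c a = tensor_class G \<rho> t c b \<longleftrightarrow> a - b \<in> rca_ideal G \<rho> t c"
  by (simp add: tensor_class_def fun_eq_iff rca_class_eq)

lemma pure_tensor_class:
  "pure_tensor G \<rho> t c (rca_class G \<rho> t c h) v = tensor_class G \<rho> t c (scalar (v $ 1) * h)"
  by (rule fun_num1_eqI) (simp add: pure_tensor_def tensor_class_def rca_mult)

lemma tensor_group: "group (add_monoid (tensor_module G \<rho> t c :: (_, 1 \<Rightarrow> _) module))"
proof (rule groupI)
  fix x :: "1 \<Rightarrow> _" assume "x \<in> carrier (add_monoid (tensor_module G \<rho> t c))"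
  then obtain a where "x = tensor_class G \<rho> t c a" by (auto simp: tensor_carrier)
  then show "\<exists>y\<in>carrier (add_monoid (tensor_module G \<rho> t c)).
      y \<otimes>\<^bsub>add_monoid (tensor_module G \<rho> t c)\<^esub> x = \<one>\<^bsub>add_monoid (tensor_module G \<rho> t c)\<^esub>"
    by (intro bexI[of _ "tensor_class G \<rho> t c (- a)"]) (auto simp: tensor_simps)
qed (auto simp: tensor_simps add.assoc)

lemma tensor_uminus: "\<ominus>\<^bsub>tensor_module G \<rho> t c\<^esub> tensor_class G \<rho> t c a = tensor_class G \<rho> t c (- a)"
proof -
  interpret T: group "add_monoid (tensor_module G \<rho> t c :: (_, 1 \<Rightarrow> _) module)" by (rule tensor_group)
  show ?thesis unfolding a_inv_def
    by (rule T.inv_equality) (auto simp: tensor_simps)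
qed

lemma triv_mult [simp]: "triv g *v v = v"
  by (simp add: triv_def)

lemma verma_null_triv: "verma_null G \<rho> t c triv = tensor_class G \<rho> t c ` verma_ideal G \<rho> t c"
proof (intro equalityI subsetI)
  fix x assume "x \<in> verma_null G \<rho> t c triv"
  then have "x \<in> generate (add_monoid (tensor_module G \<rho> t c)) (verma_rels G \<rho> t c triv)"
    by (simp add: verma_null_def)
  moreover have rels: "h \<in> tensor_class G \<rho> t c ` verma_ideal G \<rho> t c" if "h \<in> verma_rels G \<rho> t c triv" for h
    using that unfolding verma_rels_def
  proof (elim UnE CollectE exE conjE)
    fix h' g v assume h: "h = pure_tensor G \<rho> t c (h' \<otimes>\<^bsub>rca G \<rho> t c\<^esub> rca_class G \<rho> t c (grp g)) v
      \<ominus>\<^bsub>tensor_module G \<rho> t c\<^esub> pure_tensor G \<rho> t c h' (triv g *v v)"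
      and h': "h' \<in> carrier (rca G \<rho> t c)" and g: "g \<in> carrier G"
    obtain a where a: "h' = rca_class G \<rho> t c a" using h' by (auto simp: rca_carrier)
    have "h = tensor_class G \<rho> t c (scalar (v $ 1) * (a * grp g) - scalar (v $ 1) * a)"
      by (simp add: h a rca_mult pure_tensor_class a_minus_def tensor_uminus tensor_add)
    also have "scalar (v $ 1) * (a * grp g) - scalar (v $ 1) * a = (scalar (v $ 1) * a) * (grp g - 1)"
      by (simp add: algebra_simps)
    finally show ?thesis using verma_ideal.grp[OF g] by blast
  next
    fix h' y v assume h: "h = pure_tensor G \<rho> t c (h' \<otimes>\<^bsub>rca G \<rho> t c\<^esub> rca_class G \<rho> t c (yvec y)) v"
      and h': "h' \<in> carrier (rca G \<rho> t c)"
    obtain a where a: "h' = rca_class G \<rho> t c a" using h' by (auto simp: rca_carrier)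
    have "h = tensor_class G \<rho> t c ((scalar (v $ 1) * a) * yvec y)"
      by (simp add: h a rca_mult pure_tensor_class mult.assoc)
    then show ?thesis using verma_ideal.yvec by blast
  qed
  ultimately show "x \<in> tensor_class G \<rho> t c ` verma_ideal G \<rho> t c"
  proof (induction rule: generate.induct)
    case one then show ?case by (auto simp: tensor_zero)
  next
    case (inv h)
    then obtain a where "a \<in> verma_ideal G \<rho> t c" "h = tensor_class G \<rho> t c a" using rels[OF inv.hyps] by blast
    then show ?case by (auto simp: a_inv_def[symmetric] tensor_uminus verma_ideal.uminus)
  next
    case (eng h1 h2)
    then show ?case by (auto simp: tensor_add verma_ideal.add)
  qed (use rels in auto)
next
  fix x assume "x \<in> tensor_class G \<rho> t c ` verma_ideal G \<rho> t c"
  then obtain a where a: "a \<in> verma_ideal G \<rho> t c" "x = tensor_class G \<rho> t c a" by blast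
  have "tensor_class G \<rho> t c a \<in> generate (add_monoid (tensor_module G \<rho> t c)) (verma_rels G \<rho> t c triv)"
    using a(1)
  proof (induction rule: verma_ideal.induct)
    case (ideal a)
    then have "tensor_class G \<rho> t c a = \<one>\<^bsub>add_monoid (tensor_module G \<rho> t c)\<^esub>" by (simp add: tensor_zero tensor_class_eq)
    then show ?case by (simp only: generate.one)
  next
    case (grp g a)
    have "tensor_class G \<rho> t c (a * (grp g - 1)) =
      pure_tensor G \<rho> t c (rca_class G \<rho> t c a \<otimes>\<^bsub>rca G \<rho> t c\<^esub> rca_class G \<rho> t c (grp g)) (\<chi> i. 1)
      \<ominus>\<^bsub>tensor_module G \<rho> t c\<^esub> pure_tensor G \<rho> t c (rca_class G \<rho> t c a) (triv g *v (\<chi> i. 1))"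
      by (simp add: rca_mult pure_tensor_class a_minus_def tensor_uminus tensor_add algebra_simps)
    then have "tensor_class G \<rho> t c (a * (grp g - 1)) \<in> verma_rels G \<rho> t c triv"
      unfolding verma_rels_def rca_carrier using grp by blast
    then show ?case by (rule generate.incl)
  next
    case (yvec a y)
    have "tensor_class G \<rho> t c (a * yvec y) =
      pure_tensor G \<rho> t c (rca_class G \<rho> t c a \<otimes>\<^bsub>rca G \<rho> t c\<^esub> rca_class G \<rho> t c (yvec y)) (\<chi> i. 1)"
      by (simp add: rca_mult pure_tensor_class)
    then have "tensor_class G \<rho> t c (a * yvec y) \<in> verma_rels G \<rho> t c triv"
      unfolding verma_rels_def rca_carrier by blast
    then show ?case by (rule generate.incl)
  next
    case (add a b)
    then show ?case using generate.eng[OF add(3,4)] by (simp add: tensor_add)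
  next
    case (uminus a)
    interpret T: group "add_monoid (tensor_module G \<rho> t c :: (_, 1 \<Rightarrow> _) module)" by (rule tensor_group)
    have sub: "verma_rels G \<rho> t c triv \<subseteq> carrier (add_monoid (tensor_module G \<rho> t c :: (_, 1 \<Rightarrow> _) module))"
      by (auto simp: verma_rels_def rca_carrier rca_mult pure_tensor_class a_minus_def tensor_uminus tensor_add tensor_carrier)
    show ?case using T.generate_m_inv_closed[OF sub uminus(2)]
      by (simp add: a_inv_def[symmetric] tensor_uminus)
  qed
  then show "x \<in> verma_null G \<rho> t c triv" by (simp add: a(2) verma_null_def)
qed

definition verma_class :: "('g, 'm) monoid_scheme \<Rightarrow> ('g \<Rightarrow> 'k::field^'n^'n) \<Rightarrow> 'k \<Rightarrow> ('g \<Rightarrow> 'k)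
    \<Rightarrow> ('g, 'n, 'k) free_alg \<Rightarrow> (1 \<Rightarrow> ('g, 'n, 'k) free_alg set) set" where
  "verma_class G \<rho> t c a = verma_null G \<rho> t c triv +>\<^bsub>tensor_module G \<rho> t c\<^esub> tensor_class G \<rho> t c a"

interpretation verma: presented_quotient "tensor_module G \<rho> t c" "tensor_class G \<rho> t c" "verma_ideal G \<rho> t c"
    "verma_null G \<rho> t c triv"
  rewrites "presented_quotient.qcl (tensor_module G \<rho> t c) (tensor_class G \<rho> t c) (verma_null G \<rho> t c triv)
    = verma_class G \<rho> t c"
  for G \<rho> t c
proof -
  show *: "presented_quotient (tensor_module G \<rho> t c) (tensor_class G \<rho> t c) (verma_ideal G \<rho> t c) (verma_null G \<rho> t c triv)"
    by unfold_locales (auto simp: tensor_simps verma_null_triv tensor_class_eq intro: verma_ideal.intros)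
  show "presented_quotient.qcl (tensor_module G \<rho> t c) (tensor_class G \<rho> t c) (verma_null G \<rho> t c triv)
    = verma_class G \<rho> t c"
    by (intro ext) (simp add: presented_quotient.qcl_def[OF *] verma_class_def)
qed

lemma verma_simps:
  shows verma_class_eq: "verma_class G \<rho> t c a = verma_class G \<rho> t c b \<longleftrightarrow> a - b \<in> verma_ideal G \<rho> t c"
    and verma_carrier: "carrier (verma G \<rho> t c triv) = range (verma_class G \<rho> t c)"
    and verma_add: "verma_class G \<rho> t c a \<oplus>\<^bsub>verma G \<rho> t c triv\<^esub> verma_class G \<rho> t c b = verma_class G \<rho> t c (a + b)"
    and verma_zero: "\<zero>\<^bsub>verma G \<rho> t c triv\<^esub> = verma_class G \<rho> t c 0"
    and verma_smult: "rca_class G \<rho> t c a \<odot>\<^bsub>verma G \<rho> t c triv\<^esub> verma_class G \<rho> t c b = verma_class G \<rho> t c (a * b)"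
  unfolding verma_def
  by (rule verma.qcl_eq verma.carrier_quot verma.add_quot verma.zero_quot
      verma.smult_quot[where f = "\<lambda>b. a * b"]; simp add: tensor_smult verma_ideal_mult right_diff_distrib)+

definition homog :: "int \<Rightarrow> ('g, 'n, 'k::field) free_alg set" where
  "homog i = {a. \<forall>w\<in>Poly_Mapping.keys a. word_degree w = i}"

lemma homog_add: "a \<in> homog i \<Longrightarrow> b \<in> homog i \<Longrightarrow> a + b \<in> homog i"
  using keys_add[of a b] by (fastforce simp: homog_def)

lemma homog_mult: "a \<in> homog i \<Longrightarrow> b \<in> homog l \<Longrightarrow> a * b \<in> homog (i + l)"
proof -
  have "word_degree (u + v) = word_degree u + word_degree v" for u v :: "('a, 'b) gen free_monoid"
    by (simp add: word_degree_def plus_free_monoid_def)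
  then show "a \<in> homog i \<Longrightarrow> b \<in> homog l \<Longrightarrow> a * b \<in> homog (i + l)"
    using keys_mult[of a b] by (fastforce simp: homog_def)
qed

lemma homog_scalar: "scalar r \<in> homog 0"
  by (auto simp: scalar_def homog_def word_degree_def zero_free_monoid_def)

lemma homog_grp: "grp g \<in> homog 0"
  by (simp add: grp_def homog_def word_degree_def)

lemma homog_xvec: "xvec v \<in> homog 1"
  unfolding homog_def xvec_def
proof (intro CollectI ballI)
  fix w assume "w \<in> Poly_Mapping.keys (\<Sum>i\<in>UNIV. Poly_Mapping.single (Word [GenX i]) (v $ i))"
  then obtain i where "w \<in> Poly_Mapping.keys (Poly_Mapping.single (Word [GenX i]) (v $ i))"
    by (blast dest: subsetD[OF keys_sum])
  then show "word_degree w = 1" by (simp add: word_degree_def split: if_splits)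
qed

lemma verma_piece_triv: "verma_piece G \<rho> t c triv i = verma_class G \<rho> t c ` homog i"
proof -
  have "{f :: 1 \<Rightarrow> _. \<forall>j. f j \<in> rca_piece G \<rho> t c i} = tensor_class G \<rho> t c ` homog i"
  proof (intro equalityI subsetI)
    fix f :: "1 \<Rightarrow> _" assume "f \<in> {f. \<forall>j. f j \<in> rca_piece G \<rho> t c i}"
    then have "f 1 \<in> rca_piece G \<rho> t c i" by blast
    then obtain a where "a \<in> homog i" "f 1 = rca_class G \<rho> t c a"
      by (auto simp: rca_piece_def homog_def)
    moreover from this(2) have "f = tensor_class G \<rho> t c a" by (intro fun_num1_eqI) (simp add: tensor_class_def)
    ultimately show "f \<in> tensor_class G \<rho> t c ` homog i" by blast
  qed (auto simp: tensor_class_def rca_piece_def homog_def)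
  then show ?thesis by (simp add: verma_piece_def image_image verma_class_def)
qed

lemma verma_low_triv: "verma_low G \<rho> t c triv v = verma_class G \<rho> t c (scalar (v $ 1))"
  by (simp add: verma_low_def rca_one pure_tensor_class verma_class_def)

subsection \<open>The piece of degree zero\<close>

lemma word_degree_Word: "word_degree (Word l) = sum_list (map gen_degree l)"
  by (simp add: word_degree_def)

text \<open>
  Representatives of the span of the elements \<open>x\<^sub>1 \<dots> x\<^sub>d \<otimes> 1\<close>, which is zero for negative \<open>d\<close>.  The
  following lemmas show that \<open>G\<close>, \<open>h\<^sup>*\<close> and \<open>h\<close> shift \<open>d\<close> by 0, 1 and \<open>-1\<close>, so that these spans exhaust
  the Verma module.
\<close>

inductive xspan :: "('g, 'm) monoid_scheme \<Rightarrow> ('g \<Rightarrow> 'k::field^'n^'n) \<Rightarrow> 'k \<Rightarrow> ('g \<Rightarrow> 'k)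
    \<Rightarrow> int \<Rightarrow> ('g, 'n, 'k) free_alg \<Rightarrow> bool"
  for G \<rho> t c where
  null: "a \<in> verma_ideal G \<rho> t c \<Longrightarrow> xspan G \<rho> t c d a"
| word: "d = int (length l) \<Longrightarrow> xspan G \<rho> t c d (Poly_Mapping.single (Word (map GenX l)) r)"
| add: "xspan G \<rho> t c d a \<Longrightarrow> xspan G \<rho> t c d b \<Longrightarrow> xspan G \<rho> t c d (a + b)"

lemma xspan_scalar: "xspan G \<rho> t c d a \<Longrightarrow> xspan G \<rho> t c d (scalar r * a)"
  by (induction rule: xspan.induct)
     (auto simp: scalar_mult_single distrib_left intro: xspan.intros verma_ideal_mult)

lemma xspan_uminus: "xspan G \<rho> t c d a \<Longrightarrow> xspan G \<rho> t c d (- a)"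
  using xspan_scalar[of G \<rho> t c d a "- 1"] by (simp add: scalar_uminus)

lemma xspan_diff: "xspan G \<rho> t c d a \<Longrightarrow> xspan G \<rho> t c d b \<Longrightarrow> xspan G \<rho> t c d (a - b)"
  using xspan.add[OF _ xspan_uminus] by (metis diff_conv_add_uminus)

lemma xspan_sum: "(\<And>i. i \<in> A \<Longrightarrow> xspan G \<rho> t c d (f i)) \<Longrightarrow> xspan G \<rho> t c d (\<Sum>i\<in>A. f i)"
  by (induction A rule: infinite_finite_induct) (auto intro: xspan.add xspan.null)

lemma xspan_x: "xspan G \<rho> t c d a \<Longrightarrow> xspan G \<rho> t c (d + 1) (xgen i * a)"
proof (induction rule: xspan.induct)
  case (word d l r)
  then show ?case using xspan.word[of "d + 1" "i # l" G \<rho> t c r] by simp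
qed (auto simp: distrib_left intro: xspan.intros verma_ideal_mult)

lemma xspan_xvec: "xspan G \<rho> t c d a \<Longrightarrow> xspan G \<rho> t c (d + 1) (xvec v * a)"
  unfolding xvec_expand sum_distrib_right mult.assoc
  by (intro xspan_sum xspan_scalar xspan_x)

lemma xspan_cong: "a - b \<in> verma_ideal G \<rho> t c \<Longrightarrow> xspan G \<rho> t c d b \<Longrightarrow> xspan G \<rho> t c d a"
  using xspan.add[OF xspan.null[of "a - b" G \<rho> t c d], of b] by simp

lemma single_Cons:
  "Poly_Mapping.single (Word (x # l)) (r :: 'k::field) = Poly_Mapping.single (Word [x]) 1 * Poly_Mapping.single (Word l) r"
  by simp

lemma xspan_grp_word:
  "xspan G \<rho> t c (int (length l)) (grp g * Poly_Mapping.single (Word (map GenX l)) r)"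
proof (cases "g \<in> carrier G")
  case False
  then have "grp g \<in> rca_ideal G \<rho> t c" by (intro rca_ideal_rels) (auto simp: smash_rels_def)
  then show ?thesis by (intro xspan.null verma_ideal.ideal rca_ideal_mult_right)
next
  case True
  show ?thesis
  proof (induction l)
    case Nil
    have "grp g * scalar r - scalar r \<in> verma_ideal G \<rho> t c"
      using verma_ideal.grp[OF True, of "scalar r" \<rho> t c]
      by (simp add: scalar_commute[of r "grp g"] right_diff_distrib)
    moreover have "xspan G \<rho> t c 0 (scalar r)"
      using xspan.word[of 0 "[]" G \<rho> t c r] by (simp add: scalar_def Word_Nil)
    ultimately have "xspan G \<rho> t c 0 (grp g * scalar r)" by (rule xspan_cong)
    then show ?case by (simp add: Word_Nil scalar_def)
  next
    case (Cons i l)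
    let ?w = "Poly_Mapping.single (Word (map GenX l)) r"
    have "grp g * xvec (axis i 1) - xvec (dual_rep G \<rho> g *v axis i 1) * grp g \<in> rca_ideal G \<rho> t c"
      using True by (intro rca_ideal_rels) (auto simp: smash_rels_def)
    then have "(grp g * xvec (axis i 1) - xvec (dual_rep G \<rho> g *v axis i 1) * grp g) * ?w \<in> verma_ideal G \<rho> t c"
      by (intro verma_ideal.ideal rca_ideal_mult_right)
    then have 1: "grp g * (xvec (axis i 1) * ?w) - xvec (dual_rep G \<rho> g *v axis i 1) * (grp g * ?w) \<in> verma_ideal G \<rho> t c"
      by (simp only: left_diff_distrib mult.assoc)
    have "xspan G \<rho> t c (int (length l) + 1) (grp g * (xvec (axis i 1) * ?w))"
      by (rule xspan_cong[OF 1 xspan_xvec[OF Cons]])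
    then show ?case
      by (simp only: xvec_axis list.map single_Cons[of "GenX i" "map GenX l"]) (simp add: add.commute)
  qed
qed

lemma xspan_grp: "xspan G \<rho> t c d a \<Longrightarrow> xspan G \<rho> t c d (grp g * a)"
proof (induction rule: xspan.induct)
  case (word d l r) then show ?case by (simp only: xspan_grp_word)
qed (auto simp: distrib_left intro: xspan.intros verma_ideal_mult)

lemma commutator_mult_right:
  "((a * b - b * a) - C) * w = a * (b * w) - (b * (a * w) + C * w)" for a :: "'a::ring"
  by (simp add: algebra_simps)

text \<open>
  Moving \<open>y\<close> to the right past the first letter of a monomial leaves a commutator in \<open>k G\<close> in front of
  the remaining letters, which stays in the span by \<open>xspan_grp_word\<close>.
\<close>

lemma xspan_y_word:
  "xspan G \<rho> t c (int (length l) - 1) (ygen j * Poly_Mapping.single (Word (map GenX l)) r)"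
proof (induction l)
  case Nil
  have "ygen j * scalar r \<in> verma_ideal G \<rho> t c"
    using verma_ideal.yvec[of "scalar r" "axis j 1" G \<rho> t c]
    by (simp only: scalar_commute[of r "ygen j"] yvec_axis)
  then have "xspan G \<rho> t c (- 1) (ygen j * scalar r)" by (rule xspan.null)
  then show ?case by (simp add: Word_Nil scalar_def)
next
  case (Cons i l)
  let ?w = "Poly_Mapping.single (Word (map GenX l)) r"
  let ?d = "int (length l)"
  let ?y = "yvec (axis j 1)" and ?x = "xvec (axis i 1)"
  let ?C = "scalar (pairing (axis j 1) (axis i 1) * t)
          - (\<Sum>s\<in>reflections G \<rho>. scalar (c s * pairing (axis j 1) (axis i 1 - dual_rep G \<rho> s *v axis i 1)) * grp s)"
  have w: "xspan G \<rho> t c ?d ?w" by (rule xspan.word) simp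
  have "(?y * ?x - ?x * ?y) - ?C \<in> rca_ideal G \<rho> t c"
    by (intro rca_ideal_rels) (auto simp: commutator_rels_def)
  then have "((?y * ?x - ?x * ?y) - ?C) * ?w \<in> verma_ideal G \<rho> t c"
    by (intro verma_ideal.ideal rca_ideal_mult_right)
  then have 1: "?y * (?x * ?w) - (?x * (?y * ?w) + ?C * ?w) \<in> verma_ideal G \<rho> t c"
    by (simp only: commutator_mult_right)
  have 2: "xspan G \<rho> t c ?d (?C * ?w)"
    unfolding left_diff_distrib sum_distrib_right mult.assoc
    by (intro xspan_diff xspan_sum xspan_scalar xspan_grp_word w)
  have 3: "xspan G \<rho> t c ?d (?x * (?y * ?w))"
    using xspan_xvec[OF Cons, of "axis i 1"] by (simp only: yvec_axis diff_add_cancel)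
  have "xspan G \<rho> t c ?d (?y * (?x * ?w))"
    by (rule xspan_cong[OF 1 xspan.add[OF 3 2]])
  then show ?case
    by (simp only: xvec_axis yvec_axis list.map single_Cons[of "GenX i" "map GenX l"]) simp
qed

lemma xspan_y: "xspan G \<rho> t c d a \<Longrightarrow> xspan G \<rho> t c (d - 1) (ygen i * a)"
proof (induction rule: xspan.induct)
  case (word d l r) then show ?case by (simp only: xspan_y_word)
qed (auto simp: distrib_left intro: xspan.intros verma_ideal_mult)

lemma xspan_monomial: "xspan G \<rho> t c (word_degree w) (Poly_Mapping.single w 1)"
proof -
  have "xspan G \<rho> t c (sum_list (map gen_degree l)) (Poly_Mapping.single (Word l) 1)" for l
  proof (induction l)
    case Nil then show ?case using xspan.word[of 0 "[]" G \<rho> t c 1] by simp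
  next
    case (Cons x l)
    then show ?case
      using xspan_grp[OF Cons] xspan_x[OF Cons] xspan_y[OF Cons]
      by (cases x) (simp_all add: grp_def add.commute[of 1])
  qed
  then show ?thesis by (cases w) (simp add: word_degree_Word)
qed

text \<open>
  This makes a functional on the Verma module unique once its value on the lowest weight vector is
  known and it vanishes on the other graded pieces.
\<close>

lemma degree_0_scalar:
  assumes "word_degree w = 0"
  shows "\<exists>r. Poly_Mapping.single w 1 - scalar r \<in> verma_ideal G \<rho> t c"
proof -
  have "\<exists>r. a - scalar r \<in> verma_ideal G \<rho> t c" if "xspan G \<rho> t c d a" "d = 0" for a d
    using that
  proof (induction rule: xspan.induct)
    case (null a d)
    then show ?case by (intro exI[of _ 0]) simp
  next
    case (word d l r)
    then show ?case by (intro exI[of _ r]) (simp add: scalar_def Word_Nil)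
  next
    case (add d a b)
    then obtain r s where "a - scalar r \<in> verma_ideal G \<rho> t c" "b - scalar s \<in> verma_ideal G \<rho> t c" by blast
    then have "(a - scalar r) + (b - scalar s) \<in> verma_ideal G \<rho> t c" by (rule verma_ideal.add)
    then show ?case by (intro exI[of _ "r + s"]) (simp add: scalar_add algebra_simps)
  qed
  then show ?thesis using xspan_monomial[of G \<rho> t c w] assms by blast
qed

subsection \<open>The anti-isomorphism and the relations\<close>

definition outer :: "'k::field^'n \<Rightarrow> 'k^'m \<Rightarrow> 'k^'m^'n" where
  "outer u a = (\<chi> i j. u $ i * a $ j)"

lemma rank_1_iff_outer:
  fixes A :: "'k::field^'n^'m"
  shows "rank A = 1 \<longleftrightarrow> (\<exists>u a. u \<noteq> 0 \<and> a \<noteq> 0 \<and> A = outer u a)"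
proof
  assume "rank A = 1"
  then have d: "vec.dim (rows A) = 1" by (simp add: row_rank_def_gen)
  obtain B where B: "B \<subseteq> rows A" "vec.independent B" "rows A \<subseteq> vec.span B" "card B = vec.dim (rows A)"
    using vec.basis_exists by blast
  then obtain b where b: "B = {b}" using d card_1_singletonE by metis
  then have b0: "b \<noteq> 0" using B(2) vec.dependent_zero by blast
  have "\<exists>r. row i A = r *s b" for i
    using B(3) unfolding b vec.span_singleton by (auto simp: rows_def)
  then obtain u where u: "row i A = u i *s b" for i by metis
  then have A: "A = outer (\<chi> i. u i) b"
    by (simp add: outer_def vec_eq_iff row_def)
  have "(\<chi> i. u i) \<noteq> 0"
  proof
    assume "(\<chi> i. u i) = 0"
    then have "A = 0" unfolding A by (simp add: outer_def vec_eq_iff)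
    then have "rows A \<subseteq> {0}" by (auto simp: rows_def row_def vec_eq_iff)
    then show False using B(1) b b0 by auto
  qed
  then show "\<exists>u a. u \<noteq> 0 \<and> a \<noteq> 0 \<and> A = outer u a" using A b0 by blast
next
  assume "\<exists>u a. u \<noteq> 0 \<and> a \<noteq> 0 \<and> A = outer u a"
  then obtain u a where ua: "u \<noteq> 0" "a \<noteq> 0" "A = outer u a" by blast
  obtain i where i: "u $ i \<noteq> 0" using ua(1) by (auto simp: vec_eq_iff)
  have row: "row j A = u $ j *s a" for j
    by (simp add: ua(3) outer_def row_def vec_eq_iff)
  have "vec.span (rows A) = vec.span {a}"
  proof (rule vec.span_eq[THEN iffD2], intro conjI subsetI)
    fix x assume "x \<in> rows A"
    then show "x \<in> vec.span {a}" by (auto simp: rows_def row intro: vec.span_scale vec.span_base)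
  next
    fix x assume "x \<in> {a}"
    then have "x = inverse (u $ i) *s row i A" using i by (simp add: row)
    moreover have "row i A \<in> rows A" by (auto simp: rows_def)
    ultimately show "x \<in> vec.span (rows A)" by (auto intro: vec.span_scale vec.span_base)
  qed
  moreover have "vec.independent {a}" using ua(2) by simp
  ultimately have "vec.dim (rows A) = 1"
    by (metis vec.dim_span vec.dim_eq_card_independent card_1_singleton_iff One_nat_def)
  then show "rank A = 1" by (simp add: row_rank_def_gen)
qed

lemma transpose_outer: "transpose (outer u a) = outer a u"
  by (simp add: outer_def transpose_def vec_eq_iff mult.commute)

text \<open>
  Being a reflection passes to the dual representation.
\<close>

lemma rank_1_transpose: "rank (transpose A) = 1 \<longleftrightarrow> rank (A :: 'k::field^'n^'m) = 1"
  unfolding rank_1_iff_outer by (metis transpose_outer transpose_transpose)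

lemma transpose_diff: "transpose (A - B) = transpose A - transpose (B :: 'k::field^'n^'m)"
  by (simp add: transpose_def vec_eq_iff)

definition matrix_rep :: "('g, 'm) monoid_scheme \<Rightarrow> ('g \<Rightarrow> 'k::field^'n^'n) \<Rightarrow> bool" where
  "matrix_rep G \<rho> \<longleftrightarrow> group G \<and> \<rho> \<one>\<^bsub>G\<^esub> = mat 1
     \<and> (\<forall>g\<in>carrier G. \<forall>h\<in>carrier G. \<rho> (g \<otimes>\<^bsub>G\<^esub> h) = \<rho> g ** \<rho> h)"

lemma matrix_repD:
  assumes "matrix_rep G \<rho>"
  shows "group G" "\<rho> \<one>\<^bsub>G\<^esub> = mat 1"
    "g \<in> carrier G \<Longrightarrow> h \<in> carrier G \<Longrightarrow> \<rho> (g \<otimes>\<^bsub>G\<^esub> h) = \<rho> g ** \<rho> h"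
    "g \<in> carrier G \<Longrightarrow> \<rho> (inv\<^bsub>G\<^esub> g) ** \<rho> g = mat 1"
    "g \<in> carrier G \<Longrightarrow> \<rho> g ** \<rho> (inv\<^bsub>G\<^esub> g) = mat 1"
proof -
  interpret group G using assms by (simp add: matrix_rep_def)
  show "group G" by (rule group_axioms)
  show 1: "\<rho> \<one>\<^bsub>G\<^esub> = mat 1" using assms by (simp add: matrix_rep_def)
  show *: "\<rho> (g \<otimes>\<^bsub>G\<^esub> h) = \<rho> g ** \<rho> h" if "g \<in> carrier G" "h \<in> carrier G" for g h
    using assms that by (simp add: matrix_rep_def)
  show "\<rho> (inv\<^bsub>G\<^esub> g) ** \<rho> g = mat 1" if "g \<in> carrier G"
    using *[of "inv\<^bsub>G\<^esub> g" g] that 1 by simp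
  show "\<rho> g ** \<rho> (inv\<^bsub>G\<^esub> g) = mat 1" if "g \<in> carrier G"
    using *[of g "inv\<^bsub>G\<^esub> g"] that 1 by simp
qed

lemma matrix_rep_dual: "matrix_rep G \<rho> \<Longrightarrow> matrix_rep G (dual_rep G \<rho>)"
proof -
  assume \<rho>: "matrix_rep G \<rho>"
  interpret group G using \<rho> by (simp add: matrix_rep_def)
  show ?thesis
    using \<rho> unfolding matrix_rep_def
    by (auto simp: dual_rep_def inv_mult_group matrix_transpose_mul)
qed

lemma pairing_transpose: "pairing y (transpose A *v x) = pairing x (A *v (y :: 'k::field^'n))"
proof -
  have "pairing y (transpose A *v x) = (\<Sum>i\<in>UNIV. \<Sum>j\<in>UNIV. x $ j * (A $ j $ i * y $ i))"
    by (simp add: pairing_def matrix_vector_mult_def transpose_def sum_distrib_left mult_ac)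
  also have "\<dots> = pairing x (A *v y)"
    by (subst sum.swap) (simp add: pairing_def matrix_vector_mult_def sum_distrib_left)
  finally show ?thesis .
qed

lemma pairing_commute: "pairing x y = pairing y x"
  by (simp add: pairing_def mult.commute)

lemma pairing_diff: "pairing x (y - z) = pairing x y - pairing x z"
  by (simp add: pairing_def right_diff_distrib sum_subtractf)

text \<open>
  The hypotheses are symmetric in the two sets of data, so the lemma covers the passage to the dual
  algebra as well as the way back.
\<close>

lemma opp_free_rca_ideal:
  fixes G :: "('g, 'm) monoid_scheme" and \<rho>1 \<rho>2 :: "'g \<Rightarrow> 'k::field^'n^'n"
  assumes \<rho>1: "matrix_rep G \<rho>1"
    and \<rho>2: "\<And>g. g \<in> carrier G \<Longrightarrow> \<rho>2 g = transpose (\<rho>1 (inv\<^bsub>G\<^esub> g))"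
    and c2: "\<And>s. s \<in> carrier G \<Longrightarrow> c2 s = c1 (inv\<^bsub>G\<^esub> s)"
    and a: "a \<in> rca_ideal G \<rho>1 t c1"
  shows "opp_free G a \<in> rca_ideal G \<rho>2 t c2"
proof -
  interpret group G using \<rho>1 by (simp add: matrix_rep_def)
  note rel = rca_ideal_rels[of _ G \<rho>2 t c2]
  have dual2: "dual_rep G \<rho>2 g = \<rho>1 g" if "g \<in> carrier G" for g
    using that by (simp add: dual_rep_def \<rho>2)
  have "rca_ideal G \<rho>1 t c1 \<subseteq> {a. opp_free G a \<in> rca_ideal G \<rho>2 t c2}"
  proof (rule rca_ideal_subset)
    have "opp_free G a \<in> rca_ideal G \<rho>2 t c2" if "a \<in> smash_rels G \<rho>1" for a
      using that unfolding smash_rels_def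
    proof (elim UnE CollectE exE conjE)
      fix g assume "a = grp g" "g \<notin> carrier G"
      then show ?thesis by (intro rel) (auto simp: opp_free_grp smash_rels_def)
    next
      assume "a \<in> {grp \<one>\<^bsub>G\<^esub> - 1}"
      then show ?thesis by (intro rel) (auto simp: opp_free_diff opp_free_grp smash_rels_def)
    next
      fix g h assume a: "a = grp (g \<otimes>\<^bsub>G\<^esub> h) - grp g * grp h" and gh: "g \<in> carrier G" "h \<in> carrier G"
      have "opp_free G a = grp (inv\<^bsub>G\<^esub> h \<otimes>\<^bsub>G\<^esub> inv\<^bsub>G\<^esub> g) - grp (inv\<^bsub>G\<^esub> h) * grp (inv\<^bsub>G\<^esub> g)"
        using gh by (simp add: a opp_free_diff opp_free_mult opp_free_grp inv_mult_group)
      then show ?thesis using gh by (intro rel) (auto simp: smash_rels_def)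
    next
      fix g y assume a: "a = grp g * yvec y - yvec (\<rho>1 g *v y) * grp g" and g: "g \<in> carrier G"
      have "opp_free G a = - (grp (inv\<^bsub>G\<^esub> g) * xvec (\<rho>1 g *v y) - xvec y * grp (inv\<^bsub>G\<^esub> g))"
        using g by (simp add: a opp_free_diff opp_free_mult opp_free_grp opp_free_yvec)
      moreover have "dual_rep G \<rho>2 (inv\<^bsub>G\<^esub> g) *v (\<rho>1 g *v y) = y"
        using g by (simp add: dual2 matrix_vector_mul_assoc matrix_repD(4)[OF \<rho>1])
      moreover have "grp (inv\<^bsub>G\<^esub> g) * xvec (\<rho>1 g *v y)
          - xvec (dual_rep G \<rho>2 (inv\<^bsub>G\<^esub> g) *v (\<rho>1 g *v y)) * grp (inv\<^bsub>G\<^esub> g) \<in> rca_ideal G \<rho>2 t c2"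
        using g by (intro rel) (auto simp: smash_rels_def)
      ultimately show ?thesis using rca_ideal_uminus by metis
    next
      fix g x assume a: "a = grp g * xvec x - xvec (dual_rep G \<rho>1 g *v x) * grp g" and g: "g \<in> carrier G"
      have "opp_free G a = - (grp (inv\<^bsub>G\<^esub> g) * yvec (dual_rep G \<rho>1 g *v x) - yvec x * grp (inv\<^bsub>G\<^esub> g))"
        using g by (simp add: a opp_free_diff opp_free_mult opp_free_grp opp_free_xvec)
      moreover have "\<rho>2 (inv\<^bsub>G\<^esub> g) *v (dual_rep G \<rho>1 g *v x) = x"
        using g by (simp add: \<rho>2 dual_rep_def matrix_vector_mul_assoc matrix_transpose_mul[symmetric]
          matrix_repD(4)[OF \<rho>1] del: transpose_matrix_vector)
      moreover have "grp (inv\<^bsub>G\<^esub> g) * yvec (dual_rep G \<rho>1 g *v x)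
          - yvec (\<rho>2 (inv\<^bsub>G\<^esub> g) *v (dual_rep G \<rho>1 g *v x)) * grp (inv\<^bsub>G\<^esub> g) \<in> rca_ideal G \<rho>2 t c2"
        using g by (intro rel) (auto simp: smash_rels_def)
      ultimately show ?thesis using rca_ideal_uminus by metis
    qed
    moreover have "opp_free G a \<in> rca_ideal G \<rho>2 t c2" if "a \<in> commutator_rels G \<rho>1 t c1" for a
      using that unfolding commutator_rels_def
    proof (elim UnE CollectE exE conjE)
      fix x x' assume "a = xvec x * xvec x' - xvec x' * xvec x"
      then show ?thesis
        by (intro rel) (auto simp: opp_free_diff opp_free_mult opp_free_xvec commutator_rels_def)
    next
      fix x x' assume "a = yvec x * yvec x' - yvec x' * yvec x"
      then show ?thesis
        by (intro rel) (auto simp: opp_free_diff opp_free_mult opp_free_yvec commutator_rels_def)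
    next
      fix x y assume a: "a = (yvec y * xvec x - xvec x * yvec y)
         - (scalar (pairing y x * t)
            - (\<Sum>s\<in>reflections G \<rho>1. scalar (c1 s * pairing y (x - dual_rep G \<rho>1 s *v x)) * grp s))"
      have refl: "reflections G \<rho>2 = m_inv G ` reflections G \<rho>1"
      proof -
        have "s \<in> reflections G \<rho>2 \<longleftrightarrow> s \<in> carrier G \<and> inv\<^bsub>G\<^esub> s \<in> reflections G \<rho>1" for s
          using rank_1_transpose[of "mat 1 - \<rho>1 (inv\<^bsub>G\<^esub> s)"]
          by (auto simp: reflections_def \<rho>2 transpose_diff)
        moreover have "s \<in> carrier G" if "s \<in> reflections G \<rho>1" for s
          using that by (simp add: reflections_def)
        ultimately show ?thesis by (force simp: image_iff)
      qed
      have inj: "inj_on (m_inv G) (reflections G \<rho>1)"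
        by (rule inj_onI) (auto simp: reflections_def dest: inv_inv)
      have "(\<Sum>s\<in>reflections G \<rho>2. scalar (c2 s * pairing x (y - dual_rep G \<rho>2 s *v y)) * grp s :: ('g, 'n, 'k) free_alg)
        = (\<Sum>s\<in>reflections G \<rho>1. scalar (c2 (inv\<^bsub>G\<^esub> s) * pairing x (y - dual_rep G \<rho>2 (inv\<^bsub>G\<^esub> s) *v y)) * grp (inv\<^bsub>G\<^esub> s))"
        unfolding refl by (subst sum.reindex[OF inj]) simp
      also have "\<dots> = (\<Sum>s\<in>reflections G \<rho>1. opp_free G (scalar (c1 s * pairing y (x - dual_rep G \<rho>1 s *v x)) * grp s))"
      proof (rule sum.cong)
        fix s assume "s \<in> reflections G \<rho>1"
        then have s: "s \<in> carrier G" by (simp add: reflections_def)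
        have "pairing x (y - dual_rep G \<rho>2 (inv\<^bsub>G\<^esub> s) *v y) = pairing y (x - dual_rep G \<rho>1 s *v x)"
          using s by (simp add: pairing_diff dual2) (simp add: dual_rep_def pairing_transpose pairing_commute[of y x] del: transpose_matrix_vector)
        then show "scalar (c2 (inv\<^bsub>G\<^esub> s) * pairing x (y - dual_rep G \<rho>2 (inv\<^bsub>G\<^esub> s) *v y)) * grp (inv\<^bsub>G\<^esub> s)
          = opp_free G (scalar (c1 s * pairing y (x - dual_rep G \<rho>1 s *v x)) * grp s :: ('g, 'n, 'k) free_alg)"
          using s by (simp add: opp_free_mult opp_free_grp c2 scalar_commute)
      qed simp
      finally have "opp_free G a = (yvec x * xvec y - xvec y * yvec x) - (scalar (pairing x y * t)
            - (\<Sum>s\<in>reflections G \<rho>2. scalar (c2 s * pairing x (y - dual_rep G \<rho>2 s *v y)) * grp s))"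
        by (simp add: a opp_free_diff opp_free_mult opp_free_xvec opp_free_yvec opp_free_sum pairing_commute)
      then show ?thesis by (intro rel) (auto simp: commutator_rels_def)
    qed
    ultimately show "smash_rels G \<rho>1 \<union> commutator_rels G \<rho>1 t c1 \<subseteq> {a. opp_free G a \<in> rca_ideal G \<rho>2 t c2}"
      by blast
  qed (auto simp: opp_free_add opp_free_uminus opp_free_mult
      intro: rca_ideal_add rca_ideal_uminus rca_ideal_mult_left rca_ideal_mult_right)
  then show ?thesis using a by blast
qed

section \<open>Lowest weight representations\<close>


locale rca_rep = vector_space scal
  for scal :: "'k::field \<Rightarrow> 'v::ab_group_add \<Rightarrow> 'v" +
  fixes G :: "('g, 'm) monoid_scheme" and \<rho> :: "'g \<Rightarrow> 'k^'n^'n" and t :: 'k and c :: "'g \<Rightarrow> 'k"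
    and Gop :: "'g \<Rightarrow> 'v \<Rightarrow> 'v" and Xop Yop :: "'k^'n \<Rightarrow> 'v \<Rightarrow> 'v"
  assumes rep: "matrix_rep G \<rho>"
    and Gop_add: "g \<in> carrier G \<Longrightarrow> Gop g (u + v) = Gop g u + Gop g v"
    and Gop_scal: "g \<in> carrier G \<Longrightarrow> Gop g (scal a v) = scal a (Gop g v)"
    and Xop_add: "Xop x (u + v) = Xop x u + Xop x v" and Xop_scal: "Xop x (scal a v) = scal a (Xop x v)"
    and Xop_add_left: "Xop (x + x') v = Xop x v + Xop x' v" and Xop_scal_left: "Xop (a *s x) v = scal a (Xop x v)"
    and Yop_add: "Yop y (u + v) = Yop y u + Yop y v" and Yop_scal: "Yop y (scal a v) = scal a (Yop y v)"
    and Yop_add_left: "Yop (y + y') v = Yop y v + Yop y' v" and Yop_scal_left: "Yop (a *s y) v = scal a (Yop y v)"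
    and Gop_one: "Gop \<one>\<^bsub>G\<^esub> v = v"
    and Gop_mult: "g \<in> carrier G \<Longrightarrow> h \<in> carrier G \<Longrightarrow> Gop (g \<otimes>\<^bsub>G\<^esub> h) v = Gop g (Gop h v)"
    and Gop_Yop: "g \<in> carrier G \<Longrightarrow> Gop g (Yop y v) = Yop (\<rho> g *v y) (Gop g v)"
    and Gop_Xop: "g \<in> carrier G \<Longrightarrow> Gop g (Xop x v) = Xop (dual_rep G \<rho> g *v x) (Gop g v)"
    and Xop_commute: "Xop x (Xop x' v) = Xop x' (Xop x v)"
    and Yop_commute: "Yop y (Yop y' v) = Yop y' (Yop y v)"
    and Yop_Xop: "Yop y (Xop x v) - Xop x (Yop y v) = scal (pairing y x * t) v
          - (\<Sum>s\<in>reflections G \<rho>. scal (c s * pairing y (x - dual_rep G \<rho> s *v x)) (Gop s v))"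
begin

definition op :: "('g, 'n) gen \<Rightarrow> 'v \<Rightarrow> 'v" where
  "op x v = (case x of GenG g \<Rightarrow> if g \<in> carrier G then Gop g v else 0
     | GenY i \<Rightarrow> Yop (axis i 1) v | GenX i \<Rightarrow> Xop (axis i 1) v)"

definition word_op :: "('g, 'n) gen free_monoid \<Rightarrow> 'v \<Rightarrow> 'v" where
  "word_op w = foldr op (letters w)"

definition alg_op :: "('g, 'n, 'k) free_alg \<Rightarrow> 'v \<Rightarrow> 'v" where
  "alg_op a v = (\<Sum>w\<in>Poly_Mapping.keys a. scal (Poly_Mapping.lookup a w) (word_op w v))"

lemma op_add: "op x (u + v) = op x u + op x v"
  and op_scal: "op x (scal a v) = scal a (op x v)"
  by (simp_all add: op_def Gop_add Gop_scal Xop_add Xop_scal Yop_add Yop_scal split: gen.split)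

lemma word_op_add: "word_op w (u + v) = word_op w u + word_op w v"
  and word_op_scal: "word_op w (scal a v) = scal a (word_op w v)"
proof -
  have "foldr op l (u + v) = foldr op l u + foldr op l v" "foldr op l (scal a v) = scal a (foldr op l v)" for l
    by (induction l) (simp_all add: op_add op_scal)
  then show "word_op w (u + v) = word_op w u + word_op w v" "word_op w (scal a v) = scal a (word_op w v)"
    by (simp_all add: word_op_def)
qed

lemma alg_op_add_left: "alg_op (a + b) v = alg_op a v + alg_op b v"
  unfolding alg_op_def by (rule setsum_keys_plus_distrib) (simp_all add: scale_left_distrib)

lemma alg_op_single: "alg_op (Poly_Mapping.single w r) v = scal r (word_op w v)"
  by (cases "r = 0") (simp_all add: alg_op_def)

lemma alg_op_0_left [simp]: "alg_op 0 v = 0" by (simp add: alg_op_def)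

lemma alg_op_uminus_left: "alg_op (- a) v = - alg_op a v"
  using alg_op_add_left[of "- a" a v] by (simp add: eq_neg_iff_add_eq_0)

lemma alg_op_diff_left: "alg_op (a - b) v = alg_op a v - alg_op b v"
  using alg_op_add_left[of a "- b" v] by (simp add: alg_op_uminus_left)

lemma alg_op_sum_left: "alg_op (\<Sum>i\<in>A. f i) v = (\<Sum>i\<in>A. alg_op (f i) v)"
  by (induction A rule: infinite_finite_induct) (simp_all add: alg_op_add_left)

lemma alg_op_add: "alg_op a (u + v) = alg_op a u + alg_op a v"
  by (simp add: alg_op_def word_op_add scale_right_distrib sum.distrib)

lemma alg_op_scal: "alg_op a (scal r v) = scal r (alg_op a v)"
  by (simp add: alg_op_def word_op_scal scale_sum_right mult.commute)

lemma alg_op_0 [simp]: "alg_op a 0 = 0"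
  using alg_op_scal[of a 0 0] by simp

lemma alg_op_mult: "alg_op (a * b) v = alg_op a (alg_op b v)"
proof (induction a rule: poly_mapping_single_induct)
  case (single u r)
  show ?case
  proof (induction b rule: poly_mapping_single_induct)
    case (single w s)
    show ?case
      by (cases u; cases w) (simp add: alg_op_single word_op_def alg_op_scal)
  qed (simp_all add: distrib_left alg_op_add_left alg_op_add)
qed (simp_all add: distrib_right alg_op_add_left)

lemma alg_op_scalar: "alg_op (scalar r) v = scal r v"
  by (simp add: scalar_def alg_op_single word_op_def zero_free_monoid_def)

lemma alg_op_1 [simp]: "alg_op 1 v = v"
  using alg_op_scalar[of 1 v] by simp

lemma alg_op_grp: "alg_op (grp g) v = (if g \<in> carrier G then Gop g v else 0)"
  by (simp add: grp_def alg_op_single word_op_def op_def)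

lemma basis_sum_op:
  assumes "\<And>x x'. F (x + x') = F x + F x'" "\<And>a x. F (a *s x) = scal a (F x)"
  shows "(\<Sum>i\<in>UNIV. scal (x $ i) (F (axis i 1))) = F (x :: 'k^'n)"
proof -
  have F0: "F 0 = 0" using assms(1)[of 0 0] by simp
  have "F (\<Sum>i\<in>A. f i) = (\<Sum>i\<in>A. F (f i))" for A :: "'n set" and f
    by (induction A rule: infinite_finite_induct) (simp_all add: assms(1) F0)
  then have "(\<Sum>i\<in>UNIV. scal (x $ i) (F (axis i 1))) = F (\<Sum>i\<in>UNIV. x $ i *s axis i 1)"
    by (simp add: assms(2))
  then show ?thesis by (simp add: basis_expansion)
qed

lemma alg_op_xvec: "alg_op (xvec x) v = Xop x v"
  unfolding xvec_def alg_op_sum_left alg_op_single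
  using basis_sum_op[of "\<lambda>x. Xop x v" x] by (simp add: word_op_def op_def Xop_add_left Xop_scal_left)

lemma alg_op_yvec: "alg_op (yvec y) v = Yop y v"
  unfolding yvec_def alg_op_sum_left alg_op_single
  using basis_sum_op[of "\<lambda>y. Yop y v" y] by (simp add: word_op_def op_def Yop_add_left Yop_scal_left)

lemmas alg_op_simps = alg_op_add_left alg_op_uminus_left alg_op_diff_left alg_op_sum_left
  alg_op_mult alg_op_scalar alg_op_grp alg_op_xvec alg_op_yvec

lemma alg_op_rca_ideal:
  assumes "a \<in> rca_ideal G \<rho> t c"
  shows "alg_op a v = 0"
proof -
  interpret group G using rep by (simp add: matrix_rep_def)
  have "rca_ideal G \<rho> t c \<subseteq> {a. \<forall>v. alg_op a v = 0}"
  proof (rule rca_ideal_subset)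
    show "smash_rels G \<rho> \<union> commutator_rels G \<rho> t c \<subseteq> {a. \<forall>v. alg_op a v = 0}"
    proof
      fix a assume "a \<in> smash_rels G \<rho> \<union> commutator_rels G \<rho> t c"
      then show "a \<in> {a. \<forall>v. alg_op a v = 0}"
        unfolding smash_rels_def commutator_rels_def
      proof (elim UnE CollectE exE conjE, goal_cases)
        case (8 y x)
        have "s \<in> carrier G" if "s \<in> reflections G \<rho>" for s using that by (simp add: reflections_def)
        then show ?case
          unfolding 8 by (simp add: alg_op_simps Yop_Xop cong: sum.cong)
      qed (auto simp: alg_op_simps Gop_one Gop_mult Gop_Yop Gop_Xop Xop_commute Yop_commute)
    qed
  qed (auto simp: alg_op_simps)
  then show ?thesis using assms by blast
qed

end

text \<open>
  The functional \<open>\<epsilon>\<close> is the coefficient of the vacuum \<open>\<Omega>\<close>.  Its invariance under \<open>G\<close> and its vanishing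
  on the image of \<open>h\<^sup>*\<close> are what the lowest weight conditions for the dual Verma module turn into
  under the anti-isomorphism.  The assumption \<open>cogenerated\<close> makes the pairing nondegenerate on the
  representation, and \<open>generated\<close> makes the representation a quotient of the Verma module.
\<close>

locale lowest_weight_rep = rca_rep scal G \<rho> t c Gop Xop Yop
  for scal :: "'k::field \<Rightarrow> 'v::ab_group_add \<Rightarrow> 'v"
    and G :: "('g, 'm) monoid_scheme" and \<rho> :: "'g \<Rightarrow> 'k^'n^'n" and t :: 'k and c :: "'g \<Rightarrow> 'k"
    and Gop :: "'g \<Rightarrow> 'v \<Rightarrow> 'v" and Xop Yop :: "'k^'n \<Rightarrow> 'v \<Rightarrow> 'v" +
  fixes \<Omega> :: 'v and \<epsilon> :: "'v \<Rightarrow> 'k" and comp :: "int \<Rightarrow> 'v set"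
  assumes Gop_vac: "g \<in> carrier G \<Longrightarrow> Gop g \<Omega> = \<Omega>" and Yop_vac: "Yop y \<Omega> = 0"
    and eps_add: "\<epsilon> (u + v) = \<epsilon> u + \<epsilon> v" and eps_scal: "\<epsilon> (scal a v) = a * \<epsilon> v"
    and eps_vac: "\<epsilon> \<Omega> = 1"
    and eps_Gop: "g \<in> carrier G \<Longrightarrow> \<epsilon> (Gop g v) = \<epsilon> v" and eps_Xop: "\<epsilon> (Xop x v) = 0"
    and comp_0: "0 \<in> comp i" and comp_add: "u \<in> comp i \<Longrightarrow> v \<in> comp i \<Longrightarrow> u + v \<in> comp i"
    and comp_scal: "v \<in> comp i \<Longrightarrow> scal a v \<in> comp i"
    and comp_Gop: "g \<in> carrier G \<Longrightarrow> v \<in> comp i \<Longrightarrow> Gop g v \<in> comp i"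
    and comp_Xop: "v \<in> comp i \<Longrightarrow> Xop x v \<in> comp (i + 1)"
    and comp_Yop: "v \<in> comp i \<Longrightarrow> Yop y v \<in> comp (i - 1)"
    and vac_comp: "\<Omega> \<in> comp 0" and eps_comp: "v \<in> comp i \<Longrightarrow> i \<noteq> 0 \<Longrightarrow> \<epsilon> v = 0"
    and cogenerated: "(\<And>ys. \<epsilon> (foldr Yop ys v) = 0) \<Longrightarrow> v = 0"
    and generated: "v \<in> comp i \<Longrightarrow> \<exists>a\<in>homog i. v = alg_op a \<Omega>"
begin

abbreviation "\<rho>' \<equiv> dual_rep G \<rho>"
abbreviation "c' \<equiv> conj_param G c"
abbreviation "M \<equiv> verma G \<rho> t c triv"
abbreviation "M' \<equiv> verma G \<rho>' t c' triv"
abbreviation "cl \<equiv> verma_class G \<rho> t c"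
abbreviation "cl' \<equiv> verma_class G \<rho>' t c'"
abbreviation "piece i \<equiv> irr_piece G \<rho> t c triv i"

lemma group_G: "group G" using rep by (simp add: matrix_rep_def)

lemma dual_triv: "dual_rep G triv = triv"
  by (auto simp: dual_rep_def triv_def)

lemma dual_verma_eq: "dual_verma G \<rho> t c triv = M'"
  by (simp add: dual_verma_def dual_triv)

lemma dual_verma_piece_eq: "dual_verma_piece G \<rho> t c triv i = cl' ` homog i"
  by (simp add: dual_verma_piece_def dual_triv verma_piece_triv)

lemma opp_ideal: "a \<in> rca_ideal G \<rho> t c \<Longrightarrow> opp_free G a \<in> rca_ideal G \<rho>' t c'"
  by (rule opp_free_rca_ideal[OF rep]) (auto simp: dual_rep_def conj_param_def)

lemma opp_ideal': "a \<in> rca_ideal G \<rho>' t c' \<Longrightarrow> opp_free G a \<in> rca_ideal G \<rho> t c"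
proof (rule opp_free_rca_ideal[OF matrix_rep_dual[OF rep]])
  interpret group G by (rule group_G)
  show "\<rho> g = transpose (\<rho>' (inv\<^bsub>G\<^esub> g))" "c g = c' (inv\<^bsub>G\<^esub> g)" if "g \<in> carrier G" for g
    using that by (simp_all add: dual_rep_def conj_param_def)
qed

lemma opp_map_class: "opp_map G \<rho> t c (rca_class G \<rho> t c a) = rca_class G \<rho>' t c' (opp_free G a)"
proof -
  have "rca_class G \<rho>' t c' (opp_free G b) = rca_class G \<rho>' t c' (opp_free G a)"
    if "b \<in> rca_class G \<rho> t c a" for b
    using opp_ideal[of "b - a"] that by (simp add: rca_class_mem rca_class_eq opp_free_diff)
  moreover have "a \<in> rca_class G \<rho> t c a" by (simp add: rca_class_mem)
  ultimately show ?thesis unfolding opp_map_def by blast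
qed

lemma eps_0 [simp]: "\<epsilon> 0 = 0" using eps_scal[of 0 0] by simp

lemma eps_uminus: "\<epsilon> (- v) = - \<epsilon> v"
  using eps_add[of v "- v"] by (simp add: eq_neg_iff_add_eq_0 add.commute)

lemma eps_diff: "\<epsilon> (u - v) = \<epsilon> u - \<epsilon> v"
  using eps_add[of u "- v"] by (simp add: eps_uminus)

lemma alg_op_verma_ideal: "a \<in> verma_ideal G \<rho> t c \<Longrightarrow> alg_op a \<Omega> = 0"
  by (induction rule: verma_ideal.induct)
     (simp_all add: alg_op_rca_ideal alg_op_simps Gop_vac Yop_vac)

lemma eps_opp_verma_ideal: "b \<in> verma_ideal G \<rho>' t c' \<Longrightarrow> \<epsilon> (alg_op (opp_free G b) v) = 0"
proof (induction rule: verma_ideal.induct)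
  case (ideal a)
  then show ?case by (simp add: alg_op_rca_ideal opp_ideal')
next
  case (grp g a)
  interpret group G by (rule group_G)
  show ?case using grp
    by (simp add: opp_free_mult opp_free_diff opp_free_grp alg_op_simps eps_diff eps_Gop)
next
  case (yvec a y)
  show ?case by (simp add: opp_free_mult opp_free_yvec alg_op_simps eps_Xop)
qed (simp_all add: opp_free_add opp_free_uminus alg_op_simps eps_add eps_uminus)

text \<open>
  In terms of representatives, the contravariant form is the matrix coefficient of \<open>b\<^sup>o\<^sup>p a\<close> at the
  vacuum.
\<close>

definition form :: "('g, 'n, 'k) free_alg \<Rightarrow> ('g, 'n, 'k) free_alg \<Rightarrow> 'k" where
  "form a b = \<epsilon> (alg_op (opp_free G b) (alg_op a \<Omega>))"

lemma form_cong:
  assumes "cl a = cl a'" "cl' b = cl' b'"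
  shows "form a b = form a' b'"
proof -
  have "alg_op a \<Omega> = alg_op a' \<Omega>"
    using assms(1) alg_op_verma_ideal[of "a - a'"] by (simp add: verma_class_eq alg_op_diff_left)
  moreover have "\<epsilon> (alg_op (opp_free G b) v) = \<epsilon> (alg_op (opp_free G b') v)" for v
    using assms(2) eps_opp_verma_ideal[of "b - b'" v]
    by (simp add: verma_class_eq alg_op_diff_left opp_free_diff eps_diff)
  ultimately show ?thesis by (simp add: form_def)
qed

definition form_hom where
  "form_hom m = (\<lambda>m'\<in>carrier M'. form (SOME a. m = cl a) (SOME b. m' = cl' b))"

lemma form_hom_ext: "form_hom m \<in> carrier M' \<rightarrow>\<^sub>E UNIV"
  by (simp add: form_hom_def)

lemma form_hom_verma_class: "form_hom (cl a) (cl' b) = form a b"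
proof -
  have 1: "cl a = cl (SOME a'. cl a = cl a')" by (rule someI) simp
  have 2: "cl' b = cl' (SOME b'. cl' b = cl' b')"
    by (rule someI) simp
  show ?thesis using form_cong[OF 1 2] by (simp add: form_hom_def verma_carrier)
qed

lemma alg_op_comp:
  assumes "v \<in> comp j" "a \<in> homog i"
  shows "alg_op a v \<in> comp (i + j)"
proof -
  have "foldr op l v \<in> comp (sum_list (map gen_degree l) + j)" for l
  proof (induction l)
    case (Cons x l)
    then show ?case
      using comp_Gop[OF _ Cons] comp_Xop[OF Cons] comp_Yop[OF Cons]
      by (cases x) (auto simp: op_def comp_0 algebra_simps)
  qed (simp add: assms)
  then have "word_op w v \<in> comp (word_degree w + j)" for w
    by (simp add: word_op_def word_degree_def)
  then have *: "scal r (word_op w v) \<in> comp (i + j)" if "w \<in> Poly_Mapping.keys a" for w r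
    using assms(2) that comp_scal by (auto simp: homog_def)
  have "(\<Sum>w\<in>A. scal (Poly_Mapping.lookup a w) (word_op w v)) \<in> comp (i + j)"
    if "A \<subseteq> Poly_Mapping.keys a" for A
    using that by (induction A rule: infinite_finite_induct) (auto simp: comp_0 intro!: comp_add *)
  then show ?thesis by (simp add: alg_op_def)
qed

lemma opp_homog:
  fixes a :: "('g, 'n, 'k) free_alg"
  assumes a: "a \<in> homog i"
  shows "opp_free G a \<in> homog (- i)"
proof -
  have gd: "gen_degree (opp_gen G x) = - gen_degree x" for x :: "('g, 'n) gen" by (cases x) auto
  have deg: "word_degree (Word (rev (map (opp_gen G) (letters w)))) = - word_degree w" for w :: "('g, 'n) gen free_monoid"
  proof -
    have "sum_list (map gen_degree (map (opp_gen G) l)) = - sum_list (map gen_degree l)"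
      for l :: "('g, 'n) gen list"
      by (induction l) (simp_all add: gd)
    then show ?thesis by (simp add: word_degree_def rev_map[symmetric] sum_list_rev)
  qed
  show ?thesis unfolding homog_def mem_Collect_eq
  proof
    fix w assume "w \<in> Poly_Mapping.keys (opp_free G a)"
    then obtain u where u: "u \<in> Poly_Mapping.keys a"
      "w \<in> Poly_Mapping.keys (Poly_Mapping.single (Word (rev (map (opp_gen G) (letters u)))) (Poly_Mapping.lookup a u))"
      unfolding opp_free_def by (blast dest: subsetD[OF keys_sum])
    then have "w = Word (rev (map (opp_gen G) (letters u)))" by (simp split: if_splits)
    then show "word_degree w = - i" using u(1) a deg by (simp add: homog_def)
  qed
qed

lemma form_homog: 
  assumes "v \<in> comp j" "b \<in> homog i" "i \<noteq> j"
  shows "\<epsilon> (alg_op (opp_free G b) v) = 0"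
  using eps_comp[OF alg_op_comp[OF assms(1) opp_homog[OF assms(2)]]] assms(3) by simp

abbreviation "RD \<equiv> restricted_dual G \<rho> t c triv"

lemma RD_carrier: "f \<in> carrier RD \<longleftrightarrow> f \<in> carrier M' \<rightarrow>\<^sub>E UNIV
   \<and> (\<forall>a b. f (cl' (a + b)) = f (cl' a) + f (cl' b))
   \<and> (\<forall>r a. f (cl' (scalar r * a)) = r * f (cl' a))
   \<and> finite {i. \<exists>b\<in>homog i. f (cl' b) \<noteq> 0}"
  by (simp add: restricted_dual_def dual_verma_eq dual_verma_piece_eq verma_carrier verma_add verma_smult Let_def)

lemma RD_simps:
  shows RD_zero: "\<zero>\<^bsub>RD\<^esub> = (\<lambda>m\<in>carrier M'. 0)"
    and RD_add: "f \<oplus>\<^bsub>RD\<^esub> f' = (\<lambda>m\<in>carrier M'. f m + f' m)"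
    and RD_smult: "rca_class G \<rho> t c a \<odot>\<^bsub>RD\<^esub> f
      = (\<lambda>m\<in>carrier M'. f (rca_class G \<rho>' t c' (opp_free G a) \<odot>\<^bsub>M'\<^esub> m))"
  by (simp_all add: restricted_dual_def dual_verma_eq Let_def opp_map_class)

text \<open>
  Elements of the restricted dual have to vanish on almost all graded pieces; the degrees occurring
  in \<open>a \<Omega>\<close> bound those on which \<open>form a\<close> does not vanish.
\<close>

lemma alg_op_vac_decompose: "\<exists>I. finite I \<and> (\<exists>f. (\<forall>i\<in>I. f i \<in> comp i) \<and> alg_op a \<Omega> = (\<Sum>i\<in>I. f i))"
proof (induction a rule: poly_mapping_single_induct)
  case zero
  then show ?case by (intro exI[of _ "{}"]) simp
next
  case (add a b)
  then obtain I f J g where I: "finite I" "\<forall>i\<in>I. f i \<in> comp i" "alg_op a \<Omega> = (\<Sum>i\<in>I. f i)"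
    and J: "finite J" "\<forall>i\<in>J. g i \<in> comp i" "alg_op b \<Omega> = (\<Sum>i\<in>J. g i)" by blast
  let ?h = "\<lambda>i. (if i \<in> I then f i else 0) + (if i \<in> J then g i else 0)"
  have 1: "alg_op (a + b) \<Omega> = (\<Sum>i\<in>I \<union> J. ?h i)"
    using I J by (simp add: alg_op_add_left sum.distrib sum.If_cases Int_absorb1)
  have 2: "\<forall>i\<in>I \<union> J. ?h i \<in> comp i" using I(2) J(2) comp_add comp_0 by simp
  show ?case
    by (rule exI[of _ "I \<union> J"], rule conjI, simp add: I J, rule exI[of _ ?h], rule conjI, rule 2, rule 1)
next
  case (single w r)
  have "alg_op (Poly_Mapping.single w r) \<Omega> \<in> comp (word_degree w + 0)"
    by (rule alg_op_comp[OF vac_comp]) (simp add: homog_def)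
  then show ?case by (intro exI[of _ "{word_degree w}"]) auto
qed

lemma form_hom_RD: "form_hom (cl a) \<in> carrier RD"
proof -
  have "finite {i. \<exists>b\<in>homog i. form a b \<noteq> 0}"
  proof -
    obtain I f where I: "finite I" "\<forall>i\<in>I. f i \<in> comp i" "alg_op a \<Omega> = (\<Sum>i\<in>I. f i)"
      using alg_op_vac_decompose[of a] by (elim exE conjE) (rule that)
    have "form a b = 0" if "b \<in> homog j" "j \<notin> I" for b j
    proof -
      have "\<epsilon> (alg_op (opp_free G b) (\<Sum>i\<in>A. f i)) = 0" if "A \<subseteq> I" for A
        using that
      proof (induction A rule: infinite_finite_induct)
        case (insert i A)
        then have "\<epsilon> (alg_op (opp_free G b) (f i)) = 0"
          using form_homog[OF bspec[OF I(2), of i] \<open>b \<in> homog j\<close>] \<open>j \<notin> I\<close> by auto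
        then show ?case using insert by (simp add: alg_op_add eps_add)
      qed simp_all
      then show ?thesis by (simp add: form_def I(3))
    qed
    then have "{i. \<exists>b\<in>homog i. form a b \<noteq> 0} \<subseteq> I" by blast
    then show ?thesis using I(1) finite_subset by blast
  qed
  moreover have "form_hom (cl a) \<in> carrier M' \<rightarrow>\<^sub>E UNIV" by (simp add: form_hom_def)
  ultimately show ?thesis
    unfolding RD_carrier
    by (simp add: form_hom_verma_class)
       (simp add: form_def opp_free_add opp_free_mult alg_op_simps eps_add alg_op_scal eps_scal)
qed

lemma form_hom_is_contravariant: "is_contravariant_hom G \<rho> t c triv form_hom"
proof -
  have ext: "f = g" if "f \<in> carrier M' \<rightarrow>\<^sub>E (UNIV :: 'k set)" "g \<in> carrier M' \<rightarrow>\<^sub>E UNIV"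
     "\<And>b. f (cl' b) = g (cl' b)" for f g
    using that by (intro extensionalityI[of f "carrier M'" g]) (auto simp: verma_carrier PiE_def)
  have "form_hom \<in> module_hom (rca G \<rho> t c) M RD"
    unfolding module_hom_def mem_Collect_eq
  proof (intro conjI allI impI)
    show "form_hom \<in> carrier M \<rightarrow> carrier RD" using form_hom_RD by (auto simp: verma_carrier)
  next
    fix m1 m2 assume "m1 \<in> carrier M \<and> m2 \<in> carrier M"
    then obtain a1 a2 where "m1 = cl a1" "m2 = cl a2" by (auto simp: verma_carrier)
    then show "form_hom (m1 \<oplus>\<^bsub>M\<^esub> m2) = form_hom m1 \<oplus>\<^bsub>RD\<^esub> form_hom m2"
      by (intro ext form_hom_ext)
         (simp_all add: verma_add RD_add verma_carrier form_hom_verma_class form_def alg_op_simps alg_op_add eps_add)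
  next
    fix r m assume "r \<in> carrier (rca G \<rho> t c) \<and> m \<in> carrier M"
    then obtain h a where "r = rca_class G \<rho> t c h" "m = cl a" by (auto simp: verma_carrier rca_carrier)
    then show "form_hom (r \<odot>\<^bsub>M\<^esub> m) = r \<odot>\<^bsub>RD\<^esub> form_hom m"
      by (intro ext form_hom_ext)
         (simp_all add: verma_smult RD_smult verma_carrier form_hom_verma_class form_def opp_free_mult
            opp_free_opp_free[OF group_G] alg_op_mult)
  qed
  moreover have "form_hom (verma_low G \<rho> t c triv v) (verma_low G \<rho>' t c' (dual_rep G triv) \<xi>) = pairing v \<xi>" for v \<xi>
    by (simp add: dual_triv verma_low_triv form_hom_verma_class form_def alg_op_scalar eps_scal eps_vac pairing_def sum_1)
  moreover have "form_hom (verma_low G \<rho> t c triv v) m = 0"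
    if i: "i \<noteq> 0" and m: "m \<in> dual_verma_piece G \<rho> t c triv i" for v i m
  proof -
    obtain b where b: "m = cl' b" "b \<in> homog i" using m by (auto simp: dual_verma_piece_eq)
    show ?thesis
      using form_homog[OF comp_scal[OF vac_comp] b(2)] i
      by (simp add: b(1) verma_low_triv form_hom_verma_class form_def alg_op_scalar)
  qed
  ultimately show ?thesis unfolding is_contravariant_hom_def by blast
qed

text \<open>
  A word of degree 0 equals a scalar in the Verma module, and both functionals vanish on the words of
  other degrees.
\<close>

lemma RD_functional_unique:
  assumes f: "f \<in> carrier RD" and g: "g \<in> carrier RD"
    and low: "f (cl' 1) = g (cl' 1)"
    and deg: "\<And>i b. i \<noteq> 0 \<Longrightarrow> b \<in> homog i \<Longrightarrow> f (cl' b) = 0 \<and> g (cl' b) = 0"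
  shows "f (cl' b) = g (cl' b)"
proof -
  have smult: "h (cl' (scalar r * a)) = r * h (cl' a)"
    and add: "h (cl' (a + b)) = h (cl' a) + h (cl' b)"
    if "h \<in> carrier RD" for h r a b
    using that by (simp_all add: RD_carrier)
  show ?thesis
  proof (induction b rule: poly_mapping_single_induct)
    case zero
    then show ?case using smult[OF f, of 0 0] smult[OF g, of 0 0] by simp
  next
    case (add a b)
    then show ?case using f g by (simp add: RD_carrier)
  next
    case (single w r)
    show ?case
    proof (cases "word_degree w = 0")
      case False
      then show ?thesis using deg[OF False, of "Poly_Mapping.single w r"] by (simp add: homog_def)
    next
      case True
      then obtain s where "Poly_Mapping.single w 1 - scalar s \<in> verma_ideal G \<rho>' t c'"
        using degree_0_scalar by blast
      then have "scalar r * (Poly_Mapping.single w 1 - scalar s) \<in> verma_ideal G \<rho>' t c'" by (rule verma_ideal_mult)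
      moreover have "scalar r * (Poly_Mapping.single w 1 - scalar s) = Poly_Mapping.single w r - scalar (r * s) * 1"
        by (simp add: right_diff_distrib scalar_mult_single scalar_mult)
      ultimately have "cl' (Poly_Mapping.single w r) = cl' (scalar (r * s) * 1)"
        by (simp only: verma_class_eq)
      then show ?thesis by (simp only: smult[OF f] smult[OF g] low)
    qed
  qed
qed

text \<open>
  A homomorphism \<open>h\<close> to the restricted dual is determined by the functional \<open>h (1 \<otimes> 1)\<close>, and
  \<open>RD_functional_unique\<close> determines that functional, so the chosen form is \<open>form\<close>.
\<close>

lemma contravariant_hom_eq: 
  "contravariant_hom G \<rho> t c triv (cl a) (cl' b) = form a b"
proof -
  define \<phi> where "\<phi> = contravariant_hom G \<rho> t c triv"
  have \<phi>: "is_contravariant_hom G \<rho> t c triv \<phi>"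
    unfolding \<phi>_def contravariant_hom_def by (rule someI[where P = "is_contravariant_hom G \<rho> t c triv", OF form_hom_is_contravariant])
  have *: "h (cl a) (cl' b) = h (cl 1) (cl' (opp_free G a * b))"
    "h (cl 1) \<in> carrier RD" "h (cl 1) (cl' 1) = 1"
    "\<And>i b. i \<noteq> 0 \<Longrightarrow> b \<in> homog i \<Longrightarrow> h (cl 1) (cl' b) = 0"
    if h: "is_contravariant_hom G \<rho> t c triv h" for h
  proof -
    have hom: "h \<in> module_hom (rca G \<rho> t c) M RD" using h by (simp add: is_contravariant_hom_def)
    have "h (rca_class G \<rho> t c a \<odot>\<^bsub>M\<^esub> cl 1) = rca_class G \<rho> t c a \<odot>\<^bsub>RD\<^esub> h (cl 1)"
      by (rule module_hom_smult[OF hom]) (auto simp: rca_carrier verma_carrier)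
    then show "h (cl a) (cl' b) = h (cl 1) (cl' (opp_free G a * b))"
      by (simp add: verma_smult RD_smult verma_carrier)
    show "h (cl 1) \<in> carrier RD"
      using module_hom_closed[OF hom] by (auto simp: verma_carrier)
    have low: "cl 1 = verma_low G \<rho> t c triv (\<chi> i. 1)" "cl' 1 = verma_low G \<rho>' t c' triv (\<chi> i. 1)"
      by (simp_all add: verma_low_triv)
    show "h (cl 1) (cl' 1) = 1"
      using h unfolding low is_contravariant_hom_def dual_triv by (simp add: pairing_def sum_1)
    show "h (cl 1) (cl' b) = 0" if "i \<noteq> 0" "b \<in> homog i" for i b
      using h that unfolding low is_contravariant_hom_def dual_verma_piece_eq by blast
  qed
  note f = *[OF \<phi>] and g = *[OF form_hom_is_contravariant]
  have "\<phi> (cl a) (cl' b) = form_hom (cl a) (cl' b)"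
    unfolding f(1) g(1)
    by (rule RD_functional_unique[OF f(2) g(2)]) (use f(3,4) g(3,4) in auto)
  then show ?thesis by (simp add: \<phi>_def form_hom_verma_class)
qed

text \<open>
  The form is \<open>\<epsilon> (b\<^sup>o\<^sup>p (a \<Omega>))\<close>, where \<open>b\<^sup>o\<^sup>p\<close> may be any product of elements of \<open>h\<close>; by \<open>cogenerated\<close>
  it vanishes for all \<open>b\<close> only if \<open>a \<Omega> = 0\<close>.
\<close>

lemma ker_B_eq: "ker_B G \<rho> t c triv = cl ` {a. alg_op a \<Omega> = 0}"
proof -
  have \<phi>: "is_contravariant_hom G \<rho> t c triv (contravariant_hom G \<rho> t c triv)"
    unfolding contravariant_hom_def by (rule someI[where P = "is_contravariant_hom G \<rho> t c triv", OF form_hom_is_contravariant])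
  have "contravariant_hom G \<rho> t c triv (cl a) = \<zero>\<^bsub>RD\<^esub> \<longleftrightarrow> alg_op a \<Omega> = 0" for a
  proof -
    have "contravariant_hom G \<rho> t c triv \<in> module_hom (rca G \<rho> t c) M RD"
      using \<phi> by (simp add: is_contravariant_hom_def)
    from module_hom_closed[OF this]
    have RD: "contravariant_hom G \<rho> t c triv (cl a) \<in> carrier RD"
      by (auto simp: verma_carrier)
    have "contravariant_hom G \<rho> t c triv (cl a) = \<zero>\<^bsub>RD\<^esub> \<longleftrightarrow>
       (\<forall>b. contravariant_hom G \<rho> t c triv (cl a) (cl' b) = 0)"
    proof
      assume *: "\<forall>b. contravariant_hom G \<rho> t c triv (cl a) (cl' b) = 0"
      show "contravariant_hom G \<rho> t c triv (cl a) = \<zero>\<^bsub>RD\<^esub>"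
        by (rule extensionalityI[of _ "carrier M'"])
           (use * RD in \<open>auto simp: RD_zero RD_carrier verma_carrier PiE_def\<close>)
    qed (simp add: RD_zero verma_carrier)
    also have "\<dots> \<longleftrightarrow> (\<forall>b. \<epsilon> (alg_op (opp_free G b) (alg_op a \<Omega>)) = 0)"
      by (simp add: contravariant_hom_eq form_def)
    also have "\<dots> \<longleftrightarrow> alg_op a \<Omega> = 0"
    proof
      assume *: "\<forall>b. \<epsilon> (alg_op (opp_free G b) (alg_op a \<Omega>)) = 0"
      show "alg_op a \<Omega> = 0"
      proof (rule cogenerated)
        fix ys
        have "foldr Yop ys v = alg_op (prod_list (map yvec ys)) v" for v
          by (induction ys) (simp_all add: alg_op_simps)
        then show "\<epsilon> (foldr Yop ys (alg_op a \<Omega>)) = 0"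
          using *[rule_format, of "opp_free G (prod_list (map yvec ys))"]
          by (simp add: opp_free_opp_free[OF group_G])
      qed
    qed simp
    finally show ?thesis .
  qed
  then show ?thesis by (auto simp: ker_B_def verma_carrier)
qed

lemma irr_presented: "presented_quotient M (cl) {a. alg_op a \<Omega> = 0} (ker_B G \<rho> t c triv)"
  by unfold_locales
     (auto simp: verma_simps ker_B_eq alg_op_simps dest: alg_op_verma_ideal)

text \<open>
  The isomorphism from \<open>L\<close> to the representation sends the class of \<open>a\<close> to \<open>a \<Omega>\<close>; it is well defined and
  injective by \<open>ker_B_eq\<close>.
\<close>

theorem irr_piece_model:
  obtains F where "bij_betw F (carrier (piece i)) (comp i)"
    and "\<And>a b. a \<in> carrier (piece i) \<Longrightarrow> b \<in> carrier (piece i) \<Longrightarrow>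
      a \<oplus>\<^bsub>piece i\<^esub> b \<in> carrier (piece i) \<and>
      F (a \<oplus>\<^bsub>piece i\<^esub> b) = F a + F b"
    and "\<zero>\<^bsub>piece i\<^esub> \<in> carrier (piece i) \<and>
      F \<zero>\<^bsub>piece i\<^esub> = 0"
    and "\<And>r a. a \<in> carrier (piece i) \<Longrightarrow>
      r \<odot>\<^bsub>piece i\<^esub> a \<in> carrier (piece i) \<and>
      F (r \<odot>\<^bsub>piece i\<^esub> a) = scal r (F a)"
    and "\<And>g a. g \<in> carrier G \<Longrightarrow> a \<in> carrier (piece i) \<Longrightarrow>
      act (piece i) g a \<in> carrier (piece i) \<and>
      F (act (piece i) g a) = Gop g (F a)"
proof -
  interpret L: presented_quotient M "cl" "{a. alg_op a \<Omega> = 0}" "ker_B G \<rho> t c triv"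
    by (rule irr_presented)
  define F where "F m = alg_op (SOME a. m = L.qcl a) \<Omega>" for m
  let ?P = "piece i"
  have car: "carrier ?P = L.qcl ` homog i"
    by (simp add: irr_piece_def Let_def verma_piece_triv image_image L.qcl_def)
  have F: "F (L.qcl a) = alg_op a \<Omega>" for a
  proof -
    have "L.qcl a = L.qcl (SOME a'. L.qcl a = L.qcl a')" by (rule someI) simp
    then show ?thesis by (simp add: F_def L.qcl_eq alg_op_diff_left)
  qed
  have add: "L.qcl a \<oplus>\<^bsub>?P\<^esub> L.qcl b = L.qcl (a + b)" for a b
    using L.add_quot by (simp add: irr_piece_def irr_mod_def Let_def)
  have smult: "rca_class G \<rho> t c h \<odot>\<^bsub>irr_mod G \<rho> t c triv\<^esub> L.qcl a = L.qcl (h * a)" for h a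
    unfolding irr_mod_def
    by (rule L.smult_quot) (simp_all add: verma_smult right_diff_distrib alg_op_mult)
  show ?thesis
  proof (rule that[of F])
    show "bij_betw F (carrier ?P) (comp i)"
      unfolding bij_betw_def
    proof
      show "inj_on F (carrier ?P)"
        unfolding car by (rule inj_onI, elim imageE) (simp add: F L.qcl_eq alg_op_diff_left)
      show "F ` carrier ?P = comp i"
        using alg_op_comp[OF vac_comp] generated by (fastforce simp: car F image_image)
    qed
    show "a \<oplus>\<^bsub>?P\<^esub> b \<in> carrier ?P \<and> F (a \<oplus>\<^bsub>?P\<^esub> b) = F a + F b" if ab: "a \<in> carrier ?P" "b \<in> carrier ?P" for a b
    proof -
      obtain a' b' where "a = L.qcl a'" "b = L.qcl b'" "a' \<in> homog i" "b' \<in> homog i"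
        using ab by (auto simp: car)
      moreover from this have "a' + b' \<in> homog i" using keys_add[of a' b'] by (fastforce simp: homog_def)
      ultimately show ?thesis by (simp add: add F car alg_op_add_left)
    qed
    have "\<zero>\<^bsub>?P\<^esub> = L.qcl 0"
      using L.zero_quot by (simp add: irr_piece_def irr_mod_def Let_def)
    moreover have "0 \<in> homog i" by (simp add: homog_def)
    ultimately show "\<zero>\<^bsub>?P\<^esub> \<in> carrier ?P \<and> F \<zero>\<^bsub>?P\<^esub> = 0" by (auto simp: car F)
    show "r \<odot>\<^bsub>?P\<^esub> a \<in> carrier ?P \<and> F (r \<odot>\<^bsub>?P\<^esub> a) = scal r (F a)" if ra: "a \<in> carrier ?P" for r a
    proof -
      obtain a' where a': "a = L.qcl a'" "a' \<in> homog i" using ra by (auto simp: car)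
      moreover have "r \<odot>\<^bsub>?P\<^esub> a = L.qcl (scalar r * a')" by (simp add: irr_piece_def Let_def a' smult)
      moreover have "scalar r * a' \<in> homog i" using homog_mult[OF homog_scalar a'(2)] by simp
      ultimately show ?thesis by (simp add: F car alg_op_simps)
    qed
    show "act ?P g a \<in> carrier ?P \<and> F (act ?P g a) = Gop g (F a)" if g: "g \<in> carrier G" and ra: "a \<in> carrier ?P" for g a
    proof -
      obtain a' where a': "a = L.qcl a'" "a' \<in> homog i" using ra by (auto simp: car)
      moreover have "act ?P g a = L.qcl (grp g * a')" by (simp add: irr_piece_def Let_def a' smult)
      moreover have "grp g * a' \<in> homog i" using homog_mult[OF homog_grp a'(2)] by simp
      ultimately show ?thesis using g by (simp add: F car alg_op_simps)
    qed
  qed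
qed

end

section \<open>Representations and the Grothendieck group\<close>

lemma base_field_field: "field (base_field :: 'k::field ring)"
  by (rule field_from_type_algebra)

text \<open>
  A bijection onto \<open>W\<close> under which the operations of \<open>P\<close> correspond to those of \<open>W\<close>.  In contrast to
  \<^const>\<open>grep_iso\<close>, nothing is presupposed about \<open>P\<close>, so all axioms for \<open>P\<close> can be pulled back from \<open>W\<close>.
\<close>

definition grep_transport ::
  "('g, 'm) monoid_scheme \<Rightarrow> ('p \<Rightarrow> 'w) \<Rightarrow> ('k::field, 'p, 'g) grep \<Rightarrow> ('k, 'w, 'g) grep \<Rightarrow> bool" where
  "grep_transport G f P W \<longleftrightarrow> bij_betw f (carrier P) (carrier W)
   \<and> (\<forall>a\<in>carrier P. \<forall>b\<in>carrier P. a \<oplus>\<^bsub>P\<^esub> b \<in> carrier P \<and> f (a \<oplus>\<^bsub>P\<^esub> b) = f a \<oplus>\<^bsub>W\<^esub> f b)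
   \<and> \<zero>\<^bsub>P\<^esub> \<in> carrier P \<and> f \<zero>\<^bsub>P\<^esub> = \<zero>\<^bsub>W\<^esub>
   \<and> (\<forall>r. \<forall>a\<in>carrier P. r \<odot>\<^bsub>P\<^esub> a \<in> carrier P \<and> f (r \<odot>\<^bsub>P\<^esub> a) = r \<odot>\<^bsub>W\<^esub> f a)
   \<and> (\<forall>g\<in>carrier G. \<forall>a\<in>carrier P. act P g a \<in> carrier P \<and> f (act P g a) = act W g (f a))"

lemma is_grepD:
  assumes "is_grep G V"
  shows "vectorspace base_field V"
    "\<And>u v. u \<in> carrier V \<Longrightarrow> v \<in> carrier V \<Longrightarrow> u \<oplus>\<^bsub>V\<^esub> v \<in> carrier V"
    "\<zero>\<^bsub>V\<^esub> \<in> carrier V"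
    "\<And>r v. v \<in> carrier V \<Longrightarrow> r \<odot>\<^bsub>V\<^esub> v \<in> carrier V"
    "\<And>g v. g \<in> carrier G \<Longrightarrow> v \<in> carrier V \<Longrightarrow> act V g v \<in> carrier V"
    "\<And>g u v. g \<in> carrier G \<Longrightarrow> u \<in> carrier V \<Longrightarrow> v \<in> carrier V \<Longrightarrow> act V g (u \<oplus>\<^bsub>V\<^esub> v) = act V g u \<oplus>\<^bsub>V\<^esub> act V g v"
    "\<And>g r v. g \<in> carrier G \<Longrightarrow> v \<in> carrier V \<Longrightarrow> act V g (r \<odot>\<^bsub>V\<^esub> v) = r \<odot>\<^bsub>V\<^esub> act V g v"
    "\<And>v. v \<in> carrier V \<Longrightarrow> act V \<one>\<^bsub>G\<^esub> v = v"
    "\<And>g h v. g \<in> carrier G \<Longrightarrow> h \<in> carrier G \<Longrightarrow> v \<in> carrier V \<Longrightarrow> act V (g \<otimes>\<^bsub>G\<^esub> h) v = act V g (act V h v)"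
proof -
  show V: "vectorspace base_field V" using assms by (simp add: is_grep_def)
  interpret vectorspace base_field V by (rule V)
  show "\<And>u v. u \<in> carrier V \<Longrightarrow> v \<in> carrier V \<Longrightarrow> u \<oplus>\<^bsub>V\<^esub> v \<in> carrier V" by simp
  show "\<zero>\<^bsub>V\<^esub> \<in> carrier V" by simp
  show "\<And>r v. v \<in> carrier V \<Longrightarrow> r \<odot>\<^bsub>V\<^esub> v \<in> carrier V" by simp
qed (use assms in \<open>auto simp: is_grep_def module_hom_def Pi_def\<close>)

lemma grep_transport_fd_grep:
  assumes G: "group G" and W: "is_fd_grep G W" and f: "grep_transport G f P W"
  shows "is_fd_grep G P" and "f \<in> grep_hom G P W" and "grep_iso G P W"
    and "vectorspace.dim base_field P = vectorspace.dim base_field W"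
proof -
  have Wg: "is_grep G W" and Wfin: "vectorspace.fin_dim base_field W"
    using W by (simp_all add: is_fd_grep_def)
  interpret W: vectorspace base_field W by (rule is_grepD(1)[OF Wg])
  note wd = is_grepD(2-)[OF Wg]
  have bij: "bij_betw f (carrier P) (carrier W)"
    and add: "a \<in> carrier P \<Longrightarrow> b \<in> carrier P \<Longrightarrow> a \<oplus>\<^bsub>P\<^esub> b \<in> carrier P"
      "a \<in> carrier P \<Longrightarrow> b \<in> carrier P \<Longrightarrow> f (a \<oplus>\<^bsub>P\<^esub> b) = f a \<oplus>\<^bsub>W\<^esub> f b"
    and zero: "\<zero>\<^bsub>P\<^esub> \<in> carrier P" "f \<zero>\<^bsub>P\<^esub> = \<zero>\<^bsub>W\<^esub>"
    and smult: "a \<in> carrier P \<Longrightarrow> r \<odot>\<^bsub>P\<^esub> a \<in> carrier P"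
      "a \<in> carrier P \<Longrightarrow> f (r \<odot>\<^bsub>P\<^esub> a) = r \<odot>\<^bsub>W\<^esub> f a"
    and act: "g \<in> carrier G \<Longrightarrow> a \<in> carrier P \<Longrightarrow> act P g a \<in> carrier P"
      "g \<in> carrier G \<Longrightarrow> a \<in> carrier P \<Longrightarrow> f (act P g a) = act W g (f a)" for a b r g
    using f by (auto simp: grep_transport_def)
  have fW: "a \<in> carrier P \<Longrightarrow> f a \<in> carrier W" for a using bij by (auto simp: bij_betw_def)
  have eq: "a = b" if "a \<in> carrier P" "b \<in> carrier P" "f a = f b" for a b
    using bij that by (auto simp: bij_betw_def inj_on_def)
  have P: "vectorspace base_field P"
  proof (rule vs_criteria[OF base_field_field])
    show "\<forall>v\<in>carrier P. \<exists>neg_v\<in>carrier P. v \<oplus>\<^bsub>P\<^esub> neg_v = \<zero>\<^bsub>P\<^esub>"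
    proof
      fix v assume v: "v \<in> carrier P"
      have "\<ominus>\<^bsub>W\<^esub> f v \<in> f ` carrier P" using bij fW[OF v] by (simp add: bij_betw_def)
      then obtain u where "u \<in> carrier P" "f u = \<ominus>\<^bsub>W\<^esub> f v" by auto
      then show "\<exists>neg_v\<in>carrier P. v \<oplus>\<^bsub>P\<^esub> neg_v = \<zero>\<^bsub>P\<^esub>"
        using v fW[OF v] by (intro bexI[of _ u] eq) (auto simp: add zero W.module.M.r_neg)
    qed
    show "\<forall>v w. v \<in> carrier P \<and> w \<in> carrier P \<longrightarrow> v \<oplus>\<^bsub>P\<^esub> w = w \<oplus>\<^bsub>P\<^esub> v"
      by (auto intro!: eq simp: add fW W.module.M.a_comm)
    show "\<forall>v w x. v \<in> carrier P \<and> w \<in> carrier P \<and> x \<in> carrier P \<longrightarrow> v \<oplus>\<^bsub>P\<^esub> w \<oplus>\<^bsub>P\<^esub> x = v \<oplus>\<^bsub>P\<^esub> (w \<oplus>\<^bsub>P\<^esub> x)"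
      by (auto intro!: eq simp: add fW W.module.M.a_assoc)
    show "\<forall>v\<in>carrier P. v \<oplus>\<^bsub>P\<^esub> \<zero>\<^bsub>P\<^esub> = v"
      by (auto intro!: eq simp: add fW zero)
    show "\<forall>a b v. a \<in> carrier base_field \<and> b \<in> carrier base_field \<and> v \<in> carrier P \<longrightarrow>
       (a \<otimes>\<^bsub>base_field\<^esub> b) \<odot>\<^bsub>P\<^esub> v = a \<odot>\<^bsub>P\<^esub> (b \<odot>\<^bsub>P\<^esub> v)"
      using W.smult_assoc1 by (auto intro!: eq simp: smult fW)
    show "\<forall>v\<in>carrier P. \<one>\<^bsub>base_field\<^esub> \<odot>\<^bsub>P\<^esub> v = v"
      using W.smult_one by (auto intro!: eq simp: smult fW)
    show "\<forall>a b v. a \<in> carrier base_field \<and> b \<in> carrier base_field \<and> v \<in> carrier P \<longrightarrow>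
       (a \<oplus>\<^bsub>base_field\<^esub> b) \<odot>\<^bsub>P\<^esub> v = a \<odot>\<^bsub>P\<^esub> v \<oplus>\<^bsub>P\<^esub> b \<odot>\<^bsub>P\<^esub> v"
      using W.smult_l_distr by (auto intro!: eq simp: smult fW add)
    show "\<forall>a v w. a \<in> carrier base_field \<and> v \<in> carrier P \<and> w \<in> carrier P \<longrightarrow>
       a \<odot>\<^bsub>P\<^esub> (v \<oplus>\<^bsub>P\<^esub> w) = a \<odot>\<^bsub>P\<^esub> v \<oplus>\<^bsub>P\<^esub> a \<odot>\<^bsub>P\<^esub> w"
      using W.smult_r_distr by (auto intro!: eq simp: smult fW add)
  qed (auto simp: add zero smult)
  have hom: "f \<in> module_hom base_field P W"
    by (auto simp: module_hom_def add smult fW)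
  define h where "h = the_inv_into (carrier P) f"
  have h: "w \<in> carrier W \<Longrightarrow> h w \<in> carrier P" "w \<in> carrier W \<Longrightarrow> f (h w) = w" for w
    using bij by (auto simp: h_def bij_betw_def the_inv_into_into f_the_inv_into_f)
  have hbij: "bij_betw h (carrier W) (carrier P)"
    unfolding h_def by (rule bij_betw_the_inv_into[OF bij])
  have hhom: "h \<in> module_hom base_field W P"
    by (auto simp: module_hom_def h add smult wd intro!: eq)
  interpret h: linear_map base_field W P h
    by (intro linear_map.intro mod_hom.intro mod_hom_axioms.intro P hhom W.vectorspace_axioms
        vectorspace.axioms(1))
  have fin: "vectorspace.fin_dim base_field P"
    using h.surj_fin_dim[OF Wfin] hbij by (auto simp: bij_betw_def)
  have "act P g \<in> module_hom base_field P P" if "g \<in> carrier G" for g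
    using that by (auto simp: module_hom_def act add smult fW wd intro!: eq)
  then have "is_grep G P"
    unfolding is_grep_def
    by (auto simp: P act fW wd group.is_monoid[OF G] monoid.one_closed monoid.m_closed intro!: eq)
  then show "is_fd_grep G P" using fin by (simp add: is_fd_grep_def)
  show "f \<in> grep_hom G P W" using hom by (simp add: grep_hom_def act)
  then show "grep_iso G P W" using bij by (auto simp: grep_iso_def)
  show "vectorspace.dim base_field P = vectorspace.dim base_field W"
    using h.dim_eq[OF Wfin] hbij by (simp add: bij_betw_def)
qed

lemma grep_hom_comp: "f \<in> grep_hom G U V \<Longrightarrow> h \<in> grep_hom G V W \<Longrightarrow> h \<circ> f \<in> grep_hom G U W"
  by (auto simp: grep_hom_def module_hom_def Pi_def)

lemma grep_iso_trans: "grep_iso G U V \<Longrightarrow> grep_iso G V W \<Longrightarrow> grep_iso G U W"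
  unfolding grep_iso_def by (meson bij_betw_trans grep_hom_comp)

lemma grep_hom_inverse:
  assumes "is_grep G V" "is_grep G W" "f \<in> grep_hom G V W" "bij_betw f (carrier V) (carrier W)"
  shows "the_inv_into (carrier V) f \<in> grep_hom G W V"
proof -
  let ?h = "the_inv_into (carrier V) f"
  have h: "w \<in> carrier W \<Longrightarrow> ?h w \<in> carrier V" "w \<in> carrier W \<Longrightarrow> f (?h w) = w" for w
    using assms(4) by (auto simp: bij_betw_def the_inv_into_into f_the_inv_into_f)
  have eq: "a = b" if "a \<in> carrier V" "b \<in> carrier V" "f a = f b" for a b
    using assms(4) that by (auto simp: bij_betw_def inj_on_def)
  show ?thesis
    using assms(3) unfolding grep_hom_def module_hom_def
    by (auto intro!: eq simp: h is_grepD(2-)[OF assms(1)] is_grepD(2-)[OF assms(2)])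
qed

lemma grep_iso_sym: "is_grep G V \<Longrightarrow> is_grep G W \<Longrightarrow> grep_iso G V W \<Longrightarrow> grep_iso G W V"
  unfolding grep_iso_def using grep_hom_inverse bij_betw_the_inv_into by blast

text \<open>
  Isomorphic representations have the same isomorphic copies on \<open>nat \<Rightarrow> 'k\<close>, so that the same one is chosen
  for both.
\<close>

lemma K0_class_cong:
  fixes V :: "('k::field, 'v, 'g) grep" and W :: "('k, 'w, 'g) grep"
  assumes "is_grep G V" "is_grep G W" "grep_iso G V W"
  shows "K0_class G V = K0_class G W"
proof -
  have "grep_iso G V' V \<longleftrightarrow> grep_iso G V' W" for V' :: "('k, 'g) std_grep"
    using grep_iso_trans[OF _ assms(3), of V'] grep_iso_trans[OF _ grep_iso_sym[OF assms], of V'] by blast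
  then show ?thesis by (simp add: K0_class_def)
qed

text \<open>
  The structure of \<open>V\<close> can be carried along any injection of sets; coordinates with respect to a finite
  generating set provide one into \<open>nat \<Rightarrow> 'k\<close>.
\<close>

lemma std_copy:
  fixes V :: "('k::field, 'v, 'g) grep"
  assumes G: "group G" and V: "is_fd_grep G V"
  shows "\<exists>V'. V' \<in> fd_greps G \<and> grep_iso G V' V"
proof -
  have Vg: "is_grep G V" and fin: "vectorspace.fin_dim base_field V"
    using V by (simp_all add: is_fd_grep_def)
  interpret V: vectorspace base_field V by (rule is_grepD(1)[OF Vg])
  note vd = is_grepD(2-)[OF Vg]
  obtain A where A: "finite A" "A \<subseteq> carrier V" "V.span A = carrier V"
    using fin by (auto simp: V.fin_dim_def)
  have "\<exists>a. v = V.lincomb a A" if "v \<in> carrier V" for v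
    using that A(3) V.finite_span[OF A(1,2)] by auto
  then obtain a where a: "v = V.lincomb (a v) A" if "v \<in> carrier V" for v by metis
  obtain e :: "_ \<Rightarrow> nat" where e: "inj_on e A"
    using finite_imp_inj_to_nat_seg[OF A(1)] by blast
  define j where "j v = (\<lambda>n. if n \<in> e ` A then a v (the_inv_into A e n) else 0)" for v
  have inj: "inj_on j (carrier V)"
  proof (rule inj_onI)
    fix u v assume uv: "u \<in> carrier V" "v \<in> carrier V" "j u = j v"
    have "a u x = a v x" if "x \<in> A" for x
      using fun_cong[OF uv(3), of "e x"] that e by (simp add: j_def the_inv_into_f_f)
    then have "V.lincomb (a u) A = V.lincomb (a v) A"
      by (intro V.lincomb_cong) (use A in auto)
    then show "u = v" using a uv by metis
  qed
  define i where "i = the_inv_into (carrier V) j"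
  have i: "v \<in> carrier V \<Longrightarrow> i (j v) = v" for v
    using inj by (simp add: i_def the_inv_into_f_f)
  define V' :: "('k, 'g) std_grep" where
    "V' = \<lparr>carrier = j ` carrier V, mult = \<lambda>_ _. j \<zero>\<^bsub>V\<^esub>, one = j \<zero>\<^bsub>V\<^esub>, zero = j \<zero>\<^bsub>V\<^esub>,
      add = (\<lambda>x y. j (i x \<oplus>\<^bsub>V\<^esub> i y)), module.smult = (\<lambda>r x. j (r \<odot>\<^bsub>V\<^esub> i x)),
      act = (\<lambda>g x. j (act V g (i x)))\<rparr>"
  have "bij_betw i (j ` carrier V) (carrier V)"
    unfolding i_def using inj by (intro bij_betw_the_inv_into) (simp add: bij_betw_def)
  then have "grep_transport G i V' V"
    by (auto simp: grep_transport_def V'_def i vd)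
  from grep_transport_fd_grep(1,3)[OF G V this] show ?thesis by (auto simp: fd_greps_def)
qed

lemma normal_K0_rels:
  "(K0_rels G :: (('k::field, 'g) std_grep \<Rightarrow>\<^sub>0 int) set) \<lhd> free_Abelian_group (fd_greps G)"
proof -
  interpret F: comm_group "free_Abelian_group (fd_greps G :: ('k, 'g) std_grep set)"
    by (rule abelian_free_Abelian_group)
  have "Poly_Mapping.keys (frag_of V - frag_of U - frag_of W) \<subseteq> fd_greps G"
    if "U \<in> fd_greps G" "V \<in> fd_greps G" "W \<in> fd_greps G" for U V W :: "('k, 'g) std_grep"
    using that keys_diff[of "frag_of V - frag_of U" "frag_of W"] keys_diff[of "frag_of V" "frag_of U"]
    by (auto simp: keys_frag_of)
  then have "subgroup (K0_rels G :: (('k, 'g) std_grep \<Rightarrow>\<^sub>0 int) set) (free_Abelian_group (fd_greps G))"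
    unfolding K0_rels_def by (intro F.generate_is_subgroup) auto
  then show ?thesis by (rule F.subgroup_imp_normal)
qed

lemma comm_group_K0: "comm_group (K0 G)"
  unfolding K0_def
  by (rule comm_group.abelian_FactGroup[OF abelian_free_Abelian_group])
     (rule normal_imp_subgroup[OF normal_K0_rels])

definition std_of :: "('g, 'm) monoid_scheme \<Rightarrow> ('k::field, 'v, 'g) grep \<Rightarrow> ('k, 'g) std_grep" where
  "std_of G V = (SOME V'. V' \<in> fd_greps G \<and> grep_iso G V' V)"

lemma std_of: "group G \<Longrightarrow> is_fd_grep G V \<Longrightarrow> std_of G V \<in> fd_greps G \<and> grep_iso G (std_of G V) V"
  unfolding std_of_def by (rule someI_ex) (rule std_copy)

lemma K0_class_std: "K0_class G V = K0_rels G #>\<^bsub>free_Abelian_group (fd_greps G)\<^esub> frag_of (std_of G V)"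
  by (simp add: K0_class_def std_of_def)

lemma K0_class_closed: "group G \<Longrightarrow> is_fd_grep G V \<Longrightarrow> K0_class G V \<in> carrier (K0 G)"
  using std_of[of G V] by (auto simp: K0_class_std K0_def FactGroup_def RCOSETS_def keys_frag_of
      intro!: bexI[of _ "frag_of (std_of G V)"])

text \<open>
  The sequence is transported to the chosen copies, where it is one of the defining relations.
\<close>

lemma K0_class_exact:
  fixes U :: "('k::field, 'u, 'g) grep" and V :: "('k, 'v, 'g) grep" and W :: "('k, 'w, 'g) grep"
  assumes G: "group G" and fd: "is_fd_grep G U" "is_fd_grep G V" "is_fd_grep G W" and ex: "short_exact G U V W"
  shows "K0_class G V = K0_class G U \<otimes>\<^bsub>K0 G\<^esub> K0_class G W"
proof -
  let ?F = "free_Abelian_group (fd_greps G) :: (('k, 'g) std_grep \<Rightarrow>\<^sub>0 int) monoid"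
  interpret F: comm_group ?F by (rule abelian_free_Abelian_group)
  interpret N: normal "K0_rels G" ?F by (rule normal_K0_rels)
  note std = std_of[OF G fd(1)] std_of[OF G fd(2)] std_of[OF G fd(3)]
  have g: "is_grep G U" "is_grep G V" "is_grep G W" "is_grep G (std_of G U)"
     "is_grep G (std_of G V)" "is_grep G (std_of G W)"
    using fd std by (auto simp: is_fd_grep_def fd_greps_def)
  obtain f h where f: "f \<in> grep_hom G U V" "inj_on f (carrier U)"
    and fh: "f ` carrier U = {v \<in> carrier V. h v = \<zero>\<^bsub>W\<^esub>}"
    and h: "h \<in> grep_hom G V W" "h ` carrier V = carrier W"
    using ex by (auto simp: short_exact_def)
  obtain i where i: "i \<in> grep_hom G (std_of G U) U" "bij_betw i (carrier (std_of G U)) (carrier U)"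
    using std by (auto simp: grep_iso_def)
  obtain j where j: "j \<in> grep_hom G (std_of G V) V" "bij_betw j (carrier (std_of G V)) (carrier V)"
    using std by (auto simp: grep_iso_def)
  obtain k where k: "k \<in> grep_hom G (std_of G W) W" "bij_betw k (carrier (std_of G W)) (carrier W)"
    using std by (auto simp: grep_iso_def)
  define j' where "j' = the_inv_into (carrier (std_of G V)) j"
  define k' where "k' = the_inv_into (carrier (std_of G W)) k"
  have j': "j' \<in> grep_hom G V (std_of G V)" "bij_betw j' (carrier V) (carrier (std_of G V))"
    unfolding j'_def using grep_hom_inverse[OF g(5,2) j] bij_betw_the_inv_into[OF j(2)] by auto
  have k': "k' \<in> grep_hom G W (std_of G W)" "bij_betw k' (carrier W) (carrier (std_of G W))"
    unfolding k'_def using grep_hom_inverse[OF g(6,3) k] bij_betw_the_inv_into[OF k(2)] by auto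
  have j'j: "v \<in> carrier (std_of G V) \<Longrightarrow> j' (j v) = v" for v
    using j(2) by (simp add: j'_def bij_betw_def the_inv_into_f_f)
  have k'0: "w \<in> carrier W \<Longrightarrow> k' w = \<zero>\<^bsub>std_of G W\<^esub> \<longleftrightarrow> w = \<zero>\<^bsub>W\<^esub>" for w
  proof -
    assume w: "w \<in> carrier W"
    interpret W: vectorspace base_field W by (rule is_grepD(1)[OF g(3)])
    interpret W': vectorspace base_field "std_of G W" by (rule is_grepD(1)[OF g(6)])
    interpret lm: linear_map base_field W "std_of G W" k'
      using k'(1) by (intro linear_map.intro mod_hom.intro mod_hom_axioms.intro W.vectorspace_axioms
        W'.vectorspace_axioms vectorspace.axioms(1)) (simp add: grep_hom_def)
    show ?thesis using k'(2) w lm.f0_is_0 is_grepD(3)[OF g(3)]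
      unfolding bij_betw_def inj_on_def by metis
  qed
  have "short_exact G (std_of G U) (std_of G V) (std_of G W)"
    unfolding short_exact_def
  proof (intro bexI conjI)
    show "j' \<circ> (f \<circ> i) \<in> grep_hom G (std_of G U) (std_of G V)"
      by (intro grep_hom_comp[OF grep_hom_comp[OF i(1) f(1)] j'(1)])
    show "k' \<circ> (h \<circ> j) \<in> grep_hom G (std_of G V) (std_of G W)"
      by (intro grep_hom_comp[OF grep_hom_comp[OF j(1) h(1)] k'(1)])
    have fc: "f ` carrier U \<subseteq> carrier V" using fh by auto
    show "inj_on (j' \<circ> (f \<circ> i)) (carrier (std_of G U))"
    proof (rule comp_inj_on)
      show "inj_on (f \<circ> i) (carrier (std_of G U))"
        using i(2) f(2) by (intro comp_inj_on) (auto simp: bij_betw_def)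
      have "(f \<circ> i) ` carrier (std_of G U) \<subseteq> carrier V" using i(2) fc by (auto simp: bij_betw_def)
      then show "inj_on j' ((f \<circ> i) ` carrier (std_of G U))"
        using j'(2) by (auto simp: bij_betw_def intro: inj_on_subset)
    qed
    have jc: "j ` carrier (std_of G V) = carrier V" "i ` carrier (std_of G U) = carrier U"
      "k' ` carrier W = carrier (std_of G W)" using j(2) i(2) k'(2) by (auto simp: bij_betw_def)
    have hc: "h v \<in> carrier W" if "v \<in> carrier V" for v using h(2) that by auto
    have "(j' \<circ> (f \<circ> i)) ` carrier (std_of G U) = j' ` {v \<in> carrier V. h v = \<zero>\<^bsub>W\<^esub>}"
      by (simp only: image_comp[symmetric] jc fh)
    also have "\<dots> = j' ` {v \<in> j ` carrier (std_of G V). h v = \<zero>\<^bsub>W\<^esub>}" by (simp add: jc)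
    also have "\<dots> = {v \<in> carrier (std_of G V). h (j v) = \<zero>\<^bsub>W\<^esub>}"
      by (force simp: j'j image_iff)
    also have "\<dots> = {v \<in> carrier (std_of G V). (k' \<circ> (h \<circ> j)) v = \<zero>\<^bsub>std_of G W\<^esub>}"
      using k'0 hc jc(1) by auto
    finally show "(j' \<circ> (f \<circ> i)) ` carrier (std_of G U)
      = {v \<in> carrier (std_of G V). (k' \<circ> (h \<circ> j)) v = \<zero>\<^bsub>std_of G W\<^esub>}" .
    show "(k' \<circ> (h \<circ> j)) ` carrier (std_of G V) = carrier (std_of G W)"
      by (simp only: image_comp[symmetric] jc h(2))
  qed
  then have rel: "frag_of (std_of G V) - frag_of (std_of G U) - frag_of (std_of G W) \<in> K0_rels G"
    unfolding K0_rels_def using std by (intro generate.incl) blast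
  have "K0_class G U \<otimes>\<^bsub>K0 G\<^esub> K0_class G W
     = K0_rels G #>\<^bsub>?F\<^esub> (frag_of (std_of G U) \<otimes>\<^bsub>?F\<^esub> frag_of (std_of G W))"
    using std by (simp add: K0_class_std K0_def FactGroup_def N.rcos_sum)
  also have "\<dots> = K0_rels G #>\<^bsub>?F\<^esub> frag_of (std_of G V)"
  proof (rule F.repr_independence[OF _ _ N.is_subgroup])
    have "frag_of (std_of G V) = (frag_of (std_of G V) - frag_of (std_of G U) - frag_of (std_of G W))
        + (frag_of (std_of G U) + frag_of (std_of G W))" by simp
    then show "frag_of (std_of G V) \<in> K0_rels G #>\<^bsub>?F\<^esub> (frag_of (std_of G U) \<otimes>\<^bsub>?F\<^esub> frag_of (std_of G W))"
      unfolding r_coset_def by (auto intro!: bexI[OF _ rel])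
    show "frag_of (std_of G U) \<otimes>\<^bsub>?F\<^esub> frag_of (std_of G W) \<in> carrier ?F"
      using std by (intro F.m_closed) auto
  qed
  finally show ?thesis by (simp add: K0_class_std)
qed

text \<open>
  The sequence \<open>0 \<rightarrow> V \<rightarrow> V \<rightarrow> V \<rightarrow> 0\<close> is exact when \<open>V = 0\<close>, so the class is idempotent.
\<close>

lemma K0_class_zero:
  assumes G: "group G" and fd: "is_fd_grep G V" and zero: "carrier V = {\<zero>\<^bsub>V\<^esub>}"
  shows "K0_class G V = \<one>\<^bsub>K0 G\<^esub>"
proof -
  have g: "is_grep G V" using fd by (simp add: is_fd_grep_def)
  interpret K: comm_group "K0 G" by (rule comm_group_K0)
  have "short_exact G V V V"
    unfolding short_exact_def
    by (intro bexI[of _ "\<lambda>x. x"])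
       (use zero is_grepD[OF g] in \<open>auto simp: grep_hom_def module_hom_def\<close>)
  then have "K0_class G V = K0_class G V \<otimes>\<^bsub>K0 G\<^esub> K0_class G V"
    by (rule K0_class_exact[OF G fd fd fd])
  then show ?thesis using K0_class_closed[OF G fd] K.r_cancel_one' by metis
qed

lemma K0_diff_mult:
  assumes "a \<in> carrier (K0 G)" "b \<in> carrier (K0 G)"
  shows "K0_diff G (a \<otimes>\<^bsub>K0 G\<^esub> b) a = b"
proof -
  interpret K: comm_group "K0 G" by (rule comm_group_K0)
  show ?thesis using assms by (simp add: K0_diff_def K.m_comm[of a b] K.m_assoc)
qed

subsection \<open>Matrix representations\<close>

lemma matrix_grep_simps [simp]:
  "carrier (matrix_grep \<rho>) = UNIV" "add (matrix_grep \<rho>) = (+)" "zero (matrix_grep \<rho>) = 0"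
  "module.smult (matrix_grep \<rho>) = (*s)" "act (matrix_grep \<rho>) g v = \<rho> g *v v"
  by (simp_all add: matrix_grep_def)

lemma vectorspace_matrix_grep: "vectorspace base_field (matrix_grep \<rho> :: ('k::field, 'k^'n, 'g) grep)"
proof (rule vs_criteria[OF base_field_field])
  show "\<forall>v\<in>carrier (matrix_grep \<rho>). \<exists>neg_v\<in>carrier (matrix_grep \<rho>). v \<oplus>\<^bsub>matrix_grep \<rho>\<^esub> neg_v = \<zero>\<^bsub>matrix_grep \<rho>\<^esub>"
    by (auto intro: exI[of _ "- _"])
qed (auto simp: vector_smult_assoc vector_sadd_rdistrib vector_add_ldistrib algebra_simps)

lemma finsum_matrix_grep: "finite A \<Longrightarrow> finsum (matrix_grep \<rho>) f A = sum f A"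
proof (induction A rule: finite_induct)
  case empty
  interpret V: vectorspace base_field "matrix_grep \<rho>" by (rule vectorspace_matrix_grep)
  show ?case using V.module.M.finsum_empty[of f] by simp
next
  case (insert x A)
  interpret V: vectorspace base_field "matrix_grep \<rho>" by (rule vectorspace_matrix_grep)
  show ?case using V.module.M.finsum_insert[of A x f] insert by simp
qed

lemma matrix_grep_dim:
  fixes \<rho> :: "'g \<Rightarrow> 'k::field^'n^'n"
  shows "vectorspace.fin_dim base_field (matrix_grep \<rho>)"
    and "vectorspace.dim base_field (matrix_grep \<rho>) = CARD('n)"
proof -
  interpret V: vectorspace base_field "matrix_grep \<rho>" by (rule vectorspace_matrix_grep)
  let ?e = "\<lambda>i. axis i 1 :: 'k^'n"
  have inj: "inj ?e" by (auto simp: inj_on_def axis_eq_axis)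
  have lc: "V.lincomb a (range ?e) = (\<chi> i. a (?e i))" for a
  proof -
    have "V.lincomb a (range ?e) = (\<Sum>b\<in>range ?e. a b *s b)"
      by (simp add: V.lincomb_def finsum_matrix_grep)
    also have "\<dots> = (\<Sum>i\<in>UNIV. a (?e i) *s ?e i)"
      by (subst sum.reindex[OF inj]) simp
    also have "\<dots> = (\<chi> i. a (?e i))"
      using basis_expansion[of "\<chi> i. a (?e i)"] by simp
    finally show ?thesis .
  qed
  have mem: "?e i \<in> range ?e" for i by blast
  have basis: "V.basis (range ?e)"
  proof (subst V.basis_criterion)
    show "\<forall>v. v \<in> carrier (matrix_grep \<rho>) \<longrightarrow> (\<exists>!a. a \<in> range ?e \<rightarrow>\<^sub>E carrier base_field \<and> V.lincomb a (range ?e) = v)"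
    proof (intro allI impI ex1I conjI)
      fix v :: "'k^'n"
      let ?a = "\<lambda>b\<in>range ?e. v $ the_inv ?e b"
      show "?a \<in> range ?e \<rightarrow>\<^sub>E carrier base_field" by simp
      show "V.lincomb ?a (range ?e) = v"
        unfolding lc by (simp add: mem vec_eq_iff the_inv_f_f[OF inj])
      fix a assume "a \<in> range ?e \<rightarrow>\<^sub>E carrier base_field \<and> V.lincomb a (range ?e) = v"
      then show "a = ?a"
        unfolding lc by (intro extensionalityI[of a "range ?e"]) (auto simp: PiE_def the_inv_f_f[OF inj])
    qed
  qed auto
  then show "V.fin_dim" unfolding V.fin_dim_def V.basis_def by (intro exI[of _ "range ?e"]) auto
  show "V.dim = CARD('n)" using V.dim_basis[OF _ basis] card_image[OF inj] by simp
qed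

lemma is_fd_grep_matrix_grep:
  assumes "matrix_rep G \<rho>"
  shows "is_fd_grep G (matrix_grep \<rho>)"
  unfolding is_fd_grep_def is_grep_def
  using assms vectorspace_matrix_grep matrix_grep_dim(1)
  by (auto simp: module_hom_def matrix_vector_right_distrib matrix_vector_mult_scaleR
     vector_scalar_commute matrix_rep_def matrix_vector_mul_assoc)

lemma matrix_rep_triv: "group G \<Longrightarrow> matrix_rep G triv"
  by (simp add: matrix_rep_def triv_def)

definition zero_grep :: "('k::field, 'k^1, 'g) grep" where
  "zero_grep = (matrix_grep triv) \<lparr>carrier := {0}\<rparr>"

lemma zero_grep:
  fixes G :: "('g, 'm) monoid_scheme"
  assumes "group G"
  shows "is_fd_grep G (zero_grep :: ('k::field, 'k^1, 'g) grep)" "vectorspace.dim base_field (zero_grep :: ('k::field, 'k^1, 'g) grep) = 0"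
    "K0_class G (zero_grep :: ('k::field, 'k^1, 'g) grep) = \<one>\<^bsub>K0 G\<^esub>"
proof -
  let ?Z = "zero_grep :: ('k, 'k^1, 'g) grep"
  have V: "vectorspace base_field ?Z"
    by (rule vs_criteria[OF base_field_field]) (auto simp: zero_grep_def)
  interpret V: vectorspace base_field ?Z by (rule V)
  have c: "carrier ?Z = {\<zero>\<^bsub>?Z\<^esub>}"
    by (simp add: zero_grep_def)
  then have gen: "V.span {\<zero>\<^bsub>?Z\<^esub>} = carrier ?Z"
    using V.span_zero V.span_closed[of "{\<zero>\<^bsub>?Z\<^esub>}"] by auto
  show "V.dim = 0" by (rule V.dim0I[OF gen])
  have "V.fin_dim" unfolding V.fin_dim_def by (intro exI[of _ "{\<zero>\<^bsub>?Z\<^esub>}"]) (use gen c in auto)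
  then show fd: "is_fd_grep G ?Z"
    unfolding is_fd_grep_def is_grep_def
    using V by (auto simp: zero_grep_def module_hom_def)
  show "K0_class G ?Z = \<one>\<^bsub>K0 G\<^esub>"
    by (rule K0_class_zero[OF assms fd c])
qed

section \<open>Symmetric powers\<close>

definition cst :: "'k::field \<Rightarrow> ('n, 'k) sym_alg" where "cst a = Poly_Mapping.single 0 a"
definition var :: "'n \<Rightarrow> ('n, 'k::field) sym_alg" where
  "var i = Poly_Mapping.single (Poly_Mapping.single i 1) 1"

lemma cst_simps: "cst 0 = 0" "cst 1 = 1" "cst (a + b) = cst a + cst b" "cst (a * b) = cst a * cst b"
  by (simp_all add: cst_def single_add mult_single)

lemma cst_numeral: "cst (numeral w) = numeral w"
  by (simp add: cst_def)

lemma var_power: "var i ^ n = Poly_Mapping.single (Poly_Mapping.single i n) (1 :: 'k::field)"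
proof (induction n)
  case (Suc n)
  then show ?case by (simp add: var_def mult_single single_add[symmetric])
qed simp

lemma cst_mult_single: "cst k * Poly_Mapping.single m l = Poly_Mapping.single m (k * l)"
  by (simp add: cst_def mult_single)

lemma monomial_expand:
  "Poly_Mapping.single m k = cst k * (\<Prod>i\<in>UNIV. var i ^ Poly_Mapping.lookup m (i :: 'n::finite))"
proof -
  have "(\<Prod>i\<in>A. Poly_Mapping.single (f i) (1 :: 'a)) = Poly_Mapping.single (\<Sum>i\<in>A. f i) 1"
    for A and f :: "'n \<Rightarrow> 'n \<Rightarrow>\<^sub>0 nat"
    by (induction A rule: infinite_finite_induct) (simp_all add: mult_single)
  moreover have "(\<Sum>i\<in>UNIV. Poly_Mapping.single i (Poly_Mapping.lookup m i)) = m"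
  proof (rule poly_mapping_eqI)
    fix j
    have "(\<Sum>i\<in>UNIV. Poly_Mapping.lookup (Poly_Mapping.single i (Poly_Mapping.lookup m i)) j)
      = (\<Sum>i\<in>UNIV. if i = j then Poly_Mapping.lookup m i else 0)"
      by (intro sum.cong) (auto simp: lookup_single when_def)
    then show "Poly_Mapping.lookup (\<Sum>i\<in>UNIV. Poly_Mapping.single i (Poly_Mapping.lookup m i)) j
        = Poly_Mapping.lookup m j"
      by (simp add: lookup_sum)
  qed
  ultimately show ?thesis by (simp add: var_power cst_mult_single)
qed

lemma linear_form_expand: "linear_form v = (\<Sum>i\<in>UNIV. cst (v $ i) * var i)"
  by (simp add: linear_form_def var_def cst_mult_single)

lemma linear_form_axis: "linear_form (axis i 1) = var i"
  unfolding linear_form_expand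
  by (rule axis_expand[of "\<lambda>a b. cst a * b"]) (simp_all add: cst_simps)

lemma matrix_axis_nth: "(A *v axis i 1) $ j = (A :: 'k::field^'n^'m) $ j $ i"
proof -
  have "(A *v axis i 1) $ j = (\<Sum>k\<in>UNIV. if k = i then A $ j $ k else 0)"
    unfolding matrix_vector_mult_def by (simp add: axis_def if_distrib cong: if_cong)
  then show ?thesis by simp
qed

lemma linear_form_mult:
  fixes A :: "'k::field^'n^'m"
  shows "linear_form (A *v v) = (\<Sum>i\<in>UNIV. cst (v $ i) * linear_form (A *v axis i 1))"
proof -
  have cst_sum: "cst (\<Sum>i\<in>B. f i) = (\<Sum>i\<in>B. cst (f i))" for B and f :: "'n \<Rightarrow> 'k"
    by (induction B rule: infinite_finite_induct) (simp_all add: cst_simps)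
  have "linear_form (A *v v) = (\<Sum>j\<in>UNIV. \<Sum>i\<in>UNIV. cst (v $ i) * (cst (A $ j $ i) * var j))"
    by (simp add: linear_form_expand matrix_vector_mult_def cst_sum cst_simps sum_distrib_right sum_distrib_left mult_ac)
  also have "\<dots> = (\<Sum>i\<in>UNIV. cst (v $ i) * linear_form (A *v axis i 1))"
    by (subst sum.swap) (simp add: linear_form_expand matrix_axis_nth sum_distrib_left)
  finally show ?thesis .
qed

lemma sym_act_add: "sym_act \<rho> g (P + Q) = sym_act \<rho> g P + sym_act \<rho> g Q"
  unfolding sym_act_def
  by (rule setsum_keys_plus_distrib) (simp_all add: single_add distrib_right)

lemma sym_act_single: "sym_act \<rho> g (Poly_Mapping.single m k)
    = cst k * (\<Prod>i\<in>UNIV. linear_form (\<rho> g *v axis i 1) ^ Poly_Mapping.lookup m i)"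
  by (cases "k = 0") (simp_all add: sym_act_def cst_def)

lemma sym_act_cst [simp]: "sym_act \<rho> g (cst k) = cst k"
  by (simp add: cst_def[of k] sym_act_single[of \<rho> g 0])

lemma sym_act_1 [simp]: "sym_act \<rho> g 1 = 1"
  using sym_act_cst[of \<rho> g 1] by (simp add: cst_simps)

lemma sym_act_0 [simp]: "sym_act \<rho> g 0 = 0"
  by (simp add: sym_act_def)

lemma sym_act_mult: "sym_act \<rho> g (P * Q) = sym_act \<rho> g P * sym_act \<rho> g Q"
proof (induction P rule: poly_mapping_single_induct)
  case (single m k)
  show ?case
  proof (induction Q rule: poly_mapping_single_induct)
    case (single m' k')
    show ?case
      by (simp add: mult_single sym_act_single lookup_add power_add prod.distrib cst_simps mult_ac)
  qed (simp_all add: distrib_left sym_act_add)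
qed (simp_all add: distrib_right sym_act_add)

lemma sym_act_power: "sym_act \<rho> g (P ^ n) = sym_act \<rho> g P ^ n"
  by (induction n) (simp_all add: sym_act_mult)

lemma sym_act_prod: "sym_act \<rho> g (\<Prod>i\<in>A. f i) = (\<Prod>i\<in>A. sym_act \<rho> g (f i))"
  by (induction A rule: infinite_finite_induct) (simp_all add: sym_act_mult)

lemma sym_act_sum: "sym_act \<rho> g (\<Sum>i\<in>A. f i) = (\<Sum>i\<in>A. sym_act \<rho> g (f i))"
  by (induction A rule: infinite_finite_induct) (simp_all add: sym_act_add)

lemma sym_act_var: "sym_act \<rho> g (var i) = linear_form (\<rho> g *v axis i 1)"
proof -
  have "(\<Prod>j\<in>UNIV. linear_form (\<rho> g *v axis j 1) ^ Poly_Mapping.lookup (Poly_Mapping.single i 1) j)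
    = (\<Prod>j\<in>UNIV. if j = i then linear_form (\<rho> g *v axis j 1) else 1)"
    by (intro prod.cong) (auto simp: lookup_single when_def)
  then show ?thesis by (simp add: var_def sym_act_single cst_simps)
qed

lemma sym_act_linear_form: "sym_act \<rho> g (linear_form v) = linear_form (\<rho> g *v v)"
  by (subst linear_form_expand, subst linear_form_mult)
     (simp add: sym_act_sum sym_act_mult sym_act_var)

lemma sym_act_group_mult:
  assumes "matrix_rep G \<rho>" "g \<in> carrier G" "h \<in> carrier G"
  shows "sym_act \<rho> (g \<otimes>\<^bsub>G\<^esub> h) P = sym_act \<rho> g (sym_act \<rho> h P)"
proof (induction P rule: poly_mapping_single_induct)
  case (single m k)
  show ?case
    using matrix_repD(3)[OF assms]
    by (simp add: sym_act_single sym_act_mult sym_act_prod sym_act_power sym_act_linear_form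
      matrix_vector_mul_assoc)
qed (simp_all add: sym_act_add)

lemma sym_act_one:
  assumes "matrix_rep G \<rho>"
  shows "sym_act \<rho> \<one>\<^bsub>G\<^esub> P = P"
proof (induction P rule: poly_mapping_single_induct)
  case (single m k)
  show ?case
    unfolding sym_act_single matrix_repD(2)[OF assms] matrix_vector_mul_lid linear_form_axis
    by (rule monomial_expand[symmetric])
qed (simp_all add: sym_act_add)

definition sym_homog :: "nat \<Rightarrow> ('n, 'k::field) sym_alg set" where
  "sym_homog d = {P. \<forall>m\<in>Poly_Mapping.keys P. (\<Sum>i\<in>UNIV. Poly_Mapping.lookup m i) = d}"

lemma sym_homog_0 [simp]: "0 \<in> sym_homog d" by (simp add: sym_homog_def)

lemma sym_homog_add: "P \<in> sym_homog d \<Longrightarrow> Q \<in> sym_homog d \<Longrightarrow> P + Q \<in> sym_homog d"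
  using keys_add[of P Q] by (fastforce simp: sym_homog_def)

lemma sym_homog_uminus: "P \<in> sym_homog d \<Longrightarrow> - P \<in> sym_homog d"
  by (simp add: sym_homog_def in_keys_iff)

lemma sym_homog_mult: "P \<in> sym_homog d \<Longrightarrow> Q \<in> sym_homog e \<Longrightarrow> P * Q \<in> sym_homog (d + e)"
  using keys_mult[of P Q] by (fastforce simp: sym_homog_def lookup_add sum.distrib)

lemma sym_homog_cst: "cst a \<in> sym_homog 0"
  by (simp add: sym_homog_def cst_def)

lemma sym_homog_cst_mult: "P \<in> sym_homog d \<Longrightarrow> cst a * P \<in> sym_homog d"
  using sym_homog_mult[OF sym_homog_cst, of P d a] by simp

lemma sym_homog_sum: "(\<And>i. i \<in> A \<Longrightarrow> f i \<in> sym_homog d) \<Longrightarrow> (\<Sum>i\<in>A. f i) \<in> sym_homog d"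
  by (induction A rule: infinite_finite_induct) (auto intro: sym_homog_add)

lemma sym_homog_var: "var (i :: 'n::finite) \<in> sym_homog 1"
proof -
  have "(\<Sum>j\<in>UNIV. Poly_Mapping.lookup (Poly_Mapping.single i (1::nat)) j) = (\<Sum>j\<in>UNIV. if j = i then 1 else 0)"
    by (intro sum.cong) (auto simp: lookup_single when_def)
  then show ?thesis by (simp add: sym_homog_def var_def)
qed

lemma sym_homog_power: "P \<in> sym_homog d \<Longrightarrow> P ^ n \<in> sym_homog (n * d)"
proof (induction n)
  case 0 then show ?case using sym_homog_cst[of 1] by (simp add: cst_simps)
next
  case (Suc n) then show ?case using sym_homog_mult[of P d "P ^ n" "n * d"] by simp
qed

lemma sym_homog_prod: "(\<And>i. i \<in> A \<Longrightarrow> f i \<in> sym_homog (e i)) \<Longrightarrow> (\<Prod>i\<in>A. f i) \<in> sym_homog (\<Sum>i\<in>A. e i)"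
proof (induction A rule: infinite_finite_induct)
  case (insert x A) then show ?case by (auto intro: sym_homog_mult)
qed (use sym_homog_cst[of 1] in \<open>simp_all add: cst_simps\<close>)

lemma sym_act_homog:
  fixes P :: "('n::finite, 'k::field) sym_alg"
  assumes "P \<in> sym_homog d"
  shows "sym_act \<rho> g P \<in> sym_homog d"
  unfolding sym_act_def
proof (rule sym_homog_sum)
  fix m assume "m \<in> Poly_Mapping.keys P"
  then have "(\<Sum>i\<in>UNIV. Poly_Mapping.lookup m i * 1) = d" using assms by (simp add: sym_homog_def)
  moreover have "linear_form v \<in> sym_homog 1" for v :: "'k^'n"
    unfolding linear_form_expand by (intro sym_homog_sum sym_homog_cst_mult sym_homog_var)
  ultimately have "(\<Prod>i\<in>UNIV. linear_form (\<rho> g *v axis i 1) ^ Poly_Mapping.lookup m i) \<in> sym_homog d"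
    using sym_homog_prod[of UNIV "\<lambda>i. linear_form (\<rho> g *v axis i 1) ^ Poly_Mapping.lookup m i" "\<lambda>i. Poly_Mapping.lookup m i * 1"]
      sym_homog_power by blast
  then show "Poly_Mapping.single 0 (Poly_Mapping.lookup P m)
      * (\<Prod>i\<in>UNIV. linear_form (\<rho> g *v axis i 1) ^ Poly_Mapping.lookup m i) \<in> sym_homog d"
    using sym_homog_cst_mult by (simp add: cst_def)
qed

lemma sym_power_simps [simp]:
  "carrier (sym_power \<rho> d) = sym_homog d" "add (sym_power \<rho> d) = (+)" "zero (sym_power \<rho> d) = 0"
  "module.smult (sym_power \<rho> d) a P = cst a * P" "act (sym_power \<rho> d) = sym_act \<rho>"
  by (simp_all add: sym_power_def sym_homog_def cst_def)

lemma vectorspace_sym_power: "vectorspace base_field (sym_power \<rho> d :: ('k::field, ('n::finite, 'k) sym_alg, 'g) grep)"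
proof (rule vs_criteria[OF base_field_field])
  show "\<forall>v\<in>carrier (sym_power \<rho> d). \<exists>neg_v\<in>carrier (sym_power \<rho> d). v \<oplus>\<^bsub>sym_power \<rho> d\<^esub> neg_v = \<zero>\<^bsub>sym_power \<rho> d\<^esub>"
    by (auto intro!: bexI[of _ "- _"] sym_homog_uminus)
qed (auto simp: cst_simps distrib_left distrib_right add_ac mult.assoc intro: sym_homog_add sym_homog_cst_mult)

text \<open>
  The finitely many monomials of degree \<open>d\<close> generate.
\<close>

lemma fin_dim_sym_power:
  "vectorspace.fin_dim base_field (sym_power \<rho> d :: ('k::field, ('n::finite, 'k) sym_alg, 'g) grep)"
proof -
  let ?S = "sym_power \<rho> d :: ('k, ('n, 'k) sym_alg, 'g) grep"
  interpret V: vectorspace base_field ?S by (rule vectorspace_sym_power)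
  let ?I = "{m :: 'n \<Rightarrow>\<^sub>0 nat. (\<Sum>i\<in>UNIV. Poly_Mapping.lookup m i) = d}"
  let ?s = "\<lambda>m. Poly_Mapping.single m 1 :: ('n, 'k) sym_alg"
  have s_eq: "?s m = ?s m' \<longleftrightarrow> m = m'" for m m'
  proof
    assume "?s m = ?s m'"
    then have "Poly_Mapping.keys (?s m) = Poly_Mapping.keys (?s m')" by (rule arg_cong)
    then show "m = m'" by simp
  qed simp
  have "Poly_Mapping.lookup ` ?I \<subseteq> PiE UNIV (\<lambda>_. {..d})"
    by (auto intro: member_le_sum)
  then have "finite (Poly_Mapping.lookup ` ?I)"
    by (rule finite_subset) (simp add: finite_PiE)
  then have fin: "finite ?I"
    by (rule finite_imageD) (auto simp: inj_on_def poly_mapping_eqI)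
  have sub: "?s ` ?I \<subseteq> carrier ?S" by (auto simp: sym_homog_def)
  have fs: "finsum ?S f A = sum f A" if "finite A" "f ` A \<subseteq> sym_homog d" for f and A :: "('n, 'k) sym_alg set"
    using that
  proof (induction A rule: finite_induct)
    case empty
    show ?case using V.module.M.finsum_empty[of f] by simp
  next
    case (insert x A)
    then have "f \<in> A \<rightarrow> carrier ?S" "f x \<in> carrier ?S" by auto
    then show ?case using V.module.M.finsum_insert[of A x f] insert by simp
  qed
  have "P \<in> V.span (?s ` ?I)" if P: "P \<in> sym_homog d" for P
  proof -
    let ?a = "\<lambda>Q. Poly_Mapping.lookup P (THE m. Q = ?s m)"
    have a: "?a (?s m) = Poly_Mapping.lookup P m" for m
      by (simp add: s_eq eq_commute[of m])
    have inj: "inj_on ?s ?I" by (simp add: inj_on_def s_eq)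
    have "V.lincomb ?a (?s ` ?I) = (\<Sum>Q\<in>?s ` ?I. cst (?a Q) * Q)"
      unfolding V.lincomb_def using fin sub sym_homog_cst_mult by (subst fs) auto
    also have "\<dots> = (\<Sum>m\<in>?I. Poly_Mapping.single m (Poly_Mapping.lookup P m))"
      by (subst sum.reindex[OF inj]) (simp add: a cst_mult_single)
    also have "\<dots> = P"
    proof (rule poly_mapping_eqI)
      fix m
      have "(\<Sum>m'\<in>?I. Poly_Mapping.lookup (Poly_Mapping.single m' (Poly_Mapping.lookup P m')) m)
        = (\<Sum>m'\<in>?I. if m' = m then Poly_Mapping.lookup P m' else 0)"
        by (intro sum.cong) (auto simp: lookup_single when_def)
      also have "\<dots> = Poly_Mapping.lookup P m"
        using P fin by (auto simp: sym_homog_def in_keys_iff)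
      finally show "Poly_Mapping.lookup (\<Sum>m\<in>?I. Poly_Mapping.single m (Poly_Mapping.lookup P m)) m
        = Poly_Mapping.lookup P m"
        by (simp add: lookup_sum)
    qed
    finally show ?thesis
      unfolding V.finite_span[OF finite_imageI[OF fin] sub] by (auto intro!: exI[of _ ?a])
  qed
  moreover have "V.span (?s ` ?I) \<subseteq> carrier ?S" using V.span_closed[OF sub] by blast
  ultimately have "V.span (?s ` ?I) = carrier ?S" by auto
  then show ?thesis unfolding V.fin_dim_def using fin sub by blast
qed

lemma is_fd_grep_sym_power:
  assumes "matrix_rep G \<rho>"
  shows "is_fd_grep G (sym_power \<rho> d)"
  unfolding is_fd_grep_def is_grep_def
  using vectorspace_sym_power fin_dim_sym_power
  by (auto simp: module_hom_def sym_act_add sym_act_mult sym_act_group_mult[OF assms]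
    sym_act_one[OF assms] intro: sym_act_homog)

section \<open>Binary forms over the field with two elements\<close>

text \<open>
  The two-dimensional representations of interest have matrices over the field with two elements,
  although \<open>'k\<close> may be larger.
\<close>

locale plane_F2 =
  fixes i j :: "'n::finite" and G :: "('g, 'm) monoid_scheme" and \<rho> :: "'g \<Rightarrow> 'k::field^'n^'n"
  assumes ij: "i \<noteq> j" and UNIV_ij: "(UNIV :: 'n set) = {i, j}"
    and char2: "(1 :: 'k) + 1 = 0" and rep: "matrix_rep G \<rho>"
    and entries: "g \<in> carrier G \<Longrightarrow> \<rho> g $ a $ b = 0 \<or> \<rho> g $ a $ b = 1"
    and det: "g \<in> carrier G \<Longrightarrow> \<rho> g $ i $ i * \<rho> g $ j $ j + \<rho> g $ i $ j * \<rho> g $ j $ i = 1"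
begin

lemma add_self [simp]: "(x :: 'k) + x = 0"
proof -
  have "x + x = x * (1 + 1)" by (simp add: distrib_left)
  then show ?thesis using char2 by simp
qed

lemma add_self_left [simp]: "(x :: 'k) + (x + y) = y"
  by (simp add: add.assoc[symmetric])

lemma uminus_self [simp]: "- (x :: 'k) = x"
  by (rule minus_unique) simp

lemma add_eq_0_self: "(x :: 'k) + y = 0 \<longleftrightarrow> x = y"
  by (metis add_self add_self_left add.right_neutral)

lemma sum_ij: "(\<Sum>l\<in>UNIV. f l) = f i + f j" for f :: "'n \<Rightarrow> 'b::comm_monoid_add"
  using ij by (simp add: UNIV_ij)

lemma all_ij: "(\<forall>l. Q l) \<longleftrightarrow> Q i \<and> Q j"
  using UNIV_ij by (metis UNIV_I insert_iff singletonD)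

lemma cases6:
  assumes "g \<in> carrier G"
  shows "(\<rho> g $ i $ i, \<rho> g $ j $ i, \<rho> g $ i $ j, \<rho> g $ j $ j)
     \<in> {(1,0,0,1), (0,1,1,0), (1,1,0,1), (1,0,1,1), (1,1,1,0), (0,1,1,1)}"
  using entries[OF assms, of i i] entries[OF assms, of i j] entries[OF assms, of j i] entries[OF assms, of j j]
    det[OF assms] by (elim disjE) simp_all

text \<open>
  \<open>mon a b\<close> is the exponent of the monomial \<open>x\<^sup>a y\<^sup>b\<close>, where \<open>x\<close> and \<open>y\<close> are the variables with index \<open>i\<close> and
  \<open>j\<close>.
\<close>

definition mon :: "nat \<Rightarrow> nat \<Rightarrow> 'n \<Rightarrow>\<^sub>0 nat" where
  "mon a b = Poly_Mapping.single i a + Poly_Mapping.single j b"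

lemma mon_eq [simp]: "mon a b = mon a' b' \<longleftrightarrow> a = a' \<and> b = b'"
  using ij by (auto simp: mon_def poly_mapping_eq_iff fun_eq_iff lookup_add lookup_single when_def all_ij)

lemma mon_sum: "(\<Sum>l\<in>UNIV. Poly_Mapping.lookup (mon a b) l) = a + b"
  using ij by (simp add: sum_ij mon_def lookup_add lookup_single)

lemma mon_surj: "m = mon (Poly_Mapping.lookup m i) (Poly_Mapping.lookup m j)"
  using ij by (simp add: mon_def poly_mapping_eq_iff fun_eq_iff lookup_add lookup_single all_ij)

lemma single_mon: "Poly_Mapping.single (mon a b) k = cst k * (var i ^ a * var j ^ b)"
  unfolding mon_def var_power by (simp add: mult_single cst_mult_single)

definition quad :: "'k \<Rightarrow> 'k \<Rightarrow> 'k \<Rightarrow> ('n, 'k) sym_alg" where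
  "quad a b c = Poly_Mapping.single (mon 2 0) a + Poly_Mapping.single (mon 1 1) b + Poly_Mapping.single (mon 0 2) c"

definition cubic :: "'k \<Rightarrow> 'k \<Rightarrow> 'k \<Rightarrow> 'k \<Rightarrow> ('n, 'k) sym_alg" where
  "cubic a b c d = Poly_Mapping.single (mon 3 0) a + Poly_Mapping.single (mon 2 1) b
     + Poly_Mapping.single (mon 1 2) c + Poly_Mapping.single (mon 0 3) d"

lemma lookup_quad:
  "Poly_Mapping.lookup (quad a b c) (mon 2 0) = a" "Poly_Mapping.lookup (quad a b c) (mon (Suc 0) (Suc 0)) = b"
  "Poly_Mapping.lookup (quad a b c) (mon 0 2) = c"
  by (simp_all add: quad_def lookup_add lookup_single when_def)

lemma lookup_cubic:
  "Poly_Mapping.lookup (cubic a b c d) (mon 3 0) = a" "Poly_Mapping.lookup (cubic a b c d) (mon 2 (Suc 0)) = b"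
  "Poly_Mapping.lookup (cubic a b c d) (mon (Suc 0) 2) = c" "Poly_Mapping.lookup (cubic a b c d) (mon 0 3) = d"
  by (simp_all add: cubic_def lookup_add lookup_single when_def)

lemma quad_eq [simp]: "quad a b c = quad a' b' c' \<longleftrightarrow> a = a' \<and> b = b' \<and> c = c'"
  by (metis lookup_quad)

lemma cubic_eq [simp]: "cubic a b c d = cubic a' b' c' d' \<longleftrightarrow> a = a' \<and> b = b' \<and> c = c' \<and> d = d'"
  by (metis lookup_cubic)

lemma sym_homog_single_mon: "a + b = d \<Longrightarrow> Poly_Mapping.single (mon a b) k \<in> sym_homog d"
  by (auto simp: sym_homog_def mon_sum)

lemma quad_homog: "quad a b c \<in> sym_homog 2"
  unfolding quad_def by (intro sym_homog_add sym_homog_single_mon) simp_all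

lemma cubic_homog: "cubic a b c d \<in> sym_homog 3"
  unfolding cubic_def by (intro sym_homog_add sym_homog_single_mon) simp_all

lemma lookup_homog: "P \<in> sym_homog d \<Longrightarrow> Poly_Mapping.lookup P (mon a b) \<noteq> 0 \<Longrightarrow> a + b = d"
  using mon_sum[of a b] by (auto simp: sym_homog_def in_keys_iff)

lemma sym_homog_2: "P \<in> sym_homog 2 \<Longrightarrow> \<exists>a b c. P = quad a b c"
proof (intro exI poly_mapping_eqI)
  fix m assume P: "P \<in> sym_homog 2"
  obtain a b where m: "m = mon a b" using mon_surj by blast
  consider "a = 2" "b = 0" | "a = Suc 0" "b = Suc 0" | "a = 0" "b = 2" | "a + b \<noteq> 2" by linarith
  then show "Poly_Mapping.lookup P m = Poly_Mapping.lookup (quad (Poly_Mapping.lookup P (mon 2 0))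
     (Poly_Mapping.lookup P (mon (Suc 0) (Suc 0))) (Poly_Mapping.lookup P (mon 0 2))) m"
  proof cases
    case 4
    then show ?thesis using lookup_homog[OF P, of a b] lookup_homog[OF quad_homog, of _ _ _ a b] by (metis m)
  qed (simp_all add: m lookup_quad)
qed

lemma sym_homog_3: "P \<in> sym_homog 3 \<Longrightarrow> \<exists>a b c d. P = cubic a b c d"
proof (intro exI poly_mapping_eqI)
  fix m assume P: "P \<in> sym_homog 3"
  obtain a b where m: "m = mon a b" using mon_surj by blast
  consider "a = 3" "b = 0" | "a = 2" "b = Suc 0" | "a = Suc 0" "b = 2" | "a = 0" "b = 3" | "a + b \<noteq> 3" by linarith
  then show "Poly_Mapping.lookup P m = Poly_Mapping.lookup (cubic (Poly_Mapping.lookup P (mon 3 0))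
     (Poly_Mapping.lookup P (mon 2 (Suc 0))) (Poly_Mapping.lookup P (mon (Suc 0) 2)) (Poly_Mapping.lookup P (mon 0 3))) m"
  proof cases
    case 5
    then show ?thesis using lookup_homog[OF P, of a b] lookup_homog[OF cubic_homog, of _ _ _ _ a b] by (metis m)
  qed (simp_all add: m lookup_cubic)
qed

lemma quad_add: "quad a b c + quad a' b' c' = quad (a + a') (b + b') (c + c')"
  and cst_quad: "cst k * quad a b c = quad (k * a) (k * b) (k * c)"
  by (simp_all add: quad_def single_add add_ac distrib_left cst_mult_single)

lemma cubic_add: "cubic a b c d + cubic a' b' c' d' = cubic (a + a') (b + b') (c + c') (d + d')"
  and cst_cubic: "cst k * cubic a b c d = cubic (k * a) (k * b) (k * c) (k * d)"
  by (simp_all add: cubic_def single_add add_ac distrib_left cst_mult_single)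

lemma zero_quad: "0 = quad 0 0 0" and zero_cubic: "0 = cubic 0 0 0 0"
  by (simp_all add: quad_def cubic_def)

lemma sym_act_var_ij:
  "sym_act \<rho> g (var i) = cst (\<rho> g $ i $ i) * var i + cst (\<rho> g $ j $ i) * var j"
  "sym_act \<rho> g (var j) = cst (\<rho> g $ i $ j) * var i + cst (\<rho> g $ j $ j) * var j"
  by (simp_all add: sym_act_var linear_form_expand matrix_axis_nth sum_ij)

lemma sym_act_quad:
  assumes "\<rho> g $ i $ i = p" "\<rho> g $ j $ i = q" "\<rho> g $ i $ j = r" "\<rho> g $ j $ j = s"
  shows "sym_act \<rho> g (quad a b c) = quad (a * p * p + b * p * r + c * r * r)
    ((a * p * q + a * p * q) + b * (p * s + q * r) + (c * r * s + c * r * s)) (a * q * q + b * q * s + c * s * s)"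
  unfolding quad_def single_mon
  by (simp add: sym_act_add sym_act_mult sym_act_power sym_act_var_ij assms cst_simps power2_eq_square
      del: add_self add_self_left) (simp add: algebra_simps cst_numeral del: add_self add_self_left)

lemma sym_act_cubic:
  assumes "\<rho> g $ i $ i = p" "\<rho> g $ j $ i = q" "\<rho> g $ i $ j = r" "\<rho> g $ j $ j = s"
  shows "sym_act \<rho> g (cubic a b c d) = cubic (a * p * p * p + b * p * p * r + c * p * r * r + d * r * r * r)
    ((a * p * p * q + a * p * p * q + a * p * p * q) + b * (p * p * s + p * q * r + p * q * r) + c * (q * r * r + p * r * s + p * r * s) + (d * r * r * s + d * r * r * s + d * r * r * s))
    ((a * p * q * q + a * p * q * q + a * p * q * q) + b * (p * q * s + p * q * s + q * q * r) + c * (q * r * s + q * r * s + p * s * s) + (d * r * s * s + d * r * s * s + d * r * s * s))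
    (a * q * q * q + b * q * q * s + c * q * s * s + d * s * s * s)"
  unfolding cubic_def single_mon
  by (simp add: sym_act_add sym_act_mult sym_act_power sym_act_var_ij assms cst_simps power2_eq_square power3_eq_cube
      del: add_self add_self_left) (simp add: algebra_simps cst_numeral del: add_self add_self_left)

definition vec2 :: "'k \<Rightarrow> 'k \<Rightarrow> 'k^'n" where "vec2 a b = (\<chi> l. if l = i then a else b)"

lemma vec2_nth [simp]: "vec2 a b $ i = a" "vec2 a b $ j = b"
  using ij by (simp_all add: vec2_def)

lemma vec_eq_ij: "(u :: 'k^'n) = v \<longleftrightarrow> u $ i = v $ i \<and> u $ j = v $ j"
  by (simp add: vec_eq_iff all_ij)

lemma mult_vec_ij: "(\<rho> g *v v) $ l = \<rho> g $ l $ i * v $ i + \<rho> g $ l $ j * v $ j"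
  by (simp add: matrix_vector_mult_def sum_ij)

lemma group_G: "group G" using matrix_repD(1)[OF rep] .

text \<open>
  The multiples of the invariant \<open>x\<^sup>2 + x y + y\<^sup>2\<close> form a trivial subrepresentation.  Modulo it
  \<open>x y = x\<^sup>2 + y\<^sup>2\<close>, and \<open>x\<^sup>2\<close>, \<open>y\<^sup>2\<close> transform like \<open>x\<close>, \<open>y\<close> because the matrix entries are their own
  squares.
\<close>

lemma K0_sym_2:
  "K0_class G (sym_power \<rho> 2) = K0_class G (matrix_grep triv :: ('k, 'k^1, 'g) grep) \<otimes>\<^bsub>K0 G\<^esub> K0_class G (matrix_grep \<rho>)"
proof (rule K0_class_exact[OF group_G])
  show "is_fd_grep G (matrix_grep triv :: ('k, 'k^1, 'g) grep)" "is_fd_grep G (sym_power \<rho> 2)" "is_fd_grep G (matrix_grep \<rho>)"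
    by (rule is_fd_grep_matrix_grep matrix_rep_triv group_G is_fd_grep_sym_power rep)+
  define f :: "'k^1 \<Rightarrow> ('n, 'k) sym_alg" where "f v = quad (v $ 1) (v $ 1) (v $ 1)" for v
  define h :: "('n, 'k) sym_alg \<Rightarrow> 'k^'n" where
    "h P = vec2 (Poly_Mapping.lookup P (mon 2 0) + Poly_Mapping.lookup P (mon (Suc 0) (Suc 0)))
       (Poly_Mapping.lookup P (mon 0 2) + Poly_Mapping.lookup P (mon (Suc 0) (Suc 0)))" for P
  have h: "h (quad a b c) = vec2 (a + b) (c + b)" for a b c by (simp add: h_def lookup_quad)
  have act_f: "sym_act \<rho> g (f v) = f v" if "g \<in> carrier G" for g v
    using cases6[OF that] by (auto simp: f_def sym_act_quad)
  have act_h: "h (sym_act \<rho> g (quad a b c)) = \<rho> g *v h (quad a b c)" if "g \<in> carrier G" for g a b c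
    using cases6[OF that] by (auto simp: sym_act_quad h vec_eq_ij mult_vec_ij add_ac)
  show "short_exact G (matrix_grep triv :: ('k, 'k^1, 'g) grep) (sym_power \<rho> 2) (matrix_grep \<rho>)"
    unfolding short_exact_def
  proof (intro bexI conjI)
    show "f \<in> grep_hom G (matrix_grep triv) (sym_power \<rho> 2)"
      by (auto simp: grep_hom_def module_hom_def act_f) (auto simp: f_def quad_homog quad_add cst_quad)
    show "h \<in> grep_hom G (sym_power \<rho> 2) (matrix_grep \<rho>)"
      by (auto simp: grep_hom_def module_hom_def dest!: sym_homog_2)
         (auto simp: act_h, auto simp: quad_add cst_quad h vec_eq_ij algebra_simps)
    show "inj_on f (carrier (matrix_grep triv))" by (auto simp: inj_on_def f_def vec_eq_iff forall_1)
    show "f ` carrier (matrix_grep triv) = {v \<in> carrier (sym_power \<rho> 2). h v = \<zero>\<^bsub>matrix_grep \<rho>\<^esub>}"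
    proof (intro equalityI subsetI)
      fix P assume "P \<in> {v \<in> carrier (sym_power \<rho> 2). h v = \<zero>\<^bsub>matrix_grep \<rho>\<^esub>}"
      then have "P \<in> sym_homog 2" "h P = 0" by auto
      moreover from this obtain a b c where "P = quad a b c" using sym_homog_2 by blast
      ultimately have "P = f (\<chi> _. a)" by (auto simp: h vec_eq_ij f_def add_eq_0_self)
      then show "P \<in> f ` carrier (matrix_grep triv)" by simp
    qed (auto simp: f_def quad_homog h vec_eq_ij)
    have "v \<in> h ` sym_homog 2" for v
      by (rule image_eqI[OF _ quad_homog[of "v $ i" 0 "v $ j"]]) (simp add: h vec_eq_ij)
    then show "h ` carrier (sym_power \<rho> 2) = carrier (matrix_grep \<rho>)" by auto
  qed
qed

text \<open>
  The cubics divisible by \<open>x\<^sup>2 + x y + y\<^sup>2\<close> or equal to the invariant \<open>x\<^sup>2 y + x y\<^sup>2\<close> span the cubics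
  whose two middle coefficients agree.
\<close>

definition mid_cubics :: "('n, 'k) sym_alg set" where
  "mid_cubics = {cubic a b b d | a b d. True}"

definition mid_grep :: "('k, ('n, 'k) sym_alg, 'g) grep" where
  "mid_grep = (sym_power \<rho> 3) \<lparr>carrier := mid_cubics\<rparr>"

lemma mid_grep_simps [simp]:
  "carrier mid_grep = mid_cubics" "add mid_grep = (+)" "zero mid_grep = 0"
  "module.smult mid_grep a P = cst a * P" "act mid_grep = sym_act \<rho>"
  using sym_power_simps(2-)[of \<rho> 3] by (simp_all add: mid_grep_def)

lemma mid_cubics_subset: "mid_cubics \<subseteq> sym_homog 3"
  by (auto simp: mid_cubics_def cubic_homog)

lemma sym_act_mid:
  assumes g: "g \<in> carrier G"
    and pqrs: "\<rho> g $ i $ i = p" "\<rho> g $ j $ i = q" "\<rho> g $ i $ j = r" "\<rho> g $ j $ j = s"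
  shows "sym_act \<rho> g (cubic a b b d) = cubic (p * a + r * d) (p * q * a + b + r * s * d)
    (p * q * a + b + r * s * d) (q * a + s * d)"
  using cases6[OF g]
  unfolding pqrs sym_act_cubic[OF pqrs] cubic_eq insert_iff prod.inject empty_iff
  by (elim disjE conjE FalseE) (simp_all add: add_ac)

text \<open>
  Finite dimension comes from a linear projection of the space of all cubics that forgets one of the middle
  coefficients.
\<close>

lemma is_fd_grep_mid: "is_fd_grep G mid_grep"
proof -
  have S: "is_fd_grep G (sym_power \<rho> 3)" by (rule is_fd_grep_sym_power[OF rep])
  then have Sg: "is_grep G (sym_power \<rho> 3)" by (simp add: is_fd_grep_def)
  have add: "P + Q \<in> mid_cubics" if "P \<in> mid_cubics" "Q \<in> mid_cubics" for P Q
    using that by (auto simp: mid_cubics_def cubic_add)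
  have smult: "cst k * P \<in> mid_cubics" if "P \<in> mid_cubics" for P k
    using that by (auto simp: mid_cubics_def cst_cubic)
  have zero: "0 \<in> mid_cubics" by (auto simp: mid_cubics_def zero_cubic)
  have act: "sym_act \<rho> g P \<in> mid_cubics" if "g \<in> carrier G" "P \<in> mid_cubics" for g P
    using that by (auto simp: mid_cubics_def sym_act_mid)
  have V: "vectorspace base_field mid_grep"
  proof (rule vs_criteria[OF base_field_field])
    have "P + cst (- 1) * P = 0" for P :: "('n, 'k) sym_alg"
    proof -
      have "P + cst (- 1) * P = cst (1 + - 1) * P" by (simp only: cst_simps distrib_right mult_1_left)
      then show ?thesis by (simp add: cst_simps)
    qed
    then show "\<forall>v\<in>carrier mid_grep. \<exists>neg_v\<in>carrier mid_grep. v \<oplus>\<^bsub>mid_grep\<^esub> neg_v = \<zero>\<^bsub>mid_grep\<^esub>"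
      using smult by (auto intro!: bexI[of _ "cst (- 1) * _"])
  qed (auto simp: add smult zero cst_simps distrib_left distrib_right add_ac mult.assoc)
  interpret V: vectorspace base_field mid_grep by (rule V)
  interpret S: vectorspace base_field "sym_power \<rho> 3 :: ('k, ('n, 'k) sym_alg, 'g) grep" by (rule vectorspace_sym_power)
  define T :: "('n, 'k) sym_alg \<Rightarrow> ('n, 'k) sym_alg" where
    "T P = cubic (Poly_Mapping.lookup P (mon 3 0)) (Poly_Mapping.lookup P (mon 2 (Suc 0)))
      (Poly_Mapping.lookup P (mon 2 (Suc 0))) (Poly_Mapping.lookup P (mon 0 3))" for P
  have T: "T (cubic a b c d) = cubic a b b d" for a b c d by (simp add: T_def lookup_cubic)
  have "T \<in> module_hom base_field (sym_power \<rho> 3) mid_grep"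
    by (auto simp: module_hom_def dest!: sym_homog_3) (auto simp: T cubic_add cst_cubic mid_cubics_def)
  then interpret T: linear_map base_field "sym_power \<rho> 3 :: ('k, ('n, 'k) sym_alg, 'g) grep" mid_grep T
    by (intro linear_map.intro mod_hom.intro mod_hom_axioms.intro V S.vectorspace_axioms vectorspace.axioms(1))
  have "T ` carrier (sym_power \<rho> 3) = carrier mid_grep"
  proof (intro equalityI subsetI)
    fix P assume "P \<in> carrier mid_grep"
    then obtain a b d where P: "P = cubic a b b d" by (auto simp: mid_cubics_def)
    then have "P = T P" by (simp add: T)
    then show "P \<in> T ` carrier (sym_power \<rho> 3)" using P cubic_homog by (metis image_eqI sym_power_simps(1))
  qed (auto dest!: sym_homog_3 simp: T mid_cubics_def)
  then have "V.fin_dim" by (rule T.surj_fin_dim[OF fin_dim_sym_power])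
  then show ?thesis
    unfolding is_fd_grep_def is_grep_def
    using V mid_cubics_subset by (auto simp: module_hom_def sym_act_add sym_act_mult act
      sym_act_group_mult[OF rep] sym_act_one[OF rep])
qed

text \<open>
  The quotient is the top degree of the coinvariant algebra: there \<open>x\<^sup>3 = y\<^sup>3 = 0\<close> and \<open>x\<^sup>2 y = x y\<^sup>2\<close>, so a
  cubic is determined by the sum of its middle coefficients.
\<close>

lemma K0_sym_3:
  "K0_class G (sym_power \<rho> 3) = K0_class G mid_grep \<otimes>\<^bsub>K0 G\<^esub> K0_class G (matrix_grep triv :: ('k, 'k^1, 'g) grep)"
proof (rule K0_class_exact[OF group_G])
  show "is_fd_grep G (matrix_grep triv :: ('k, 'k^1, 'g) grep)" "is_fd_grep G (sym_power \<rho> 3)" "is_fd_grep G mid_grep"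
    by (rule is_fd_grep_matrix_grep matrix_rep_triv group_G is_fd_grep_sym_power rep is_fd_grep_mid)+
  define h :: "('n, 'k) sym_alg \<Rightarrow> 'k^1" where
    "h P = (\<chi> _. Poly_Mapping.lookup P (mon 2 (Suc 0)) + Poly_Mapping.lookup P (mon (Suc 0) 2))" for P
  have h: "h (cubic a b c d) = (\<chi> _. b + c)" for a b c d by (simp add: h_def lookup_cubic)
  have act_h: "h (sym_act \<rho> g (cubic a b c d)) = h (cubic a b c d)" if "g \<in> carrier G" for g a b c d
    using cases6[OF that] by (auto simp: sym_act_cubic h add_ac)
  show "short_exact G mid_grep (sym_power \<rho> 3) (matrix_grep triv :: ('k, 'k^1, 'g) grep)"
    unfolding short_exact_def
  proof (intro bexI conjI)
    show "id \<in> grep_hom G mid_grep (sym_power \<rho> 3)"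
      using mid_cubics_subset by (auto simp: grep_hom_def module_hom_def)
    show "h \<in> grep_hom G (sym_power \<rho> 3) (matrix_grep triv)"
      by (auto simp: grep_hom_def module_hom_def dest!: sym_homog_3)
         (auto simp: act_h, auto simp: cubic_add cst_cubic h vec_eq_iff algebra_simps)
    show "inj_on id (carrier mid_grep)" by simp
    show "id ` carrier mid_grep = {v \<in> carrier (sym_power \<rho> 3). h v = \<zero>\<^bsub>matrix_grep triv\<^esub>}"
      by (auto simp: mid_cubics_def cubic_homog h vec_eq_iff add_eq_0_self dest!: sym_homog_3)
    have "v \<in> h ` sym_homog 3" for v
      by (rule image_eqI[OF _ cubic_homog[of 0 "v $ 1" 0 0]]) (simp add: h vec_eq_iff forall_1)
    then show "h ` carrier (sym_power \<rho> 3) = carrier (matrix_grep triv)" by auto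
  qed
qed

text \<open>
  The embedding multiplies a linear form by \<open>x\<^sup>2 + x y + y\<^sup>2\<close>.  The quotient is spanned by the class of
  \<open>x\<^sup>2 y + x y\<^sup>2\<close>, which is invariant.
\<close>

lemma K0_mid:
  "K0_class G mid_grep = K0_class G (matrix_grep \<rho>) \<otimes>\<^bsub>K0 G\<^esub> K0_class G (matrix_grep triv :: ('k, 'k^1, 'g) grep)"
proof (rule K0_class_exact[OF group_G])
  show "is_fd_grep G (matrix_grep triv :: ('k, 'k^1, 'g) grep)" "is_fd_grep G (matrix_grep \<rho>)" "is_fd_grep G mid_grep"
    by (rule is_fd_grep_matrix_grep matrix_rep_triv group_G rep is_fd_grep_mid)+
  define f :: "'k^'n \<Rightarrow> ('n, 'k) sym_alg" where "f v = cubic (v $ i) (v $ i + v $ j) (v $ i + v $ j) (v $ j)" for v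
  define h :: "('n, 'k) sym_alg \<Rightarrow> 'k^1" where
    "h P = (\<chi> _. Poly_Mapping.lookup P (mon 3 0) + Poly_Mapping.lookup P (mon 2 (Suc 0)) + Poly_Mapping.lookup P (mon 0 3))" for P
  have h: "h (cubic a b c d) = (\<chi> _. a + b + d)" for a b c d by (simp add: h_def lookup_cubic)
  have act_f: "sym_act \<rho> g (f v) = f (\<rho> g *v v)" if "g \<in> carrier G" for g v
    using cases6[OF that] by (auto simp: f_def sym_act_mid that mult_vec_ij add_ac)
  have act_h: "h (sym_act \<rho> g (cubic a b b d)) = h (cubic a b b d)" if "g \<in> carrier G" for g a b d
    using cases6[OF that] by (auto simp: sym_act_mid that h add_ac)
  show "short_exact G (matrix_grep \<rho>) mid_grep (matrix_grep triv :: ('k, 'k^1, 'g) grep)"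
    unfolding short_exact_def
  proof (intro bexI conjI)
    show "f \<in> grep_hom G (matrix_grep \<rho>) mid_grep"
      by (auto simp: grep_hom_def module_hom_def act_f)
         (auto simp: f_def mid_cubics_def cubic_add cst_cubic algebra_simps)
    show "h \<in> grep_hom G mid_grep (matrix_grep triv)"
      by (auto simp: grep_hom_def module_hom_def mid_cubics_def act_h)
         (auto simp: cubic_add cst_cubic h vec_eq_iff algebra_simps)
    show "inj_on f (carrier (matrix_grep \<rho>))" by (auto simp: inj_on_def f_def vec_eq_ij)
    show "f ` carrier (matrix_grep \<rho>) = {v \<in> carrier mid_grep. h v = \<zero>\<^bsub>matrix_grep triv\<^esub>}"
    proof (intro equalityI subsetI)
      fix P assume "P \<in> {v \<in> carrier mid_grep. h v = \<zero>\<^bsub>matrix_grep triv\<^esub>}"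
      then obtain a b d where P: "P = cubic a b b d" and "h P = 0" by (auto simp: mid_cubics_def)
      then have "b + (a + d) = 0" by (simp add: h vec_eq_iff add_ac)
      then have "P = f (vec2 a d)" using P by (simp add: f_def add_eq_0_self)
      then show "P \<in> f ` carrier (matrix_grep \<rho>)" by simp
    qed (auto simp: f_def mid_cubics_def h vec_eq_iff add_ac)
    have mem: "cubic a 0 0 0 \<in> mid_cubics" for a by (auto simp: mid_cubics_def)
    have "v \<in> h ` mid_cubics" for v
      by (rule image_eqI[OF _ mem[of "v $ 1"]]) (simp add: h vec_eq_iff forall_1)
    then show "h ` carrier mid_grep = carrier (matrix_grep triv)" by auto
  qed
qed

end

section \<open>Reflections in the special linear group\<close>

lemma matrix_diff_ldistrib: "A ** (B - C) = A ** B - A ** C" for A :: "'k::field^'n^'m"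
  by (simp add: matrix_matrix_mult_def vec_eq_iff right_diff_distrib sum_subtractf)

lemma matrix_diff_rdistrib: "(B - C) ** A = B ** A - C ** A" for A :: "'k::field^'n^'m"
  by (simp add: matrix_matrix_mult_def vec_eq_iff left_diff_distrib sum_subtractf)

lemma det_two:
  fixes A :: "'k::comm_ring_1^'n^'n"
  assumes ij: "i \<noteq> j" "(UNIV :: 'n set) = {i, j}"
  shows "det A = A $ i $ i * A $ j $ j - A $ i $ j * A $ j $ i"
proof -
  have f: "finite {j}" "i \<notin> {j}" using ij by auto
  show ?thesis
    unfolding det_def ij(2) sum_over_permutations_insert[OF f] permutes_sing
    using ij(1) by (simp add: sign_swap_id sign_id swap_id_eq)
qed

locale finite_SL =
  fixes F :: "'k::field set" and G :: "('k^'n^'n) monoid"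
  assumes subfield: "subfield F base_field" and finite_F: "finite F" and G_def: "G = SL F"
begin

lemma F_0: "0 \<in> F" and F_1: "1 \<in> F"
  and F_uminus: "a \<in> F \<Longrightarrow> - a \<in> F"
  and F_mult: "a \<in> F \<Longrightarrow> b \<in> F \<Longrightarrow> a * b \<in> F"
  and F_add: "a \<in> F \<Longrightarrow> b \<in> F \<Longrightarrow> a + b \<in> F"
  using subringE[OF subfieldE(1)[OF subfield]] by auto

lemma F_diff: "a \<in> F \<Longrightarrow> b \<in> F \<Longrightarrow> a - b \<in> F"
  using F_add[of a "- b"] F_uminus by simp

lemma F_inverse:
  assumes "a \<in> F"
  shows "inverse a \<in> F"
proof (cases "a = 0")
  case False
  then have "a \<in> F - {\<zero>\<^bsub>base_field\<^esub>}" using assms by simp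
  note inv = rta.subfield_m_inv[OF subfield this]
  from inv(2) have "a * inv\<^bsub>base_field\<^esub> a = 1" by simp
  then have "inv\<^bsub>base_field\<^esub> a = inverse a" using inverse_unique by metis
  then show ?thesis using inv(1) by simp
qed (use F_0 in simp)

lemma F_divide: "a \<in> F \<Longrightarrow> b \<in> F \<Longrightarrow> a / b \<in> F"
  by (simp add: divide_inverse F_mult F_inverse)

lemma F_sum: "(\<And>i. i \<in> A \<Longrightarrow> f i \<in> F) \<Longrightarrow> (\<Sum>i\<in>A. f i) \<in> F"
  by (induction A rule: infinite_finite_induct) (auto intro: F_0 F_add)

lemma F_prod: "(\<And>i. i \<in> A \<Longrightarrow> f i \<in> F) \<Longrightarrow> (\<Prod>i\<in>A. f i) \<in> F"
  by (induction A rule: infinite_finite_induct) (auto intro: F_1 F_mult)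

lemma det_F: "(\<And>i j. A $ i $ j \<in> F) \<Longrightarrow> det A \<in> F" for A :: "'k^'m^'m"
  unfolding det_def
proof (intro F_sum F_mult F_prod)
  fix p assume "\<And>i j. A $ i $ j \<in> F"
  show "of_int (sign p) \<in> F" by (cases p rule: sign_cases) (auto simp: F_1 F_uminus)
qed

lemma G_simps [simp]: "mult G = (**)" "one G = mat 1"
  by (simp_all add: G_def SL_def)

lemma carrier_G: "A \<in> carrier G \<longleftrightarrow> (\<forall>i j. A $ i $ j \<in> F) \<and> det A = 1"
  by (simp add: G_def SL_def)

lemma mult_G: "A \<in> carrier G \<Longrightarrow> B \<in> carrier G \<Longrightarrow> A ** B \<in> carrier G"
  by (simp add: carrier_G det_mul) (simp add: matrix_matrix_mult_def F_sum F_mult)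

lemma one_G: "mat 1 \<in> carrier G"
  unfolding carrier_G by (simp, simp add: mat_def F_0 F_1)

text \<open>
  By Cramer's rule the entries of the inverse are determinants of matrices over \<open>F\<close>.
\<close>

lemma inverse_G:
  assumes A: "A \<in> carrier G"
  shows "\<exists>B\<in>carrier G. B ** A = mat 1"
proof -
  have "det A \<noteq> 0" using A by (simp add: carrier_G)
  then obtain B where AB: "A ** B = mat 1" and BA: "B ** A = mat 1"
    using invertible_det_nz[of A] by (auto simp: invertible_def)
  have "B $ k $ j \<in> F" for k j
  proof -
    have "A *v (B *v axis j 1) = axis j 1" by (simp add: matrix_vector_mul_assoc AB)
    then have "B *v axis j 1 = (\<chi> k. det (\<chi> i l. if l = k then axis j 1 $ i else A $ i $ l) / det A)"
      using cramer[OF \<open>det A \<noteq> 0\<close>] by blast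
    then have "(B *v axis j 1) $ k = det (\<chi> i l. if l = k then axis j 1 $ i else A $ i $ l)"
      using A by (simp add: carrier_G)
    moreover have "det (\<chi> i l. if l = k then axis j 1 $ i else A $ i $ l) \<in> F"
      by (rule det_F) (use A F_0 F_1 in \<open>auto simp: carrier_G axis_def\<close>)
    ultimately show ?thesis by (simp add: matrix_axis_nth)
  qed
  moreover have "det B = 1"
  proof -
    have "det A * det B = 1" using AB by (simp add: det_mul[symmetric])
    then show ?thesis using A by (simp add: carrier_G)
  qed
  ultimately show ?thesis using BA by (auto simp: carrier_G)
qed

lemma group_G: "group G"
  by (rule groupI) (auto simp: mult_G one_G inverse_G matrix_mul_assoc)

sublocale group G by (rule group_G)

lemma matrix_rep_id: "matrix_rep G (\<lambda>g. g)"
  by (simp add: matrix_rep_def group_G)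

lemmas inv_simps = matrix_repD(4,5)[OF matrix_rep_id]

lemma finite_G: "finite (carrier G)"
proof -
  have "carrier G \<subseteq> (\<lambda>f. \<chi> i j. f i j) ` (PiE UNIV (\<lambda>_. PiE UNIV (\<lambda>_. F)))"
  proof
    fix A assume "A \<in> carrier G"
    then have "(\<lambda>i j. A $ i $ j) \<in> PiE UNIV (\<lambda>_. PiE UNIV (\<lambda>_. F))" by (auto simp: carrier_G)
    then show "A \<in> (\<lambda>f. \<chi> i j. f i j) ` (PiE UNIV (\<lambda>_. PiE UNIV (\<lambda>_. F)))"
      by (rule rev_image_eqI) (simp add: vec_eq_iff)
  qed
  then show ?thesis by (rule finite_subset) (intro finite_imageI finite_PiE finite_F; simp)
qed

abbreviation "R \<equiv> reflections G (\<lambda>g. g)"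

lemma R_carrier: "s \<in> R \<Longrightarrow> s \<in> carrier G" by (simp add: reflections_def)

lemma finite_R: "finite R"
  by (rule finite_subset[OF _ finite_G]) (auto simp: R_carrier)

lemma outer_mult_left: "A ** outer u a = outer (A *v u) a" for A :: "'k^'n^'n"
  by (simp add: outer_def matrix_matrix_mult_def matrix_vector_mult_def vec_eq_iff sum_distrib_right mult.assoc)

lemma outer_mult_right: "outer u a ** A = outer u (transpose A *v a)" for A :: "'k^'n^'n"
  by (simp add: outer_def matrix_matrix_mult_def matrix_vector_mult_def transpose_def vec_eq_iff
      sum_distrib_left mult_ac del: transpose_matrix_vector)

lemma G_mult_vec_eq_0: "g \<in> carrier G \<Longrightarrow> g *v v = 0 \<Longrightarrow> v = 0"
  using inv_simps(1)[of g] by (metis matrix_vector_mul_assoc matrix_vector_mul_lid matrix_vector_mult_0_right)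

lemma rank_1_conj:
  assumes g: "g \<in> carrier G" "h \<in> carrier G" and A: "rank A = 1"
  shows "rank (g ** A ** h) = 1"
proof -
  obtain u a where ua: "u \<noteq> 0" "a \<noteq> 0" "A = outer u a"
    using A unfolding rank_1_iff_outer by blast
  have "transpose h *v a \<noteq> 0"
  proof
    assume "transpose h *v a = 0"
    then have "transpose (inv\<^bsub>G\<^esub> h) *v (transpose h *v a) = 0" by simp
    then have "transpose (h ** inv\<^bsub>G\<^esub> h) *v a = 0"
      by (simp only: matrix_vector_mul_assoc matrix_transpose_mul)
    then show False using ua(2) g(2) inv_simps(2)[of h] by simp
  qed
  moreover have "g *v u \<noteq> 0" using G_mult_vec_eq_0[OF g(1)] ua(1) by blast
  ultimately show ?thesis
    unfolding rank_1_iff_outer ua(3) outer_mult_left outer_mult_right by blast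
qed

lemma one_minus_conj:
  assumes "g \<in> carrier G"
  shows "mat 1 - g ** s ** inv\<^bsub>G\<^esub> g = g ** (mat 1 - s) ** inv\<^bsub>G\<^esub> g"
  using inv_simps(2)[OF assms] by (simp add: matrix_diff_ldistrib matrix_diff_rdistrib)

lemma conj_R: "g \<in> carrier G \<Longrightarrow> s \<in> R \<Longrightarrow> g ** s ** inv\<^bsub>G\<^esub> g \<in> R"
  using rank_1_conj[of g "inv\<^bsub>G\<^esub> g" "mat 1 - s"]
  by (simp add: reflections_def mult_G one_minus_conj)

lemma inv_R: 
  assumes s: "s \<in> R"
  shows "inv\<^bsub>G\<^esub> s \<in> R"
proof -
  have sG: "s \<in> carrier G" using s by (rule R_carrier)
  have "mat 1 - inv\<^bsub>G\<^esub> s = (inv\<^bsub>G\<^esub> s ** (s - mat 1)) ** mat 1"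
    using inv_simps(1)[OF sG] by (simp add: matrix_diff_ldistrib)
  moreover have "rank (s - mat 1) = 1"
  proof -
    obtain u a where ua: "u \<noteq> 0" "a \<noteq> 0" "mat 1 - s = outer u a"
      using s unfolding reflections_def mem_Collect_eq rank_1_iff_outer by blast
    have "s - mat 1 = - (mat 1 - s)" by simp
    also have "\<dots> = outer (- u) a" by (simp add: ua(3) outer_def vec_eq_iff)
    finally show ?thesis using ua unfolding rank_1_iff_outer by (metis neg_equal_0_iff_equal)
  qed
  ultimately show ?thesis
    using rank_1_conj[OF inv_closed[OF sG] one_G, of "s - mat 1"] sG by (simp add: reflections_def)
qed


definition refl_sum :: "('k^'n^'n \<Rightarrow> 'k) \<Rightarrow> ('k^'n^'n) set \<Rightarrow> 'k^'n^'n" where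
  "refl_sum c S = (\<chi> a b. \<Sum>s\<in>S. c s * (mat 1 - s) $ a $ b)"

lemma refl_sum_nth: "refl_sum c S $ a $ b = (\<Sum>s\<in>S. c s * (mat 1 - s) $ a $ b)"
  by (simp add: refl_sum_def)

lemma mult_refl_sum: "(g ** refl_sum c S) $ a $ b = (\<Sum>s\<in>S. c s * (g ** (mat 1 - s)) $ a $ b)"
proof -
  have "(g ** refl_sum c S) $ a $ b = (\<Sum>k\<in>UNIV. \<Sum>s\<in>S. c s * (g $ a $ k * (mat 1 - s) $ k $ b))"
    by (simp add: matrix_matrix_mult_def refl_sum_nth sum_distrib_left mult_ac del: vector_minus_component)
  also have "\<dots> = (\<Sum>s\<in>S. c s * (g ** (mat 1 - s)) $ a $ b)"
    by (subst sum.swap) (simp add: matrix_matrix_mult_def sum_distrib_left del: vector_minus_component)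
  finally show ?thesis .
qed

lemma refl_sum_mult: "(refl_sum c S ** g) $ a $ b = (\<Sum>s\<in>S. c s * ((mat 1 - s) ** g) $ a $ b)"
proof -
  have "(refl_sum c S ** g) $ a $ b = (\<Sum>k\<in>UNIV. \<Sum>s\<in>S. c s * ((mat 1 - s) $ a $ k * g $ k $ b))"
    by (simp add: matrix_matrix_mult_def refl_sum_nth sum_distrib_right sum_distrib_left mult_ac del: vector_minus_component)
  also have "\<dots> = (\<Sum>s\<in>S. c s * ((mat 1 - s) ** g) $ a $ b)"
    by (subst sum.swap) (simp add: matrix_matrix_mult_def sum_distrib_left del: vector_minus_component)
  finally show ?thesis .
qed

lemma refl_sum_mult_vec: 
  assumes "\<And>s. s \<in> S \<Longrightarrow> s *v v = v"
  shows "refl_sum c S *v v = 0"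
proof -
  have "(refl_sum c S *v v) $ a = (\<Sum>k\<in>UNIV. \<Sum>s\<in>S. c s * ((mat 1 - s) $ a $ k * v $ k))" for a
    by (simp add: matrix_vector_mult_def refl_sum_nth sum_distrib_right sum_distrib_left mult_ac del: vector_minus_component)
  also have "\<dots> a = (\<Sum>s\<in>S. c s * ((mat 1 - s) *v v) $ a)" for a
    by (subst sum.swap) (simp add: matrix_vector_mult_def sum_distrib_left del: vector_minus_component)
  also have "\<dots> a = 0" for a
    using assms by (intro sum.neutral) (simp add: matrix_vector_mult_diff_rdistrib del: vector_minus_component)
  finally show ?thesis by (simp add: vec_eq_iff)
qed

text \<open>
  Conjugation by \<open>g\<close> permutes \<open>S\<close> and preserves \<open>c\<close>, so it preserves the sum.
\<close>

lemma refl_sum_commute: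
  assumes c: "conj_invariant G (\<lambda>g. g) c" and g: "g \<in> carrier G" and S: "S \<subseteq> R"
    and stable: "\<And>s. s \<in> S \<Longrightarrow> g ** s ** inv\<^bsub>G\<^esub> g \<in> S" "\<And>s. s \<in> S \<Longrightarrow> inv\<^bsub>G\<^esub> g ** s ** g \<in> S"
  shows "g ** refl_sum c S = refl_sum c S ** g"
proof -
  have bij: "bij_betw (\<lambda>s. g ** s ** inv\<^bsub>G\<^esub> g) S S"
  proof (rule bij_betw_byWitness[where f' = "\<lambda>s. inv\<^bsub>G\<^esub> g ** s ** g"])
    have "inv\<^bsub>G\<^esub> g ** (g ** s ** inv\<^bsub>G\<^esub> g) ** g = s" for s
    proof -
      have "inv\<^bsub>G\<^esub> g ** (g ** s ** inv\<^bsub>G\<^esub> g) ** g = (inv\<^bsub>G\<^esub> g ** g) ** s ** (inv\<^bsub>G\<^esub> g ** g)"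
        by (simp only: matrix_mul_assoc)
      then show ?thesis using inv_simps[OF g] by simp
    qed
    then show "\<forall>s\<in>S. inv\<^bsub>G\<^esub> g ** (g ** s ** inv\<^bsub>G\<^esub> g) ** g = s" by blast
    have "g ** (inv\<^bsub>G\<^esub> g ** s ** g) ** inv\<^bsub>G\<^esub> g = s" for s
    proof -
      have "g ** (inv\<^bsub>G\<^esub> g ** s ** g) ** inv\<^bsub>G\<^esub> g = (g ** inv\<^bsub>G\<^esub> g) ** s ** (g ** inv\<^bsub>G\<^esub> g)"
        by (simp only: matrix_mul_assoc)
      then show ?thesis using inv_simps[OF g] by simp
    qed
    then show "\<forall>s\<in>S. g ** (inv\<^bsub>G\<^esub> g ** s ** g) ** inv\<^bsub>G\<^esub> g = s" by blast
  qed (use stable in auto)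
  have "(g ** refl_sum c S) $ a $ b = (refl_sum c S ** g) $ a $ b" for a b
  proof -
    have "(g ** refl_sum c S) $ a $ b = (\<Sum>s\<in>S. c (g ** s ** inv\<^bsub>G\<^esub> g) * ((mat 1 - g ** s ** inv\<^bsub>G\<^esub> g) ** g) $ a $ b)"
      unfolding mult_refl_sum
    proof (rule sum.cong)
      fix s assume "s \<in> S"
      then have "c (g ** s ** inv\<^bsub>G\<^esub> g) = c s" using c g S by (auto simp: conj_invariant_def)
      moreover have "(mat 1 - g ** s ** inv\<^bsub>G\<^esub> g) ** g = g ** (mat 1 - s)"
        unfolding one_minus_conj[OF g] using inv_simps(1)[OF g] by (simp add: matrix_mul_assoc[symmetric])
      ultimately show "c s * (g ** (mat 1 - s)) $ a $ b
        = c (g ** s ** inv\<^bsub>G\<^esub> g) * ((mat 1 - g ** s ** inv\<^bsub>G\<^esub> g) ** g) $ a $ b" by simp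
    qed simp
    also have "\<dots> = (\<Sum>s\<in>S. c s * ((mat 1 - s) ** g) $ a $ b)"
      by (rule sum.reindex_bij_betw[OF bij])
    finally show ?thesis by (simp only: refl_sum_mult)
  qed
  then show ?thesis by (simp add: vec_eq_iff)
qed

definition fixed_space :: "'k^'n^'n \<Rightarrow> ('k^'n) set" where "fixed_space s = {v. s *v v = v}"

definition refl_fixing :: "('k^'n) set \<Rightarrow> ('k^'n^'n) set" where "refl_fixing H = {s \<in> R. fixed_space s = H}"

lemma refl_sum_partition:
  assumes "\<And>H. H \<in> fixed_space ` R \<Longrightarrow> refl_sum c (refl_fixing H) = 0"
  shows "refl_sum c R = 0"
proof -
  have "refl_sum c R $ a $ b = (\<Sum>H\<in>fixed_space ` R. refl_sum c (refl_fixing H) $ a $ b)" for a b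
    unfolding refl_sum_nth refl_fixing_def by (rule sum.image_gen[OF finite_R])
  then show ?thesis using assms by (simp add: vec_eq_iff)
qed

lemma fixed_space_conj:
  assumes g: "g \<in> carrier G" and H: "\<And>v. g *v v \<in> fixed_space s \<longleftrightarrow> v \<in> fixed_space s"
  shows "fixed_space (g ** s ** inv\<^bsub>G\<^esub> g) = fixed_space s" "fixed_space (inv\<^bsub>G\<^esub> g ** s ** g) = fixed_space s"
proof -
  have gi: "g *v (inv\<^bsub>G\<^esub> g *v v) = v" "inv\<^bsub>G\<^esub> g *v (g *v v) = v" for v
    using inv_simps[OF g] by (simp_all add: matrix_vector_mul_assoc)
  have "v \<in> fixed_space (g ** s ** inv\<^bsub>G\<^esub> g) \<longleftrightarrow> inv\<^bsub>G\<^esub> g *v v \<in> fixed_space s" for v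
    unfolding fixed_space_def mem_Collect_eq matrix_vector_mul_assoc[symmetric] by (metis gi)
  then show "fixed_space (g ** s ** inv\<^bsub>G\<^esub> g) = fixed_space s" using H gi by (metis Set.set_eqI)
  have "v \<in> fixed_space (inv\<^bsub>G\<^esub> g ** s ** g) \<longleftrightarrow> g *v v \<in> fixed_space s" for v
    unfolding fixed_space_def mem_Collect_eq matrix_vector_mul_assoc[symmetric] by (metis gi)
  then show "fixed_space (inv\<^bsub>G\<^esub> g ** s ** g) = fixed_space s" using H by (metis Set.set_eqI)
qed

lemma refl_sum_hyp_commute:
  assumes c: "conj_invariant G (\<lambda>g. g) c" and g: "g \<in> carrier G"
    and H: "\<And>v. g *v v \<in> H \<longleftrightarrow> v \<in> H"
  shows "g ** refl_sum c (refl_fixing H) = refl_sum c (refl_fixing H) ** g"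
proof (rule refl_sum_commute[OF c g])
  fix s assume s: "s \<in> refl_fixing H"
  then have sR: "s \<in> R" and sH: "fixed_space s = H" by (auto simp: refl_fixing_def)
  show "g ** s ** inv\<^bsub>G\<^esub> g \<in> refl_fixing H"
    using conj_R[OF g sR] fixed_space_conj(1)[OF g, of s] H by (simp add: refl_fixing_def sH)
  show "inv\<^bsub>G\<^esub> g ** s ** g \<in> refl_fixing H"
    using conj_R[OF inv_closed[OF g] sR] fixed_space_conj(2)[OF g, of s] H g by (simp add: refl_fixing_def sH)
qed (auto simp: refl_fixing_def)

definition elem :: "'n \<Rightarrow> 'n \<Rightarrow> 'k \<Rightarrow> 'k^'n^'n" where
  "elem l i x = (\<chi> a b. (if a = b then 1 else 0) + (if a = l \<and> b = i then x else 0))"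

lemma elem_mult: "(elem l i x ** A) $ a $ b = A $ a $ b + (if a = l then x * A $ i $ b else 0)"
proof -
  have "(elem l i x ** A) $ a $ b = (\<Sum>k\<in>UNIV. (if a = k then A $ k $ b else 0)
      + (if k = i then (if a = l then x * A $ k $ b else 0) else 0))"
    unfolding matrix_matrix_mult_def elem_def by (simp, intro sum.cong) (auto simp: algebra_simps)
  then show ?thesis by (simp add: sum.distrib)
qed

lemma mult_elem: "(A ** elem l i x) $ a $ b = A $ a $ b + (if b = i then A $ a $ l * x else 0)"
proof -
  have "(A ** elem l i x) $ a $ b = (\<Sum>k\<in>UNIV. (if k = b then A $ a $ k else 0)
      + (if k = l then (if b = i then A $ a $ k * x else 0) else 0))"
    unfolding matrix_matrix_mult_def elem_def by (simp, intro sum.cong) (auto simp: algebra_simps)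
  then show ?thesis by (simp add: sum.distrib)
qed

lemma elem_mult_vec: "(elem l i x *v v) $ a = v $ a + (if a = l then x * v $ i else 0)"
proof -
  have "(elem l i x *v v) $ a = (\<Sum>k\<in>UNIV. (if a = k then v $ k else 0)
      + (if k = i then (if a = l then x * v $ k else 0) else 0))"
    unfolding matrix_vector_mult_def elem_def by (simp, intro sum.cong) (auto simp: algebra_simps)
  then show ?thesis by (simp add: sum.distrib)
qed

lemma elem_G: "l \<noteq> i \<Longrightarrow> x \<in> F \<Longrightarrow> elem l i x \<in> carrier G"
proof -
  assume li: "l \<noteq> i" and x: "x \<in> F"
  have "elem l i x = (\<chi> k. if k = l then row l (mat 1) + x *s row i (mat 1) else row k (mat 1))"
    using li by (auto simp: elem_def row_def mat_def vec_eq_iff)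
  then have "det (elem l i x) = 1" using det_row_operation[OF li, of "mat 1" x] by simp
  then show ?thesis using x by (auto simp: carrier_G elem_def intro: F_add F_0 F_1)
qed

text \<open>
  The rows of \<open>1 - s\<close> are multiples of one equation \<open>\<beta>\<close> of the fixed hyperplane.  Choosing for \<open>\<beta>\<close> one of
  these rows keeps its coefficients in \<open>F\<close>.
\<close>

lemma reflection_row:
  assumes s: "s \<in> R"
  obtains \<beta> where "\<beta> \<noteq> 0" "\<And>b. \<beta> $ b \<in> F" "\<And>v. s *v v = v \<longleftrightarrow> (\<Sum>b\<in>UNIV. \<beta> $ b * v $ b) = 0"
    "\<And>a. \<exists>u. row a (mat 1 - s) = u *s \<beta>"
proof -
  obtain u a where ua: "u \<noteq> 0" "a \<noteq> 0" "mat 1 - s = outer u a"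
    using s unfolding reflections_def mem_Collect_eq rank_1_iff_outer by blast
  obtain k where k: "u $ k \<noteq> 0" using ua(1) by (auto simp: vec_eq_iff)
  define \<beta> where "\<beta> = u $ k *s a"
  have "\<beta> \<noteq> 0" using k ua(2) by (simp add: \<beta>_def)
  moreover have "\<beta> $ b \<in> F" for b
  proof -
    have "\<beta> $ b = (mat 1 - s) $ k $ b" by (simp only: ua(3)) (simp add: \<beta>_def outer_def)
    then show ?thesis using R_carrier[OF s] by (simp add: carrier_G mat_def F_0 F_1 F_diff)
  qed
  moreover have "s *v v = v \<longleftrightarrow> (\<Sum>b\<in>UNIV. \<beta> $ b * v $ b) = 0" for v
  proof -
    have "s *v v = v \<longleftrightarrow> (mat 1 - s) *v v = 0" by (auto simp: matrix_vector_mult_diff_rdistrib)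
    also have "\<dots> \<longleftrightarrow> (\<forall>l. u $ l * (\<Sum>b\<in>UNIV. a $ b * v $ b) = 0)"
      by (simp add: ua(3) outer_def matrix_vector_mult_def vec_eq_iff sum_distrib_left mult.assoc)
    also have "\<dots> \<longleftrightarrow> (\<Sum>b\<in>UNIV. \<beta> $ b * v $ b) = 0"
      using k by (auto simp: \<beta>_def sum_distrib_left[symmetric] mult.assoc)
    finally show ?thesis .
  qed
  moreover have "\<exists>w. row l (mat 1 - s) = w *s \<beta>" for l
    by (rule exI[of _ "u $ l / u $ k"]) (use k in \<open>simp add: ua(3) outer_def row_def \<beta>_def vec_eq_iff\<close>)
  ultimately show ?thesis by (rule that)
qed

text \<open>
  Let \<open>N\<close> be the part of the sum for the hyperplane \<open>H\<close>, so that \<open>N\<close> kills \<open>H\<close>.  For a nonzero \<open>v\<close> in \<open>H\<close> with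
  \<open>v\<^sub>i = 0\<close>, the transvection \<open>g w = w + w\<^sub>i v\<close> preserves \<open>H\<close> and hence commutes with \<open>N\<close>.  Then
  \<open>w\<^sub>i N v = (N w)\<^sub>i v\<close> for all \<open>w\<close>, and since \<open>N v = 0\<close>, row \<open>i\<close> of \<open>N\<close> is zero.  For \<open>n \<ge> 3\<close> such a \<open>v\<close>
  exists for every \<open>i\<close>, because \<open>H\<close> and \<open>w\<^sub>i = 0\<close> intersect nontrivially.
\<close>

lemma refl_sum_zero_3:
  assumes c: "conj_invariant G (\<lambda>g. g) c" and n: "CARD('n) \<ge> 3"
  shows "refl_sum c R = 0"
proof (rule refl_sum_partition)
  fix H assume "H \<in> fixed_space ` R"
  then obtain s0 where s0: "s0 \<in> R" "H = fixed_space s0" by blast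
  obtain \<beta> where \<beta>: "\<And>b. \<beta> $ b \<in> F" "\<And>v. s0 *v v = v \<longleftrightarrow> (\<Sum>b\<in>UNIV. \<beta> $ b * v $ b) = 0"
    using reflection_row[OF s0(1)] by metis
  have H: "v \<in> H \<longleftrightarrow> (\<Sum>b\<in>UNIV. \<beta> $ b * v $ b) = 0" for v
    by (simp add: s0(2) fixed_space_def \<beta>(2))
  let ?N = "refl_sum c (refl_fixing H)"
  have NH: "?N *v v = 0" if "v \<in> H" for v
    using that by (intro refl_sum_mult_vec) (auto simp: refl_fixing_def fixed_space_def)
  have row: "?N $ i $ b = 0" for i b
  proof -
    have "card (UNIV - {i}) \<ge> 2" using n by (simp add: card_Diff_singleton)
    then obtain j k where jk: "j \<noteq> i" "k \<noteq> i" "j \<noteq> k"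
      using card_le_Suc0_iff_eq[of "UNIV - {i}"] by (auto simp: not_less_eq_eq[symmetric] numeral_2_eq_2)
    obtain x y where xy: "x \<in> F" "y \<in> F" "x \<noteq> 0 \<or> y \<noteq> 0" "\<beta> $ j * x + \<beta> $ k * y = 0"
    proof (cases "\<beta> $ j = 0 \<and> \<beta> $ k = 0")
      case True then show ?thesis using that[of 1 0] F_0 F_1 by simp
    next
      case False then show ?thesis using that[of "\<beta> $ k" "- \<beta> $ j"] \<beta>(1) F_uminus by auto
    qed
    \<comment> \<open>the transvection along \<open>v\<close>, as a product of two elementary matrices of determinant 1\<close>
    define g where "g = elem j i x ** elem k i y"
    define v :: "'k^'n" where "v = (\<chi> a. if a = j then x else if a = k then y else 0)"
    have g: "g \<in> carrier G" unfolding g_def using jk xy by (intro mult_G elem_G) auto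
    have gv: "g *v w = w + w $ i *s v" for w
      unfolding g_def using jk by (simp add: matrix_vector_mul_assoc[symmetric] vec_eq_iff elem_mult_vec v_def)
    have "(\<Sum>b\<in>UNIV. \<beta> $ b * v $ b) = (\<Sum>b\<in>{j, k}. \<beta> $ b * v $ b)"
      by (rule sum.mono_neutral_right) (auto simp: v_def)
    then have v: "v \<in> H" using jk xy(4) by (simp add: H v_def)
    have "g *v w \<in> H \<longleftrightarrow> w \<in> H" for w
    proof -
      have "(\<Sum>b\<in>UNIV. \<beta> $ b * (w + w $ i *s v) $ b) = (\<Sum>b\<in>UNIV. \<beta> $ b * w $ b) + w $ i * (\<Sum>b\<in>UNIV. \<beta> $ b * v $ b)"
        by (simp add: distrib_left sum.distrib sum_distrib_left mult_ac)
      then show ?thesis using v by (simp add: gv H)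
    qed
    then have comm: "g ** ?N = ?N ** g" by (rule refl_sum_hyp_commute[OF c g])
    have *: "v $ a * ?N $ i $ b = 0" for a
    proof -
      have "(g ** ?N) *v axis b 1 = ?N *v (g *v axis b 1)"
        by (simp add: comm matrix_vector_mul_assoc)
      then have "g *v (?N *v axis b 1) = ?N *v axis b 1 + axis b 1 $ i *s (?N *v v)"
        by (simp add: matrix_vector_mul_assoc[symmetric] gv matrix_vector_right_distrib vector_scalar_commute)
      then have "(?N *v axis b 1) $ i *s v = 0" by (simp add: gv NH[OF v])
      then show ?thesis by (auto simp: vec_eq_iff matrix_axis_nth)
    qed
    show ?thesis using *[of j] *[of k] jk xy(3) by (auto simp: v_def)
  qed
  show "?N = 0" by (simp add: vec_eq_iff row)
qed

lemma conj_invariant_refl_sum_commute: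
  assumes c: "conj_invariant G (\<lambda>g. g) c" and g: "g \<in> carrier G"
  shows "g ** refl_sum c R = refl_sum c R ** g"
proof (rule refl_sum_commute[OF c g subset_refl])
  show "g ** s ** inv\<^bsub>G\<^esub> g \<in> R" if "s \<in> R" for s by (rule conj_R[OF g that])
  show "inv\<^bsub>G\<^esub> g ** s ** g \<in> R" if "s \<in> R" for s
    using conj_R[OF inv_closed[OF g] that] g by simp
qed

text \<open>
  A matrix \<open>1 - s\<close> of rank 1 has \<open>det s = 1 - tr (1 - s)\<close>, so a reflection of determinant 1 is a
  transvection.
\<close>

lemma trace_reflection:
  assumes ij: "i \<noteq> j" "(UNIV :: 'n set) = {i, j}" and sR: "s \<in> R"
  shows "(mat 1 - s) $ i $ i + (mat 1 - s) $ j $ j = 0"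
proof -
  obtain u a where ua: "mat 1 - s = outer u a"
    using sR unfolding reflections_def mem_Collect_eq rank_1_iff_outer by blast
  have e: "(mat 1 - s) $ k $ l = u $ k * a $ l" for k l by (simp only: ua) (simp add: outer_def)
  have "det s = 1" using R_carrier[OF sR] by (simp add: carrier_G)
  then have "s $ i $ i * s $ j $ j - s $ i $ j * s $ j $ i = 1" by (simp add: det_two[OF ij])
  moreover have "s $ i $ i = 1 - u $ i * a $ i" "s $ j $ j = 1 - u $ j * a $ j"
    "s $ i $ j = - (u $ i * a $ j)" "s $ j $ i = - (u $ j * a $ i)"
  proof -
    have "s $ k $ l = mat 1 $ k $ l - u $ k * a $ l" for k l
      using e[of k l] by (simp add: algebra_simps)
    then show "s $ i $ i = 1 - u $ i * a $ i" "s $ j $ j = 1 - u $ j * a $ j"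
      "s $ i $ j = - (u $ i * a $ j)" "s $ j $ i = - (u $ j * a $ i)"
      using ij(1) by (simp_all add: mat_def)
  qed
  ultimately have "u $ i * a $ i + u $ j * a $ j = 0" by (simp add: algebra_simps)
  then show ?thesis by (simp only: e)
qed

lemma trace_refl_sum:
  assumes ij: "i \<noteq> j" "(UNIV :: 'n set) = {i, j}" and S: "S \<subseteq> R"
  shows "refl_sum c S $ i $ i + refl_sum c S $ j $ j = 0"
proof -
  have "refl_sum c S $ i $ i + refl_sum c S $ j $ j = (\<Sum>s\<in>S. c s * ((mat 1 - s) $ i $ i + (mat 1 - s) $ j $ j))"
    by (simp only: refl_sum_nth sum.distrib[symmetric] distrib_left)
  also have "\<dots> = 0" by (intro sum.neutral ballI) (use trace_reflection[OF ij] S in \<open>simp only: subsetD mult_zero_right\<close>)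
  finally show ?thesis .
qed

text \<open>
  The sum commutes with both elementary matrices, hence is scalar, and it has trace zero.
\<close>

lemma refl_sum_zero_2_odd:
  assumes c: "conj_invariant G (\<lambda>g. g) c" and ij: "i \<noteq> j" "(UNIV :: 'n set) = {i, j}"
    and "(2 :: 'k) \<noteq> 0"
  shows "refl_sum c R = 0"
proof -
  let ?N = "refl_sum c R"
  have "(elem i j 1 ** ?N) $ a $ b = (?N ** elem i j 1) $ a $ b"
    "(elem j i 1 ** ?N) $ a $ b = (?N ** elem j i 1) $ a $ b" for a b
    using conj_invariant_refl_sum_commute[OF c elem_G[OF ij(1) F_1]]
      conj_invariant_refl_sum_commute[OF c elem_G[OF ij(1)[symmetric] F_1]] by simp_all
  from this(1)[of i i] this(1)[of i j] this(2)[of j j] ij(1)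
  have N: "?N $ j $ i = 0" "?N $ j $ j = ?N $ i $ i" "?N $ i $ j = 0"
    by (simp_all add: elem_mult mult_elem)
  have "2 * ?N $ i $ i = 0" using trace_refl_sum[OF ij subset_refl, of c] by (simp add: N)
  then have "?N $ i $ i = 0" using assms(4) by simp
  then have "?N $ a $ b = 0" for a b using N ij(2) by (metis UNIV_I insert_iff singletonD)
  then show ?thesis by (simp add: vec_eq_iff)
qed

text \<open>
  Let \<open>g\<close> have eigenvalue \<open>t\<close> on the fixed line \<open>H\<close> and \<open>t\<^sup>-\<^sup>1\<close> on a complement.  The part \<open>N\<close> of the
  sum for \<open>H\<close> maps the complement to \<open>H\<close> and \<open>H\<close> to zero, so \<open>g N g\<^sup>-\<^sup>1 = t\<^sup>2 N\<close>; but \<open>g\<close> commutes with \<open>N\<close>.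
\<close>

lemma refl_sum_zero_2_square:
  assumes c: "conj_invariant G (\<lambda>g. g) c" and ij: "i \<noteq> j" "(UNIV :: 'n set) = {i, j}"
    and t: "t \<in> F" "t \<noteq> 0" "t * t \<noteq> 1"
  shows "refl_sum c R = 0"
proof (rule refl_sum_partition)
  fix H assume "H \<in> fixed_space ` R"
  then obtain s0 where s0: "s0 \<in> R" "H = fixed_space s0" by blast
  obtain \<beta> where \<beta>: "\<beta> \<noteq> 0" "\<And>b. \<beta> $ b \<in> F" "\<And>v. s0 *v v = v \<longleftrightarrow> (\<Sum>b\<in>UNIV. \<beta> $ b * v $ b) = 0"
    using reflection_row[OF s0(1)] by metis
  have sum_ij: "(\<Sum>l\<in>UNIV. f l) = f i + f j" for f :: "'n \<Rightarrow> 'k"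
    unfolding ij(2) using ij(1) by simp
  have all_ij: "Q l" if "Q i" "Q j" for Q and l :: 'n
    using that ij(2) by (metis UNIV_I insert_iff singletonD)
  have H: "v \<in> H \<longleftrightarrow> \<beta> $ i * v $ i + \<beta> $ j * v $ j = 0" for v
    by (simp add: s0(2) fixed_space_def \<beta>(3) sum_ij)
  define N where "N = refl_sum c (refl_fixing H)"
  have NH: "N $ a $ i * v $ i + N $ a $ j * v $ j = 0" if "v \<in> H" for v a
  proof -
    have "N *v v = 0" unfolding N_def using that by (intro refl_sum_mult_vec) (auto simp: refl_fixing_def fixed_space_def)
    then have "(N *v v) $ a = 0" by simp
    then show ?thesis by (simp only: matrix_vector_mult_def vec_lambda_beta sum_ij)
  qed
  have trace: "N $ i $ i + N $ j $ j = 0"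
    unfolding N_def by (rule trace_refl_sum[OF ij]) (auto simp: refl_fixing_def)
  have tt: "t \<noteq> inverse t" using t(2,3) by (metis right_inverse)
  have comm: "(g ** N) $ a $ b = (N ** g) $ a $ b" if "g \<in> carrier G" "\<And>v. g *v v \<in> H \<longleftrightarrow> v \<in> H" for g a b
    unfolding N_def using refl_sum_hyp_commute[OF c that] by simp
  have mm: "(A ** B) $ a $ b = A $ a $ i * B $ i $ b + A $ a $ j * B $ j $ b" for A B :: "'k^'n^'n" and a b
    by (simp add: matrix_matrix_mult_def sum_ij)
  have mv: "(A *v v) $ a = A $ a $ i * v $ i + A $ a $ j * v $ j" for A :: "'k^'n^'n" and v a
    by (simp add: matrix_vector_mult_def sum_ij)
  have "N $ i $ i = 0 \<and> N $ i $ j = 0 \<and> N $ j $ i = 0 \<and> N $ j $ j = 0"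
  proof (cases "\<beta> $ j = 0")
    case True
    then have bi: "\<beta> $ i \<noteq> 0" using \<beta>(1) all_ij[of "\<lambda>l. \<beta> $ l = 0"] by (auto simp: vec_eq_iff)
    define g :: "'k^'n^'n" where
      "g = (\<chi> a b. if a \<noteq> b then 0 else if a = i then inverse t else t)"
    have ge: "g $ i $ i = inverse t" "g $ i $ j = 0" "g $ j $ i = 0" "g $ j $ j = t"
      using ij(1) by (simp_all add: g_def)
    have gG: "g \<in> carrier G"
      unfolding carrier_G using t ge by (simp add: det_two[OF ij]) (simp add: g_def F_0 F_inverse)
    have gH: "g *v v \<in> H \<longleftrightarrow> v \<in> H" for v using bi t(2) by (simp add: H True mv ge)
    have "N $ a $ j = 0" for a using NH[of "axis j 1" a] ij(1) True by (simp add: H axis_def)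
    moreover have "t * N $ j $ i = inverse t * N $ j $ i"
      using comm[OF gG gH, of j i] by (simp add: mm ge mult.commute)
    ultimately show ?thesis using trace tt by simp
  next
    case False
    define m where "m = - \<beta> $ i / \<beta> $ j"
    have m: "m \<in> F" unfolding m_def by (intro F_divide F_uminus \<beta>(2))
    have Hm: "v \<in> H \<longleftrightarrow> v $ j = m * v $ i" for v
      using False by (simp add: H m_def field_simps eq_neg_iff_add_eq_0 add.commute)
    define g :: "'k^'n^'n" where
      "g = (\<chi> a b. if a = i then (if b = i then t else 0) else if b = i then (t - inverse t) * m else inverse t)"
    have ge: "g $ i $ i = t" "g $ i $ j = 0" "g $ j $ i = (t - inverse t) * m" "g $ j $ j = inverse t"
      using ij(1) by (simp_all add: g_def)
    have gG: "g \<in> carrier G"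
      unfolding carrier_G using t m ge
      by (simp add: det_two[OF ij]) (simp add: g_def F_0 F_inverse F_mult F_diff)
    have gH: "g *v v \<in> H \<longleftrightarrow> v \<in> H" for v
    proof -
      have "g *v v \<in> H \<longleftrightarrow> inverse t * (v $ j - m * v $ i) = 0"
        by (simp add: Hm mv ge algebra_simps)
      then show ?thesis using t(2) by (simp add: Hm)
    qed
    have Nm: "N $ a $ i + N $ a $ j * m = 0" for a
      using NH[of "\<chi> l. if l = i then 1 else m" a] ij(1) by (simp add: Hm)
    have "t * N $ i $ j = inverse t * N $ i $ j"
      using comm[OF gG gH, of i j] by (simp add: mm ge mult.commute)
    then have "N $ i $ j = 0" using tt by simp
    then show ?thesis using Nm[of i] Nm[of j] trace by simp
  qed
  then have "N $ a $ b = 0" for a b using ij(2) by (metis UNIV_I insert_iff singletonD)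
  then show "refl_sum c (refl_fixing H) = 0" by (simp add: N_def[symmetric] vec_eq_iff)
qed

text \<open>
  In characteristic 2 only \<open>t = 1\<close> has \<open>t\<^sup>2 = 1\<close>, so any element of \<open>F\<close> other than 0 and 1 will do.
\<close>

theorem refl_sum_zero:
  assumes c: "conj_invariant G (\<lambda>g. g) c" and n: "CARD('n) \<ge> 2" and ne: "(card F, CARD('n)) \<noteq> (2, 2)"
  shows "refl_sum c R = 0"
proof (cases "CARD('n) = 2")
  case False
  then show ?thesis using n by (intro refl_sum_zero_3[OF c]) simp
next
  case True
  then obtain i j :: 'n where ij: "i \<noteq> j" "(UNIV :: 'n set) = {i, j}" by (auto simp: card_2_iff)
  show ?thesis
  proof (cases "(2 :: 'k) = 0")
    case False
    then show ?thesis by (rule refl_sum_zero_2_odd[OF c ij])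
  next
    case char2: True
    have "card {0, 1 :: 'k} = 2" by simp
    then have "F \<noteq> {0, 1}" using ne True by auto
    then obtain t where t: "t \<in> F" "t \<noteq> 0" "t \<noteq> 1" using F_0 F_1 by blast
    have "t * t \<noteq> 1"
    proof
      assume "t * t = 1"
      then have "(t - 1) * (t - 1) = 2 * (1 - t)" by (simp add: algebra_simps)
      then show False using char2 t(3) by simp
    qed
    then show ?thesis by (rule refl_sum_zero_2_square[OF c ij t(1,2)])
  qed
qed

lemma conj_invariant_conj_param:
  assumes c: "conj_invariant G (\<lambda>g. g) c"
  shows "conj_invariant G (\<lambda>g. g) (conj_param G c)"
  unfolding conj_invariant_def
proof (intro ballI)
  fix s g assume s: "s \<in> R" and g: "g \<in> carrier G"
  have "inv\<^bsub>G\<^esub> (g \<otimes>\<^bsub>G\<^esub> s \<otimes>\<^bsub>G\<^esub> inv\<^bsub>G\<^esub> g) = g \<otimes>\<^bsub>G\<^esub> inv\<^bsub>G\<^esub> s \<otimes>\<^bsub>G\<^esub> inv\<^bsub>G\<^esub> g"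
    using g R_carrier[OF s] by (simp add: inv_mult_group m_assoc del: G_simps)
  then show "conj_param G c (g \<otimes>\<^bsub>G\<^esub> s \<otimes>\<^bsub>G\<^esub> inv\<^bsub>G\<^esub> g) = conj_param G c s"
    using c inv_R[OF s] g by (simp add: conj_param_def conj_invariant_def del: G_simps)
qed

text \<open>
  The relations involve \<open>s\<close> through its dual, the transpose of the inverse; hence the parameter
  \<open>s \<mapsto> c (s\<^sup>-\<^sup>1)\<close>.
\<close>

lemma commutator_sum_zero:
  assumes "refl_sum (conj_param G c) R = 0"
  shows "(\<Sum>s\<in>R. c s * pairing y (x - dual_rep G (\<lambda>g. g) s *v x)) = 0"
proof -
  have p: "pairing y (x - dual_rep G (\<lambda>g. g) s *v x) = (\<Sum>a\<in>UNIV. \<Sum>b\<in>UNIV. x $ a * ((mat 1 - inv\<^bsub>G\<^esub> s) $ a $ b * y $ b))"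
    for s
  proof -
    have "pairing y (x - dual_rep G (\<lambda>g. g) s *v x) = pairing x ((mat 1 - inv\<^bsub>G\<^esub> s) *v y)"
      unfolding dual_rep_def pairing_diff pairing_transpose matrix_vector_mult_diff_rdistrib
      by (simp add: pairing_commute)
    then show ?thesis
      by (simp add: pairing_def matrix_vector_mult_def sum_distrib_left del: vector_minus_component)
  qed
  have bij: "bij_betw (\<lambda>s. inv\<^bsub>G\<^esub> s) R R"
    by (rule bij_betw_byWitness[where f' = "\<lambda>s. inv\<^bsub>G\<^esub> s"]) (auto simp: R_carrier inv_R)
  have "(\<Sum>s\<in>R. c s * (mat 1 - inv\<^bsub>G\<^esub> s) $ a $ b) = refl_sum (conj_param G c) R $ a $ b" for a b
    unfolding refl_sum_nth sum.reindex_bij_betw[OF bij, symmetric, of "\<lambda>s. conj_param G c s * (mat 1 - s) $ a $ b"]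
    by (rule sum.cong) (auto simp: conj_param_def R_carrier)
  then have z: "(\<Sum>s\<in>R. c s * (mat 1 - inv\<^bsub>G\<^esub> s) $ a $ b) = 0" for a b by (simp add: assms)
  have "(\<Sum>s\<in>R. c s * pairing y (x - dual_rep G (\<lambda>g. g) s *v x))
    = (\<Sum>s\<in>R. \<Sum>a\<in>UNIV. \<Sum>b\<in>UNIV. x $ a * y $ b * (c s * (mat 1 - inv\<^bsub>G\<^esub> s) $ a $ b))"
    by (simp only: p sum_distrib_left mult_ac)
  also have "\<dots> = (\<Sum>a\<in>UNIV. \<Sum>b\<in>UNIV. x $ a * y $ b * (\<Sum>s\<in>R. c s * (mat 1 - inv\<^bsub>G\<^esub> s) $ a $ b))"
    by (subst sum.swap, rule sum.cong[OF refl], subst sum.swap) (simp only: sum_distrib_left)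
  also have "\<dots> = 0" by (simp only: z mult_zero_right sum.neutral_const)
  finally show ?thesis .
qed

end

section \<open>The graded pieces as representations\<close>

lemma (in lowest_weight_rep) irr_piece_iso:
  fixes W :: "('k, 'w, 'g) grep"
  assumes W: "is_fd_grep G W" and bij: "bij_betw h (comp i) (carrier W)"
    and h_add: "\<And>u v. u \<in> comp i \<Longrightarrow> v \<in> comp i \<Longrightarrow> h (u + v) = h u \<oplus>\<^bsub>W\<^esub> h v"
    and h_0: "h 0 = \<zero>\<^bsub>W\<^esub>"
    and h_scal: "\<And>r u. u \<in> comp i \<Longrightarrow> h (scal r u) = r \<odot>\<^bsub>W\<^esub> h u"
    and h_act: "\<And>g u. g \<in> carrier G \<Longrightarrow> u \<in> comp i \<Longrightarrow> h (Gop g u) = act W g (h u)"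
  shows "is_fd_grep G (irr_piece G \<rho> t c triv i)"
    and "irr_char G \<rho> t c triv i = K0_class G W"
    and "irr_hilb G \<rho> t c triv i = vectorspace.dim base_field W"
proof -
  let ?P = "irr_piece G \<rho> t c triv i"
  obtain f where f: "bij_betw f (carrier ?P) (comp i)"
    "\<And>a b. a \<in> carrier ?P \<Longrightarrow> b \<in> carrier ?P \<Longrightarrow> a \<oplus>\<^bsub>?P\<^esub> b \<in> carrier ?P \<and> f (a \<oplus>\<^bsub>?P\<^esub> b) = f a + f b"
    "\<zero>\<^bsub>?P\<^esub> \<in> carrier ?P \<and> f \<zero>\<^bsub>?P\<^esub> = 0"
    "\<And>r a. a \<in> carrier ?P \<Longrightarrow> r \<odot>\<^bsub>?P\<^esub> a \<in> carrier ?P \<and> f (r \<odot>\<^bsub>?P\<^esub> a) = scal r (f a)"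
    "\<And>g a. g \<in> carrier G \<Longrightarrow> a \<in> carrier ?P \<Longrightarrow> act ?P g a \<in> carrier ?P \<and> f (act ?P g a) = Gop g (f a)"
    by (rule irr_piece_model[of i]) blast
  have fc: "a \<in> carrier ?P \<Longrightarrow> f a \<in> comp i" for a using f(1) by (auto simp: bij_betw_def)
  have tr: "grep_transport G (h \<circ> f) ?P W"
    unfolding grep_transport_def
  proof (intro conjI ballI allI)
    show "bij_betw (h \<circ> f) (carrier ?P) (carrier W)" by (rule bij_betw_trans[OF f(1) bij])
  qed (use f(2-5) fc h_add h_0 h_scal h_act in auto)
  note P = grep_transport_fd_grep[OF group_G W tr]
  show "is_fd_grep G ?P" by (rule P(1))
  show "irr_char G \<rho> t c triv i = K0_class G W"
    unfolding irr_char_def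
    by (rule K0_class_cong) (use P W in \<open>auto simp: is_fd_grep_def\<close>)
  show "irr_hilb G \<rho> t c triv i = vectorspace.dim base_field W"
    unfolding irr_hilb_def by (rule P(4))
qed

lemma (in lowest_weight_rep) irr_piece_zero:
  assumes "comp i = {0}"
  shows "is_fd_grep G (irr_piece G \<rho> t c triv i)"
    and "irr_char G \<rho> t c triv i = \<one>\<^bsub>K0 G\<^esub>"
    and "irr_hilb G \<rho> t c triv i = 0"
proof -
  let ?W = "zero_grep :: ('k, 'k^1, 'g) grep"
  have W: "carrier ?W = {0}" "\<zero>\<^bsub>?W\<^esub> = 0" "add ?W = (+)" "module.smult ?W = (*s)"
    "act ?W g v = v" for g v
    using matrix_grep_simps(5)[of triv g v] by (simp_all add: zero_grep_def)
  have bij: "bij_betw (\<lambda>_. 0) (comp i) (carrier ?W)" by (simp add: assms W bij_betw_def)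
  note iso = irr_piece_iso[OF zero_grep(1)[OF group_G] bij, unfolded W zero_grep(2,3)[OF group_G]]
  show "is_fd_grep G (irr_piece G \<rho> t c triv i)" by (rule iso(1)) simp_all
  show "irr_char G \<rho> t c triv i = \<one>\<^bsub>K0 G\<^esub>" by (rule iso(2)) simp_all
  show "irr_hilb G \<rho> t c triv i = 0" by (rule iso(3)) simp_all
qed

section \<open>The case of vanishing commutators\<close>

text \<open>
  The trivial representation of \<open>G\<close>, on which \<open>h\<close> and \<open>h\<^sup>*\<close> act by zero, is a lowest weight representation.
\<close>

lemma (in finite_SL) trivial_quotient:
  assumes zero: "\<And>y x. (\<Sum>s\<in>R. c s * pairing y (x - dual_rep G (\<lambda>g. g) s *v x)) = 0"
  shows "is_fd_grep G (irr_piece G (\<lambda>g. g) 0 c triv i)"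
    and "irr_char G (\<lambda>g. g) 0 c triv = series_of \<one>\<^bsub>K0 G\<^esub> [K0_class G (matrix_grep triv)]"
    and "irr_hilb G (\<lambda>g. g) 0 c triv = series_of 0 [1]"
proof -
  let ?comp = "\<lambda>i :: int. if i = 0 then UNIV else {0 :: 'k}"
  interpret T: rca_rep "(*)" G "\<lambda>g. g" 0 c "\<lambda>_ v. v" "\<lambda>_ _. 0" "\<lambda>_ _. 0"
    by unfold_locales
      (auto simp: algebra_simps matrix_rep_id sum_distrib_left[symmetric] sum_distrib_right[symmetric] zero)
  interpret T: lowest_weight_rep "(*)" G "\<lambda>g. g" 0 c "\<lambda>_ v. v" "\<lambda>_ _. 0" "\<lambda>_ _. 0" 1 "\<lambda>v. v" ?comp
  proof unfold_locales
    fix v :: 'k and i :: int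
    assume "v \<in> ?comp i"
    then show "\<exists>a\<in>homog i. v = T.alg_op a 1"
    proof (cases "i = 0")
      case True
      then show ?thesis
        using T.alg_op_scalar[of v 1] by (intro bexI[of _ "scalar v"]) (simp_all add: homog_scalar)
    next
      case False
      then have "v = 0" using \<open>v \<in> ?comp i\<close> by simp
      then show ?thesis by (intro bexI[of _ 0]) (simp_all add: homog_def)
    qed
  next
    fix v :: 'k assume "\<And>ys :: ('k^'n) list. foldr (\<lambda>_ _. 0) ys v = 0"
    from this[of "[]"] show "v = 0" by simp
  qed auto
  \<comment> \<open>for \<open>\<epsilon> = id\<close> this rule rewrites 0 to 0\<close>
  note T.eps_0 [simp del]
  have W: "is_fd_grep G (matrix_grep triv :: ('k, 'k^1, 'k^'n^'n) grep)"
    by (rule is_fd_grep_matrix_grep[OF matrix_rep_triv[OF group_G]])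
  have bij: "bij_betw (\<lambda>v. (\<chi> _. v) :: 'k^1) (?comp 0) (carrier (matrix_grep triv))"
    by (auto simp: bij_betw_def inj_on_def vec_eq_iff image_iff forall_1)
  note iso = T.irr_piece_iso[OF W bij]
  have 1: "is_fd_grep G (irr_piece G (\<lambda>g. g) 0 c triv 0)"
    by (rule iso(1)) (simp_all add: vec_eq_iff)
  have 2: "irr_char G (\<lambda>g. g) 0 c triv 0 = K0_class G (matrix_grep triv :: ('k, 'k^1, 'k^'n^'n) grep)"
    by (rule iso(2)) (simp_all add: vec_eq_iff)
  have "irr_hilb G (\<lambda>g. g) 0 c triv 0 = vectorspace.dim base_field (matrix_grep triv :: ('k, 'k^1, 'k^'n^'n) grep)"
    by (rule iso(3)) (simp_all add: vec_eq_iff)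
  then have 3: "irr_hilb G (\<lambda>g. g) 0 c triv 0 = 1" by (simp add: matrix_grep_dim(2))
  note P0 = 1 2 3
  have Pi: "is_fd_grep G (irr_piece G (\<lambda>g. g) 0 c triv i)"
    "irr_char G (\<lambda>g. g) 0 c triv i = \<one>\<^bsub>K0 G\<^esub>" "irr_hilb G (\<lambda>g. g) 0 c triv i = 0" if "i \<noteq> 0" for i
    using T.irr_piece_zero[of i] that by auto
  show "is_fd_grep G (irr_piece G (\<lambda>g. g) 0 c triv i)" using P0 Pi by (cases "i = 0") auto
  show "irr_char G (\<lambda>g. g) 0 c triv = series_of \<one>\<^bsub>K0 G\<^esub> [K0_class G (matrix_grep triv)]"
  proof
    fix d
    show "irr_char G (\<lambda>g. g) 0 c triv d = series_of \<one>\<^bsub>K0 G\<^esub> [K0_class G (matrix_grep triv)] d" using P0 Pi[of d] by (cases "d = 0") (auto simp: series_of_def)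
  qed
  show "irr_hilb G (\<lambda>g. g) 0 c triv = series_of 0 [1]"
  proof
    fix d
    show "irr_hilb G (\<lambda>g. g) 0 c triv d = series_of 0 [1] d" using P0 Pi[of d] by (cases "d = 0") (auto simp: series_of_def)
  qed
qed

section \<open>The group SL(2) over the field with two elements\<close>

type_synonym ('k, 'n) coinv = "'k \<times> ('k^'n) \<times> ('k^'n) \<times> 'k"

locale SL2_F2 = finite_SL F G for F :: "'k::field set" and G :: "('k^'n^'n) monoid" +
  fixes i j :: 'n
  assumes ij: "i \<noteq> j" and UNIV_ij: "(UNIV :: 'n set) = {i, j}"
    and char2: "(1 :: 'k) + 1 = 0" and F_eq: "F = {0, 1}"
begin

abbreviation dual :: "'k^'n^'n \<Rightarrow> 'k^'n^'n" where "dual \<equiv> dual_rep G (\<lambda>g. g)"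

lemma minus_char2: "- (x :: 'k) = x"
proof -
  have "x + x = x * (1 + 1)" by (simp add: distrib_left)
  then have "x + x = 0" using char2 by simp
  then show ?thesis by (rule minus_unique)
qed

lemma det_ij: "det A = A $ i $ i * A $ j $ j + A $ i $ j * A $ j $ i" for A :: "'k^'n^'n"
  using minus_char2[of "A $ i $ j * A $ j $ i"]
  by (simp add: det_two[OF ij UNIV_ij] diff_conv_add_uminus del: add_uminus_conv_diff)

lemma matrix_mult_ij: "(A ** B) $ a $ b = A $ a $ i * B $ i $ b + A $ a $ j * B $ j $ b" for A B :: "'k^'n^'n"
  using ij by (simp add: matrix_matrix_mult_def UNIV_ij)

lemma matrix_eq_ij: "A = B \<longleftrightarrow> A $ i $ i = B $ i $ i \<and> A $ i $ j = B $ i $ j \<and> A $ j $ i = B $ j $ i \<and> A $ j $ j = B $ j $ j"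
  for A B :: "'k^'n^'n"
proof -
  have "(\<forall>l. Q l) \<longleftrightarrow> Q i \<and> Q j" for Q using UNIV_ij by (metis UNIV_I insert_iff singletonD)
  then show ?thesis by (auto simp: vec_eq_iff)
qed

text \<open>
  In characteristic 2 the adjugate only exchanges the diagonal entries.
\<close>

lemma inv_ij:
  assumes g: "g \<in> carrier G"
  shows "(inv\<^bsub>G\<^esub> g) $ i $ i = g $ j $ j" "(inv\<^bsub>G\<^esub> g) $ j $ j = g $ i $ i"
    "(inv\<^bsub>G\<^esub> g) $ i $ j = g $ i $ j" "(inv\<^bsub>G\<^esub> g) $ j $ i = g $ j $ i"
proof -
  define A :: "'k^'n^'n" where
    "A = (\<chi> a b. if a = b then (if a = i then g $ j $ j else g $ i $ i) else g $ a $ b)"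
  have A: "A $ i $ i = g $ j $ j" "A $ j $ j = g $ i $ i" "A $ i $ j = g $ i $ j" "A $ j $ i = g $ j $ i"
    using ij by (simp_all add: A_def)
  have d: "g $ i $ i * g $ j $ j + g $ i $ j * g $ j $ i = 1" using g by (simp add: carrier_G det_ij)
  have AG: "A \<in> carrier G"
    unfolding carrier_G using g d by (auto simp: det_ij A mult.commute) (auto simp: A_def carrier_G)
  have two: "(2 :: 'k) = 0" using char2 by simp
  have "A ** g = mat 1"
    using d ij two by (simp add: matrix_eq_ij matrix_mult_ij A mat_def mult_ac add_ac)
  then have "inv\<^bsub>G\<^esub> g = A" using inv_equality[of A g] AG g by simp
  then show "(inv\<^bsub>G\<^esub> g) $ i $ i = g $ j $ j" "(inv\<^bsub>G\<^esub> g) $ j $ j = g $ i $ i"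
    "(inv\<^bsub>G\<^esub> g) $ i $ j = g $ i $ j" "(inv\<^bsub>G\<^esub> g) $ j $ i = g $ j $ i"
    using A by simp_all
qed

lemma dual_ij:
  assumes g: "g \<in> carrier G"
  shows "dual g $ i $ i = g $ j $ j" "dual g $ j $ j = g $ i $ i"
    "dual g $ i $ j = g $ j $ i" "dual g $ j $ i = g $ i $ j"
  by (simp_all add: dual_rep_def transpose_def inv_ij[OF g])

sublocale plane_F2 i j G dual
proof unfold_locales
  show "matrix_rep G dual" by (rule matrix_rep_dual[OF matrix_rep_id])
  show "dual g $ a $ b = 0 \<or> dual g $ a $ b = 1" if "g \<in> carrier G" for g a b
    using inv_closed[OF that] by (auto simp: dual_rep_def transpose_def carrier_G F_eq)
  show "dual g $ i $ i * dual g $ j $ j + dual g $ i $ j * dual g $ j $ i = 1" if "g \<in> carrier G" for g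
    using that by (simp add: dual_ij carrier_G det_ij mult.commute)
qed (use ij UNIV_ij char2 in auto)

lemma mult_vec_g: "g \<in> carrier G \<Longrightarrow> (g *v v) $ i = dual g $ j $ j * v $ i + dual g $ j $ i * v $ j"
  "g \<in> carrier G \<Longrightarrow> (g *v v) $ j = dual g $ i $ j * v $ i + dual g $ i $ i * v $ j"
  by (simp_all add: matrix_vector_mult_def sum_ij dual_ij)

definition swap :: "'k^'n^'n" where "swap = (\<chi> a b. if a = b then 0 else 1)"

lemma swap_ij: "swap $ i $ i = 0" "swap $ j $ j = 0" "swap $ i $ j = 1" "swap $ j $ i = 1"
  using ij by (simp_all add: swap_def)

lemma elem_ij: "elem i j 1 $ i $ i = 1" "elem i j 1 $ i $ j = 1" "elem i j 1 $ j $ i = 0" "elem i j 1 $ j $ j = 1"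
  "elem j i 1 $ i $ i = 1" "elem j i 1 $ i $ j = 0" "elem j i 1 $ j $ i = 1" "elem j i 1 $ j $ j = 1"
  using ij by (simp_all add: elem_def)

lemma transvections_G: "elem i j 1 \<in> carrier G" "elem j i 1 \<in> carrier G" "swap \<in> carrier G"
proof -
  show "elem i j 1 \<in> carrier G" "elem j i 1 \<in> carrier G" using ij by (auto intro: elem_G F_1)
  show "swap \<in> carrier G" unfolding carrier_G by (simp add: det_ij swap_ij) (simp add: swap_def F_eq)
qed

lemma outer_nth: "outer u a $ k $ l = u $ k * a $ l"
  by (simp add: outer_def)

text \<open>
  A reflection differs from 1 and has trace \<open>1 + 1 = 0\<close>, which excludes the two elements of order 3.
\<close>

lemma R_eq: "R = {elem i j 1, elem j i 1, swap}"
proof (intro equalityI subsetI)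
  fix s assume s: "s \<in> R"
  then have sG: "s \<in> carrier G" by (rule R_carrier)
  have tr: "s $ i $ i = s $ j $ j"
  proof -
    have "(1 - s $ i $ i) + (1 - s $ j $ j) = 0"
      using trace_reflection[OF ij UNIV_ij s] by (simp add: mat_def)
    then show ?thesis by (simp add: diff_conv_add_uminus add_ac add_eq_0_self del: add_uminus_conv_diff)
  qed
  have "s \<noteq> mat 1"
  proof
    assume "s = mat 1"
    then obtain u a where "u \<noteq> 0" "a \<noteq> 0" "outer u a = (0 :: 'k^'n^'n)"
      using s unfolding reflections_def mem_Collect_eq rank_1_iff_outer by (metis diff_self)
    then show False by (auto simp: outer_def vec_eq_iff)
  qed
  then show "s \<in> {elem i j 1, elem j i 1, swap}"
    using cases6[OF sG] tr ij
    unfolding dual_ij[OF sG] matrix_eq_ij insert_iff prod.inject empty_iff elem_ij swap_ij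
    by (elim disjE conjE FalseE) (simp_all add: mat_def)
next
  fix s assume "s \<in> {elem i j 1, elem j i 1, swap}"
  moreover have "rank (mat 1 - s) = 1 \<and> s \<in> carrier G \<longleftrightarrow> s \<in> R" for s by (auto simp: reflections_def)
  moreover have "mat 1 - elem i j 1 = outer (vec2 1 0) (vec2 0 1)" "mat 1 - elem j i 1 = outer (vec2 0 1) (vec2 1 0)"
    "mat 1 - swap = outer (vec2 1 1) (vec2 1 1)"
    using ij by (simp_all add: matrix_eq_ij elem_ij swap_ij outer_nth mat_def)
  moreover have "vec2 1 0 \<noteq> 0" "vec2 0 1 \<noteq> 0" "vec2 1 1 \<noteq> 0" by (simp_all add: vec_eq_ij)
  ultimately show "s \<in> R" unfolding rank_1_iff_outer using transvections_G by blast
qed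

lemma sum_R: "(\<Sum>s\<in>R. f s) = f (elem i j 1) + f (elem j i 1) + f swap" for f :: "'k^'n^'n \<Rightarrow> 'b::comm_monoid_add"
proof -
  have "elem i j 1 \<noteq> elem j i 1" "elem i j 1 \<noteq> swap" "elem j i 1 \<noteq> swap"
    by (simp_all add: matrix_eq_ij elem_ij swap_ij)
  then show ?thesis unfolding R_eq by (simp add: add.assoc)
qed

text \<open>
  The three transpositions of the symmetric group are conjugate.
\<close>

lemma conj_invariant_constant:
  assumes c: "conj_invariant G (\<lambda>g. g) c" and s: "s \<in> R"
  shows "c s = c swap"
proof -
  have conj: "c s = c s'" if "s \<in> R" "g \<in> carrier G" "s' \<in> carrier G" "g ** s = s' ** g" for g s s'
  proof -
    have "g ** s ** inv\<^bsub>G\<^esub> g = s'"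
      using that(2,4) inv_simps(2)[of g] by (simp add: matrix_mul_assoc[symmetric])
    then show ?thesis using c that(1,2) by (auto simp: conj_invariant_def)
  qed
  have m: "elem i j 1 \<in> R" "elem j i 1 \<in> R" by (simp_all add: R_eq)
  have "c (elem i j 1) = c (elem j i 1)"
    by (rule conj[OF m(1) transvections_G(3,2)]) (simp add: matrix_eq_ij matrix_mult_ij elem_ij swap_ij)
  moreover have "c (elem i j 1) = c swap"
    by (rule conj[OF m(1) transvections_G(2,3)]) (simp add: matrix_eq_ij matrix_mult_ij elem_ij swap_ij)
  ultimately show ?thesis using s by (auto simp: R_eq)
qed

text \<open>
  The quotient of \<open>k[x, y]\<close> by \<open>x\<^sup>2 + x y + y\<^sup>2\<close> and \<open>x\<^sup>2 y + x y\<^sup>2\<close> has the bases \<open>1\<close>; \<open>x, y\<close>;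
  \<open>x\<^sup>2, y\<^sup>2\<close>; \<open>x\<^sup>2 y\<close>, and \<open>(a, u, w, b)\<close> stands for
  \<open>a + (u\<^sub>i x + u\<^sub>j y) + (w\<^sub>i x\<^sup>2 + w\<^sub>j y\<^sup>2) + b x\<^sup>2 y\<close>.  Multiplication is determined by
  \<open>x y = x\<^sup>2 + y\<^sup>2\<close>, \<open>x\<^sup>3 = y\<^sup>3 = 0\<close> and \<open>x\<^sup>2 y = x y\<^sup>2\<close>.  The operators \<open>coinv_Y\<close> are the Dunkl operators
  \<open>\<kappa> \<Sum>\<^sub>s (y, \<alpha>\<^sub>s) (1 - s) / \<alpha>\<^sub>s\<close>, where signs disappear in characteristic 2.
\<close>

definition coinv_scal :: "'k \<Rightarrow> ('k, 'n) coinv \<Rightarrow> ('k, 'n) coinv" where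
  "coinv_scal r = (\<lambda>(a, u, w, b). (r * a, r *s u, r *s w, r * b))"

definition coinv_G :: "'k^'n^'n \<Rightarrow> ('k, 'n) coinv \<Rightarrow> ('k, 'n) coinv" where
  "coinv_G g = (\<lambda>(a, u, w, b). (a, dual g *v u, dual g *v w, b))"

definition coinv_X :: "'k^'n \<Rightarrow> ('k, 'n) coinv \<Rightarrow> ('k, 'n) coinv" where
  "coinv_X x = (\<lambda>(a, u, w, b). (0, a *s x,
     vec2 (x $ i * u $ i + x $ i * u $ j + x $ j * u $ i) (x $ j * u $ j + x $ i * u $ j + x $ j * u $ i),
     x $ i * w $ j + x $ j * w $ i))"

definition coinv_Y :: "'k \<Rightarrow> 'k^'n \<Rightarrow> ('k, 'n) coinv \<Rightarrow> ('k, 'n) coinv" where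
  "coinv_Y \<kappa> y = (\<lambda>(a, u, w, b). (\<kappa> * (y $ i * u $ i + y $ j * u $ j),
     \<kappa> *s vec2 (w $ i * (y $ i + y $ j) + w $ j * y $ j) (w $ i * y $ i + w $ j * (y $ i + y $ j)),
     (\<kappa> * b) *s vec2 (y $ j) (y $ i), 0))"

lemmas coinv_ops = coinv_scal_def coinv_G_def coinv_X_def coinv_Y_def

definition coinv_comp :: "int \<Rightarrow> (('k, 'n) coinv) set" where
  "coinv_comp d = (if d = 0 then {(a, 0, 0, 0) | a. True} else if d = 1 then {(0, u, 0, 0) | u. True}
     else if d = 2 then {(0, 0, w, 0) | w. True} else if d = 3 then {(0, 0, 0, b) | b. True} else {0})"

lemma pairing_ij: "pairing y x = y $ i * x $ i + y $ j * x $ j"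
  by (simp add: pairing_def sum_ij)

lemma dual_elem: "dual (elem i j 1) *v v = vec2 (v $ i) (v $ i + v $ j)"
  "dual (elem j i 1) *v v = vec2 (v $ i + v $ j) (v $ j)" "dual swap *v v = vec2 (v $ j) (v $ i)"
  using transvections_G by (simp_all add: vec_eq_ij mult_vec_ij dual_ij elem_ij swap_ij)

lemma numeral_char2 [simp]: "numeral (num.Bit0 w) = (0 :: 'k)" "numeral (num.Bit1 w) = (1 :: 'k)"
  unfolding numeral.simps by simp_all

lemma diff_char2: "(x :: 'k) - y = x + y"
  using minus_char2[of y] by (simp add: diff_conv_add_uminus del: add_uminus_conv_diff)

lemma diff_vec_char2: "(x :: 'k^'n) - y = x + y"
  by (simp add: vec_eq_iff diff_char2)

text \<open>
  The relations are checked on coordinates: those with \<open>G\<close> for each of the six group elements, the others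
  as identities between polynomials in characteristic 2.
\<close>

lemma coinvariant_rep:
  assumes c: "\<And>s. s \<in> R \<Longrightarrow> c s = \<kappa>"
  shows "rca_rep coinv_scal G (\<lambda>g. g) 0 c coinv_G coinv_X (coinv_Y \<kappa>)"
proof unfold_locales
  show "matrix_rep G (\<lambda>g. g)" by (rule matrix_rep_id)
  show "coinv_G \<one>\<^bsub>G\<^esub> v = v" for v
    using matrix_repD(2)[OF rep] by (cases v) (simp add: coinv_G_def)
  show "coinv_G g (coinv_Y \<kappa> y v) = coinv_Y \<kappa> (g *v y) (coinv_G g v)" if "g \<in> carrier G" for g y v
    using cases6[OF that] unfolding insert_iff prod.inject empty_iff
    by (cases v, elim disjE conjE FalseE)
       (simp_all add: coinv_ops vec_eq_ij mult_vec_ij mult_vec_g[OF that] algebra_simps)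
  show "coinv_G g (coinv_X x v) = coinv_X (dual g *v x) (coinv_G g v)" if "g \<in> carrier G" for g x v
    using cases6[OF that] unfolding insert_iff prod.inject empty_iff
    by (cases v, elim disjE conjE FalseE)
       (simp_all add: coinv_ops vec_eq_ij mult_vec_ij algebra_simps)
  show "coinv_X x (coinv_X x' v) = coinv_X x' (coinv_X x v)" for x x' v
    by (cases v) (simp add: coinv_ops vec_eq_ij algebra_simps)
  show "coinv_Y \<kappa> y (coinv_Y \<kappa> y' v) = coinv_Y \<kappa> y' (coinv_Y \<kappa> y v)" for y y' v
    by (cases v) (simp add: coinv_ops vec_eq_ij algebra_simps)
  show "coinv_Y \<kappa> y (coinv_X x v) - coinv_X x (coinv_Y \<kappa> y v) = coinv_scal (pairing y x * 0) v
          - (\<Sum>s\<in>R. coinv_scal (c s * pairing y (x - dual s *v x)) (coinv_G s v))" for x y v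
  proof -
    have const: "(\<Sum>s\<in>R. coinv_scal (c s * pairing y (x - dual s *v x)) (coinv_G s v))
      = (\<Sum>s\<in>R. coinv_scal (\<kappa> * pairing y (x - dual s *v x)) (coinv_G s v))"
      by (rule sum.cong) (simp_all add: c)
    show ?thesis unfolding const
      by (cases v) (simp add: sum_R coinv_ops dual_elem pairing_ij vec_eq_ij diff_char2 algebra_simps)
  qed
qed (auto simp: coinv_ops vec_eq_ij algebra_simps matrix_vector_right_distrib vector_scalar_commute
    matrix_repD(2,3)[OF rep] matrix_vector_mul_assoc G_simps[symmetric] simp del: G_simps)

lemma coinv_comp_simps: "v \<in> coinv_comp 0 \<longleftrightarrow> (\<exists>a. v = (a, 0, 0, 0))" "v \<in> coinv_comp 1 \<longleftrightarrow> (\<exists>u. v = (0, u, 0, 0))"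
  "v \<in> coinv_comp 2 \<longleftrightarrow> (\<exists>w. v = (0, 0, w, 0))" "v \<in> coinv_comp 3 \<longleftrightarrow> (\<exists>b. v = (0, 0, 0, b))"
  "d \<noteq> 0 \<Longrightarrow> d \<noteq> 1 \<Longrightarrow> d \<noteq> 2 \<Longrightarrow> d \<noteq> 3 \<Longrightarrow> v \<in> coinv_comp d \<longleftrightarrow> v = 0"
  by (auto simp: coinv_comp_def)

text \<open>
  A nonzero component in any degree can be brought to degree 0 by at most three Dunkl operators because
  \<open>\<kappa> \<noteq> 0\<close>, and the monomials of the basis generate the algebra from \<open>1\<close>.
\<close>

lemma coinvariant_lowest_weight:
  assumes c: "\<And>s. s \<in> R \<Longrightarrow> c s = \<kappa>" and \<kappa>: "\<kappa> \<noteq> 0"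
  shows "lowest_weight_rep coinv_scal G (\<lambda>g. g) 0 c coinv_G coinv_X (coinv_Y \<kappa>) (1, 0, 0, 0) fst coinv_comp"
proof -
  interpret rca_rep coinv_scal G "\<lambda>g. g" 0 c coinv_G coinv_X "coinv_Y \<kappa>" by (rule coinvariant_rep[OF c])
  have z: "vec2 0 0 = 0" by (simp add: vec_eq_ij)
  show ?thesis
  proof unfold_locales
    fix d :: int and v x assume "v \<in> coinv_comp d"
    then show "coinv_X x v \<in> coinv_comp (d + 1)"
      by (auto simp: coinv_comp_def coinv_X_def z zero_prod_def split: if_splits)
  next
    fix d :: int and v y assume "v \<in> coinv_comp d"
    then show "coinv_Y \<kappa> y v \<in> coinv_comp (d - 1)"
      by (auto simp: coinv_comp_def coinv_Y_def z zero_prod_def split: if_splits)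
  next
    fix v assume eps: "\<And>ys. fst (foldr (coinv_Y \<kappa>) ys v) = 0"
    obtain a u w b where v: "v = (a, u, w, b)" by (cases v)
    have "a = 0" using eps[of "[]"] by (simp add: v)
    moreover have "u = 0"
      using eps[of "[vec2 1 0]"] eps[of "[vec2 0 1]"] \<kappa> by (simp add: v coinv_Y_def vec_eq_ij)
    moreover have "w = 0"
      using eps[of "[vec2 1 0, vec2 1 0]"] eps[of "[vec2 0 1, vec2 0 1]"] \<kappa>
      by (simp add: v coinv_Y_def vec_eq_ij)
    moreover have "b = 0"
      using eps[of "[vec2 0 1, vec2 1 0, vec2 1 0]"] \<kappa> by (simp add: v coinv_Y_def)
    ultimately show "v = 0" by (simp add: v zero_prod_def)
  next
    fix d :: int and v assume v: "v \<in> coinv_comp d"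
    let ?\<Omega> = "(1, 0, 0, 0) :: ('k, 'n) coinv"
    have x: "alg_op (xgen l) v = coinv_X (axis l 1) v" for l v
      using alg_op_xvec[of "axis l 1" v] by (simp add: xvec_axis)
    have ax: "axis i 1 = vec2 1 0" "axis j 1 = vec2 0 1" using ij by (simp_all add: vec_eq_ij axis_def)
    have hx: "xgen l \<in> homog 1" for l :: 'n using homog_xvec[of "axis l 1"] by (simp add: xvec_axis)
    consider "d = 0" | "d = 1" | "d = 2" | "d = 3" | "d \<noteq> 0" "d \<noteq> 1" "d \<noteq> 2" "d \<noteq> 3" by blast
    then show "\<exists>a\<in>homog d. v = alg_op a ?\<Omega>"
    proof cases
      case 1
      then obtain a where "v = (a, 0, 0, 0)" using v by (auto simp: coinv_comp_simps)
      then have "v = alg_op (scalar a) ?\<Omega>" by (simp add: alg_op_scalar coinv_scal_def)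
      then show ?thesis using homog_scalar 1 by blast
    next
      case 2
      then obtain u where "v = (0, u, 0, 0)" using v by (auto simp: coinv_comp_simps)
      then have "v = alg_op (xvec u) ?\<Omega>" by (simp add: alg_op_xvec coinv_X_def z)
      then show ?thesis using homog_xvec 2 by blast
    next
      case 3
      then obtain w where "v = (0, 0, w, 0)" using v by (auto simp: coinv_comp_simps)
      then have "v = alg_op (scalar (w $ i) * (xgen i * xgen i) + scalar (w $ j) * (xgen j * xgen j)) ?\<Omega>"
        by (simp add: alg_op_add_left alg_op_mult alg_op_scalar x ax coinv_X_def coinv_scal_def vec_eq_ij
          del: word_mult_single)
      moreover have "scalar (w $ i) * (xgen i * xgen i) + scalar (w $ j) * (xgen j * xgen j) \<in> homog (0 + (1 + 1))"
        by (intro homog_add homog_mult homog_scalar hx)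
      ultimately show ?thesis using 3 by auto
    next
      case 4
      then obtain b where "v = (0, 0, 0, b)" using v by (auto simp: coinv_comp_simps)
      then have "v = alg_op (scalar b * (xgen i * (xgen j * xgen j))) ?\<Omega>"
        by (simp add: alg_op_mult alg_op_scalar x ax coinv_X_def coinv_scal_def vec_eq_ij del: word_mult_single)
      moreover have "scalar b * (xgen i * (xgen j * xgen j)) \<in> homog (0 + (1 + (1 + 1)))"
        by (intro homog_mult homog_scalar hx)
      ultimately show ?thesis using 4 by auto
    next
      case 5
      then have "v = alg_op 0 ?\<Omega>" using v by (simp add: coinv_comp_simps)
      moreover have "0 \<in> homog d" by (simp add: homog_def)
      ultimately show ?thesis by blast
    qed
  qed (auto simp: coinv_comp_def coinv_ops z zero_prod_def split: if_splits)
qed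

lemma coinvariant_quotient:
  assumes c: "\<And>s. s \<in> R \<Longrightarrow> c s = \<kappa>" and \<kappa>: "\<kappa> \<noteq> 0"
  shows "is_fd_grep G (irr_piece G (\<lambda>g. g) 0 c triv d)"
    and "irr_char G (\<lambda>g. g) 0 c triv = series_of \<one>\<^bsub>K0 G\<^esub>
          [K0_class G (matrix_grep triv),
           K0_class G (matrix_grep dual),
           K0_diff G (K0_class G (sym_power dual 2)) (K0_class G (matrix_grep triv)),
           K0_diff G (K0_diff G (K0_class G (sym_power dual 3)) (K0_class G (matrix_grep dual)))
                     (K0_class G (matrix_grep triv))]"
    and "irr_hilb G (\<lambda>g. g) 0 c triv = series_of 0 [1, 2, 2, 1]"
proof -
  interpret L: lowest_weight_rep coinv_scal G "\<lambda>g. g" 0 c coinv_G coinv_X "coinv_Y \<kappa>" "(1, 0, 0, 0)" fst coinv_comp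
    by (rule coinvariant_lowest_weight[OF c \<kappa>])
  let ?T = "matrix_grep triv :: ('k, 'k^1, 'k^'n^'n) grep" and ?D = "matrix_grep dual"
  let ?P = "irr_piece G (\<lambda>g. g) 0 c triv" and ?C = "irr_char G (\<lambda>g. g) 0 c triv"
    and ?H = "irr_hilb G (\<lambda>g. g) 0 c triv"
  have T: "is_fd_grep G ?T" by (rule is_fd_grep_matrix_grep[OF matrix_rep_triv[OF group_G]])
  have D: "is_fd_grep G ?D" by (rule is_fd_grep_matrix_grep[OF rep])
  have dT: "vectorspace.dim base_field ?T = 1" by (simp add: matrix_grep_dim(2))
  have dD: "vectorspace.dim base_field ?D = 2" using ij by (simp add: matrix_grep_dim(2) UNIV_ij)
  have k1: "v = (\<chi> _. v $ 1)" for v :: "'k^1" by (simp add: vec_eq_iff forall_1)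
  have "bij_betw (\<lambda>v. (\<chi> _. fst v) :: 'k^1) (coinv_comp 0) (carrier ?T)"
    by (rule bij_betw_byWitness[where f' = "\<lambda>v. (v $ 1, 0, 0, 0)"]) (auto simp: coinv_comp_simps k1[symmetric])
  note iso = L.irr_piece_iso[OF T this]
  have 0: "is_fd_grep G (?P 0)" by (rule iso(1)) (auto simp: coinv_comp_simps coinv_ops vec_eq_iff)
  have C0: "?C 0 = K0_class G ?T" by (rule iso(2)) (auto simp: coinv_comp_simps coinv_ops vec_eq_iff)
  have H0: "?H 0 = 1" unfolding dT[symmetric] by (rule iso(3)) (auto simp: coinv_comp_simps coinv_ops vec_eq_iff)
  have "bij_betw (\<lambda>v. fst (snd v)) (coinv_comp 1) (carrier ?D)"
    by (rule bij_betw_byWitness[where f' = "\<lambda>u. (0, u, 0, 0)"]) (auto simp: coinv_comp_simps)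
  note iso = L.irr_piece_iso[OF D this]
  have 1: "is_fd_grep G (?P 1)" by (rule iso(1)) (auto simp: coinv_comp_simps coinv_ops)
  have C1: "?C 1 = K0_class G ?D" by (rule iso(2)) (auto simp: coinv_comp_simps coinv_ops)
  have H1: "?H 1 = 2" unfolding dD[symmetric] by (rule iso(3)) (auto simp: coinv_comp_simps coinv_ops)
  have "bij_betw (\<lambda>v. fst (snd (snd v))) (coinv_comp 2) (carrier ?D)"
    by (rule bij_betw_byWitness[where f' = "\<lambda>w. (0, 0, w, 0)"]) (auto simp: coinv_comp_simps)
  note iso = L.irr_piece_iso[OF D this]
  have 2: "is_fd_grep G (?P 2)" by (rule iso(1)) (auto simp: coinv_comp_simps coinv_ops)
  have C2: "?C 2 = K0_class G ?D" by (rule iso(2)) (auto simp: coinv_comp_simps coinv_ops)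
  have H2: "?H 2 = 2" unfolding dD[symmetric] by (rule iso(3)) (auto simp: coinv_comp_simps coinv_ops)
  have "bij_betw (\<lambda>v. (\<chi> _. snd (snd (snd v))) :: 'k^1) (coinv_comp 3) (carrier ?T)"
    by (rule bij_betw_byWitness[where f' = "\<lambda>v. (0, 0, 0, v $ 1)"]) (auto simp: coinv_comp_simps k1[symmetric])
  note iso = L.irr_piece_iso[OF T this]
  have 3: "is_fd_grep G (?P 3)" by (rule iso(1)) (auto simp: coinv_comp_simps coinv_ops vec_eq_iff)
  have C3: "?C 3 = K0_class G ?T" by (rule iso(2)) (auto simp: coinv_comp_simps coinv_ops vec_eq_iff)
  have H3: "?H 3 = 1" unfolding dT[symmetric] by (rule iso(3)) (auto simp: coinv_comp_simps coinv_ops vec_eq_iff)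
  have else_piece: "is_fd_grep G (?P d)" "?C d = \<one>\<^bsub>K0 G\<^esub>" "?H d = 0"
    if "d \<noteq> 0" "d \<noteq> 1" "d \<noteq> 2" "d \<noteq> 3" for d
    using L.irr_piece_zero[of d] that by (auto simp: coinv_comp_def)
  note KT = K0_class_closed[OF group_G T] and KD = K0_class_closed[OF group_G D]
  interpret K: comm_group "K0 G :: (('k, 'k^'n^'n) std_grep \<Rightarrow>\<^sub>0 int) set monoid" by (rule comm_group_K0)
  have S2: "K0_diff G (K0_class G (sym_power dual 2)) (K0_class G ?T) = K0_class G ?D"
    unfolding K0_sym_2 by (rule K0_diff_mult[OF KT KD])
  have S3: "K0_diff G (K0_diff G (K0_class G (sym_power dual 3)) (K0_class G ?D)) (K0_class G ?T) = K0_class G ?T"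
    unfolding K0_sym_3 K0_mid K.m_assoc[OF KD KT KT] K0_diff_mult[OF KD K.m_closed[OF KT KT]]
    by (rule K0_diff_mult[OF KT KT])
  have cases: "d = 0 \<or> d = 1 \<or> d = 2 \<or> d = 3 \<or> d \<noteq> 0 \<and> d \<noteq> 1 \<and> d \<noteq> 2 \<and> d \<noteq> 3" for d :: int by blast
  show "is_fd_grep G (?P d)" using cases[of d] 0 1 2 3 else_piece(1) by blast
  have out: "series_of z [p0, p1, p2, p3] 0 = p0" "series_of z [p0, p1, p2, p3] 1 = p1"
    "series_of z [p0, p1, p2, p3] 2 = p2" "series_of z [p0, p1, p2, p3] 3 = p3"
    "d \<noteq> 0 \<Longrightarrow> d \<noteq> 1 \<Longrightarrow> d \<noteq> 2 \<Longrightarrow> d \<noteq> 3 \<Longrightarrow> series_of z [p0, p1, p2, p3] d = z"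
    for z p0 p1 p2 p3 :: 'x and d
    by (auto simp: series_of_def numeral_eq_Suc)
  show "?C = series_of \<one>\<^bsub>K0 G\<^esub>
          [K0_class G ?T, K0_class G ?D, K0_diff G (K0_class G (sym_power dual 2)) (K0_class G ?T),
           K0_diff G (K0_diff G (K0_class G (sym_power dual 3)) (K0_class G ?D)) (K0_class G ?T)]"
    unfolding S2 S3
  proof
    fix d
    show "?C d = series_of \<one>\<^bsub>K0 G\<^esub> [K0_class G ?T, K0_class G ?D, K0_class G ?D, K0_class G ?T] d"
      using cases[of d] C0 C1 C2 C3 else_piece(2)[of d] out by metis
  qed
  show "?H = series_of 0 [1, 2, 2, 1]"
  proof
    fix d
    show "?H d = series_of 0 [1, 2, 2, 1] d"
      using cases[of d] H0 H1 H2 H3 else_piece(3)[of d] out by metis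
  qed
qed

end

section \<open>The characters of the irreducible modules\<close>

theorem theorem5p6:
  fixes p q r :: nat
    and F :: "'k::alg_closed_field set"
    and c :: "'k^'n^'n \<Rightarrow> 'k"
    and G :: "('k^'n^'n) monoid"
    and \<rho> :: "'k^'n^'n \<Rightarrow> 'k^'n^'n"
  assumes "CHAR('k) = p" and "p > 0"
    and "r \<ge> 1" and "q = p ^ r"
    and "subfield F base_field" and "card F = q"
    and "CARD('n) \<ge> 2"
    and "G = SL F" and "\<rho> = (\<lambda>g. g)"
    and "conj_invariant G \<rho> c"
  shows
    "(\<forall>i. is_fd_grep G (irr_piece G \<rho> 0 c triv i))
   \<and> ((q, CARD('n)) \<noteq> (2, 2) \<longrightarrow>
        irr_char G \<rho> 0 c triv = series_of \<one>\<^bsub>K0 G\<^esub> [K0_class G (matrix_grep triv)]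
      \<and> irr_hilb G \<rho> 0 c triv = series_of 0 [1])
   \<and> ((q, CARD('n)) = (2, 2) \<and> (\<forall>s \<in> reflections G \<rho>. c s = 0) \<longrightarrow>
        irr_char G \<rho> 0 c triv = series_of \<one>\<^bsub>K0 G\<^esub> [K0_class G (matrix_grep triv)]
      \<and> irr_hilb G \<rho> 0 c triv = series_of 0 [1])
   \<and> ((q, CARD('n)) = (2, 2) \<and> \<not> (\<forall>s \<in> reflections G \<rho>. c s = 0) \<longrightarrow>
        irr_char G \<rho> 0 c triv = series_of \<one>\<^bsub>K0 G\<^esub>
          [K0_class G (matrix_grep triv),
           K0_class G (matrix_grep (dual_rep G \<rho>)),
           K0_diff G (K0_class G (sym_power (dual_rep G \<rho>) 2)) (K0_class G (matrix_grep triv)),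
           K0_diff G (K0_diff G (K0_class G (sym_power (dual_rep G \<rho>) 3))
                                (K0_class G (matrix_grep (dual_rep G \<rho>))))
                     (K0_class G (matrix_grep triv))]
      \<and> irr_hilb G \<rho> 0 c triv = series_of 0 [1, 2, 2, 1])"
proof -
  have q: "q > 0" using \<open>q = p ^ r\<close> \<open>p > 0\<close> by simp
  then have fin: "finite F" using \<open>card F = q\<close> card_gt_0_iff by blast
  interpret finite_SL F G
    by (rule finite_SL.intro[OF \<open>subfield F base_field\<close> fin \<open>G = SL F\<close>])
  have \<rho>: "\<rho> = (\<lambda>g. g)" and c: "conj_invariant G (\<lambda>g. g) c" using assms(9,10) by auto
  have generic: "(\<forall>i. is_fd_grep G (irr_piece G (\<lambda>g. g) 0 c triv i))
      \<and> irr_char G (\<lambda>g. g) 0 c triv = series_of \<one>\<^bsub>K0 G\<^esub> [K0_class G (matrix_grep triv)]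
      \<and> irr_hilb G (\<lambda>g. g) 0 c triv = series_of 0 [1]"
    if "(q, CARD('n)) \<noteq> (2, 2) \<or> (\<forall>s\<in>R. c s = 0)"
  proof -
    have zero: "(\<Sum>s\<in>R. c s * pairing y (x - dual_rep G (\<lambda>g. g) s *v x)) = 0" for x y
    proof (cases "\<forall>s\<in>R. c s = 0")
      case True
      then show ?thesis by (intro sum.neutral) simp
    next
      case False
      then have "(card F, CARD('n)) \<noteq> (2, 2)" using that \<open>card F = q\<close> by auto
      then show ?thesis
        by (intro commutator_sum_zero refl_sum_zero conj_invariant_conj_param c \<open>CARD('n) \<ge> 2\<close>)
    qed
    show ?thesis using trivial_quotient[OF zero] by blast
  qed
  have special: "(\<forall>i. is_fd_grep G (irr_piece G (\<lambda>g. g) 0 c triv i))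
      \<and> irr_char G (\<lambda>g. g) 0 c triv = series_of \<one>\<^bsub>K0 G\<^esub>
          [K0_class G (matrix_grep triv),
           K0_class G (matrix_grep (dual_rep G (\<lambda>g. g))),
           K0_diff G (K0_class G (sym_power (dual_rep G (\<lambda>g. g)) 2)) (K0_class G (matrix_grep triv)),
           K0_diff G (K0_diff G (K0_class G (sym_power (dual_rep G (\<lambda>g. g)) 3))
                                (K0_class G (matrix_grep (dual_rep G (\<lambda>g. g)))))
                     (K0_class G (matrix_grep triv))]
      \<and> irr_hilb G (\<lambda>g. g) 0 c triv = series_of 0 [1, 2, 2, 1]"
    if q2: "q = 2" and n2: "CARD('n) = 2" and c0: "\<not> (\<forall>s\<in>R. c s = 0)"
  proof -
    obtain i j :: 'n where ij: "i \<noteq> j" "(UNIV :: 'n set) = {i, j}" using n2 by (auto simp: card_2_iff)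
    have pr: "p ^ r = 2" using \<open>q = p ^ r\<close> q2 by simp
    then have "p dvd 2" using dvd_power[of r p] \<open>r \<ge> 1\<close> by simp
    moreover have "p \<noteq> 1" using pr by auto
    ultimately have "p = 2" using dvd_imp_le[of p 2] \<open>p > 0\<close> by simp
    then have "(1 :: 'k) + 1 = 0" using \<open>CHAR('k) = p\<close> of_nat_CHAR[where ?'a = 'k] by simp
    moreover have "F = {0, 1}"
      using card_subset_eq[OF fin, of "{0, 1}"] F_0 F_1 \<open>card F = q\<close> q2 by simp
    ultimately interpret SL2_F2 F G i j
      by (intro SL2_F2.intro SL2_F2_axioms.intro finite_SL_axioms ij)
    have const: "c s = c swap" if "s \<in> R" for s by (rule conj_invariant_constant[OF c that])
    then have "c swap \<noteq> 0" using c0 by metis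
    then show ?thesis using coinvariant_quotient[of c, OF const] by blast
  qed
  show ?thesis
    using generic special unfolding \<rho> prod.inject by blast
qed

end
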